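(* Let $(\mathfrak g,[\cdot,\cdot],\omega)$ be a unimodular symplectic Lie algebra which has a nonzero isotropic ideal. Then $(\mathfrak g,[\cdot,\cdot],\omega)$ is a symplectic double extension by a line or by a plane of a unimodular symplectic Lie algebra $(\mathfrak a,[\cdot,\cdot]_{\mathfrak a},\omega_{\mathfrak a})$.
   Context: All Lie algebras are real and finite-dimensional. A Lie algebra is unimodular if $\mathrm{tr}(\mathrm{ad}_x)=0$ for all $x$. A symplectic Lie algebra $(\mathfrak g,[\cdot,\cdot],\omega)$ is a Lie algebra with a nondegenerate skew-symmetric bilinear form $\omega$ satisfying $\omega([x,y],z)+\omega([y,z],x)+\omega([z,x],y)=0$ for all $x,y,z$. For a subspace $\mathfrak m$, $\mathfrak m^\perp=\{x:\omega(x,y)=0\ \forall y\in\mathfrak m\}$; $\mathfrak m$ is isotropic if $\mathfrak m\subset\mathfrak m^\perp$. The zero Lie algebra is allowed as a symplectic Lie algebra. Isomorphisms of symplectic Lie algebras are Lie algebra isomorphisms preserving the symplectic forms. In the two constructions that follow, brackets that are not listed are zero or given by skew-symmetry, and $x,y$ range over $\mathfrak a$. Double extension by a line. Let $(\mathfrak a,[\cdot,\cdot]_{\mathfrak a},\omega_{\mathfrak a})$ be a symplectic Lie algebra, $p,q\in\mathfrak a$, $D\in\mathfrak{gl}(\mathfrak a)$, $\varepsilon\in\mathbb R$. On $\mathfrak g=\mathbb R d_0\oplus\mathfrak a\oplus\mathbb R e_0$ put $[e_0,d_0]=\varepsilon e_0$, $[d_0,x]=\omega_{\mathfrak a}(p,x)d_0+D(x)+\omega_{\mathfrak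 a}(q,x)e_0$, $[x,e_0]=\omega_{\mathfrak a}(p,x)e_0$, $[x,y]=[x,y]_{\mathfrak a}+\big(\omega_{\mathfrak a}(D(x),y)+\omega_{\mathfrak a}(x,D(y))\big)e_0$, and let $\omega$ extend $\omega_{\mathfrak a}$ with $\omega(d_0,e_0)=1$ and $\mathfrak a\perp\mathrm{span}\{d_0,e_0\}$. When $(p,q,D,\varepsilon)$ is such that $(\mathfrak g,[\cdot,\cdot],\omega)$ is a symplectic Lie algebra, it is called a symplectic double extension of $(\mathfrak a,[\cdot,\cdot]_{\mathfrak a},\omega_{\mathfrak a})$ by a line. Double extension by a plane. Let $(\mathfrak a,[\cdot,\cdot]_{\mathfrak a},\omega_{\mathfrak a})$ be a symplectic Lie algebra, $a_0,a_1,b_0,b_1,b_2,z\in\mathfrak a$, $D_0,D_1\in\mathfrak{gl}(\mathfrak a)$, $\varepsilon_0,\dots,\varepsilon_5\in\mathbb R$. On $\mathfrak g=\mathbb R d_0\oplus\mathbb R d_1\oplus\mathfrak a\oplus\mathbb R e_0\oplus\mathbb R e_1$ put $[d_0,e_0]=\varepsilon_0e_0+\varepsilon_1e_1$, $[d_0,e_1]=-\varepsilon_1e_0+\varepsilon_0e_1$, $[d_1,e_0]=\varepsilon_2e_0+\varepsilon_3e_1$, $[d_1,e_1]=-\varepsilon_3e_0+\varepsilon_2e_1$, $[d_0,d_1]=(\varepsilon_2-\varepsilon_1)d_0-(\varepsilon_0+\varepsilon_3)d_1+z+\varepsilon_4e_0+\varepsilon_5e_1$, $[d_0,x]=\omega_{\mathfrak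 a}(a_0,x)d_0+\omega_{\mathfrak a}(a_1,x)d_1+D_0(x)+\omega_{\mathfrak a}(b_0,x)e_0+\omega_{\mathfrak a}(b_1,x)e_1$, $[d_1,x]=-\omega_{\mathfrak a}(a_1,x)d_0+\omega_{\mathfrak a}(a_0,x)d_1+D_1(x)+\omega_{\mathfrak a}(b_1+z,x)e_0+\omega_{\mathfrak a}(b_2,x)e_1$, $[e_0,x]=-\omega_{\mathfrak a}(a_0,x)e_0+\omega_{\mathfrak a}(a_1,x)e_1$, $[e_1,x]=-\omega_{\mathfrak a}(a_1,x)e_0-\omega_{\mathfrak a}(a_0,x)e_1$, $[x,y]=[x,y]_{\mathfrak a}+\sum_{k=0}^1\big(\omega_{\mathfrak a}(D_k(x),y)+\omega_{\mathfrak a}(x,D_k(y))\big)e_k$, and $\omega=\omega_{\mathfrak a}+d_0^*\wedge e_0^*+d_1^*\wedge e_1^*$. When the data are such that $(\mathfrak g,[\cdot,\cdot],\omega)$ is a symplectic Lie algebra, it is called a symplectic double extension of $(\mathfrak a,[\cdot,\cdot]_{\mathfrak a},\omega_{\mathfrak a})$ by a plane. "Is a symplectic double extension by a line (respectively, by a plane) of $(\mathfrak a,[\cdot,\cdot]_{\mathfrak a},\omega_{\mathfrak a})$" means: is isomorphic, as a symplectic Lie algebra, to a symplectic Lie algebra $\mathbb R d_0\oplus\mathfrak a\oplus\mathbb R e_0$ built from some data $(p,q,D,\varepsilon)$ by the line construction (respectively, to a symplectic Lie algebra $\mathbb R d_0\oplus\mathbb R d_1\oplus\mathfrak a\oplus\mathbb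 R e_0\oplus\mathbb R e_1$ built from some data $(a_0,a_1,b_0,b_1,b_2,z,D_0,D_1,\varepsilon_0,\dots,\varepsilon_5)$ by the plane construction). *)

theory Defs
  imports "HOL-Analysis.Analysis"
begin

text \<open>Lie algebras are given by a carrier subspace of an ambient real vector space; the bracket and the
  forms are only constrained on the carrier. This makes it possible to quantify existentially over
  Lie algebras, and it admits the zero Lie algebra.\<close>

definition linear_on ::
    "'a::real_vector set \<Rightarrow> 'b::real_vector set \<Rightarrow> ('a \<Rightarrow> 'b) \<Rightarrow> bool" where
  "linear_on V W f \<longleftrightarrow> f \<in> V \<rightarrow> W \<and>
     (\<forall>x\<in>V. \<forall>y\<in>V. f (x + y) = f x + f y) \<and> (\<forall>c. \<forall>x\<in>V. f (c *\<^sub>R x) = c *\<^sub>R f x)"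

definition bilinear_on ::
    "'a::real_vector set \<Rightarrow> 'b::real_vector set \<Rightarrow> ('a \<Rightarrow> 'a \<Rightarrow> 'b) \<Rightarrow> bool" where
  "bilinear_on V W f \<longleftrightarrow>
     (\<forall>x\<in>V. linear_on V W (f x)) \<and> (\<forall>y\<in>V. linear_on V W (\<lambda>x. f x y))"

text \<open>The value does not depend on the chosen basis, see \<open>trace_on_basis\<close> below.\<close>

definition trace_on :: "'a::real_vector set \<Rightarrow> ('a \<Rightarrow> 'a) \<Rightarrow> real" where
  "trace_on V f =
     (let B = (SOME B. independent B \<and> span B = V) in \<Sum>b\<in>B. representation B (f b) b)"

locale lie_algebra =
  fixes V :: "'a::real_vector set" and br :: "'a \<Rightarrow> 'a \<Rightarrow> 'a"
  assumes subspace_carrier: "subspace V"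
    and finite_dimensional: "\<exists>B. finite B \<and> span B = V"
    and bilinear_bracket: "bilinear_on V V br"
    and bracket_self: "x \<in> V \<Longrightarrow> br x x = 0"
    and jacobi: "x \<in> V \<Longrightarrow> y \<in> V \<Longrightarrow> z \<in> V \<Longrightarrow>
      br x (br y z) + br y (br z x) + br z (br x y) = 0"

locale symplectic_lie_algebra = lie_algebra V br
  for V :: "'a::real_vector set" and br :: "'a \<Rightarrow> 'a \<Rightarrow> 'a" +
  fixes \<omega> :: "'a \<Rightarrow> 'a \<Rightarrow> real"
  assumes bilinear_form: "bilinear_on V UNIV \<omega>"
    and form_skew: "x \<in> V \<Longrightarrow> y \<in> V \<Longrightarrow> \<omega> y x = - \<omega> x y"
    and form_nondegenerate: "x \<in> V \<Longrightarrow> (\<And>y. y \<in> V \<Longrightarrow> \<omega> x y = 0) \<Longrightarrow> x = 0"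
    and form_closed: "x \<in> V \<Longrightarrow> y \<in> V \<Longrightarrow> z \<in> V \<Longrightarrow>
      \<omega> (br x y) z + \<omega> (br y z) x + \<omega> (br z x) y = 0"

definition unimodular :: "'a::real_vector set \<Rightarrow> ('a \<Rightarrow> 'a \<Rightarrow> 'a) \<Rightarrow> bool" where
  "unimodular V br \<longleftrightarrow> (\<forall>x\<in>V. trace_on V (br x) = 0)"

definition lie_ideal :: "'a::real_vector set \<Rightarrow> ('a \<Rightarrow> 'a \<Rightarrow> 'a) \<Rightarrow> 'a set \<Rightarrow> bool" where
  "lie_ideal V br I \<longleftrightarrow> subspace I \<and> I \<subseteq> V \<and> (\<forall>x\<in>V. \<forall>y\<in>I. br x y \<in> I)"

definition perp :: "'a set \<Rightarrow> ('a \<Rightarrow> 'a \<Rightarrow> real) \<Rightarrow> 'a set \<Rightarrow> 'a set" where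
  "perp V \<omega> M = {x \<in> V. \<forall>y\<in>M. \<omega> x y = 0}"

definition isotropic :: "'a set \<Rightarrow> ('a \<Rightarrow> 'a \<Rightarrow> real) \<Rightarrow> 'a set \<Rightarrow> bool" where
  "isotropic V \<omega> M \<longleftrightarrow> M \<subseteq> perp V \<omega> M"

definition symplectic_lie_iso ::
    "'a::real_vector set \<Rightarrow> ('a \<Rightarrow> 'a \<Rightarrow> 'a) \<Rightarrow> ('a \<Rightarrow> 'a \<Rightarrow> real) \<Rightarrow>
     'b::real_vector set \<Rightarrow> ('b \<Rightarrow> 'b \<Rightarrow> 'b) \<Rightarrow> ('b \<Rightarrow> 'b \<Rightarrow> real) \<Rightarrow> ('a \<Rightarrow> 'b) \<Rightarrow> bool" where
  "symplectic_lie_iso V br \<omega> V' br' \<omega>' \<phi> \<longleftrightarrow> linear_on V V' \<phi> \<and> bij_betw \<phi> V V' \<and>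
     (\<forall>x\<in>V. \<forall>y\<in>V. \<phi> (br x y) = br' (\<phi> x) (\<phi> y)) \<and>
     (\<forall>x\<in>V. \<forall>y\<in>V. \<omega>' (\<phi> x) (\<phi> y) = \<omega> x y)"


section \<open>Double extension by a line\<close>

text \<open>\<open>(s, x, t)\<close> stands for \<open>s d\<^sub>0 + x + t e\<^sub>0\<close>. The bracket is the skew-symmetric bilinear
  extension of the defining relations, which are recovered in \<open>line_bracket_relations\<close> below.\<close>

definition line_carrier :: "'a set \<Rightarrow> (real \<times> 'a \<times> real) set" where
  "line_carrier A = UNIV \<times> A \<times> UNIV"

fun line_form ::
    "('a \<Rightarrow> 'a \<Rightarrow> real) \<Rightarrow> real \<times> 'a \<times> real \<Rightarrow> real \<times> 'a \<times> real \<Rightarrow> real" where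
  "line_form \<omega> (s, x, t) (s', x', t') = \<omega> x x' + (s * t' - t * s')"

fun line_bracket ::
    "('a::real_vector \<Rightarrow> 'a \<Rightarrow> 'a) \<Rightarrow> ('a \<Rightarrow> 'a \<Rightarrow> real) \<Rightarrow>
     'a \<Rightarrow> 'a \<Rightarrow> ('a \<Rightarrow> 'a) \<Rightarrow> real \<Rightarrow>
     real \<times> 'a \<times> real \<Rightarrow> real \<times> 'a \<times> real \<Rightarrow> real \<times> 'a \<times> real" where
  "line_bracket br \<omega> p q D \<epsilon> (s, x, t) (s', x', t') =
     (s * \<omega> p x' - s' * \<omega> p x,
      s *\<^sub>R D x' - s' *\<^sub>R D x + br x x',
      \<epsilon> * (t * s' - t' * s) + (s * \<omega> q x' - s' * \<omega> q x) + (t' * \<omega> p x - t * \<omega> p x')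
        + (\<omega> (D x) x' + \<omega> x (D x')))"

definition is_line_double_extension ::
    "'b::real_vector set \<Rightarrow> ('b \<Rightarrow> 'b \<Rightarrow> 'b) \<Rightarrow> ('b \<Rightarrow> 'b \<Rightarrow> real) \<Rightarrow>
     'a::real_vector set \<Rightarrow> ('a \<Rightarrow> 'a \<Rightarrow> 'a) \<Rightarrow> ('a \<Rightarrow> 'a \<Rightarrow> real) \<Rightarrow> bool" where
  "is_line_double_extension V br \<omega> A br\<^sub>A \<omega>\<^sub>A \<longleftrightarrow>
     symplectic_lie_algebra A br\<^sub>A \<omega>\<^sub>A \<and>
     (\<exists>p\<in>A. \<exists>q\<in>A. \<exists>D \<epsilon>. linear_on A A D \<and>
        symplectic_lie_algebra (line_carrier A) (line_bracket br\<^sub>A \<omega>\<^sub>A p q D \<epsilon>) (line_form \<omega>\<^sub>A) \<and>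
        (\<exists>\<phi>. symplectic_lie_iso V br \<omega>
           (line_carrier A) (line_bracket br\<^sub>A \<omega>\<^sub>A p q D \<epsilon>) (line_form \<omega>\<^sub>A) \<phi>))"


section \<open>Double extension by a plane\<close>

text \<open>\<open>(s\<^sub>0, s\<^sub>1, x, t\<^sub>0, t\<^sub>1)\<close> stands for \<open>s\<^sub>0 d\<^sub>0 + s\<^sub>1 d\<^sub>1 + x + t\<^sub>0 e\<^sub>0 + t\<^sub>1 e\<^sub>1\<close>. The bracket is the
  skew-symmetric bilinear extension of the defining relations, which are recovered in
  \<open>plane_bracket_relations\<close> below.\<close>

type_synonym 'a plane_ext = "real \<times> real \<times> 'a \<times> real \<times> real"

definition plane_carrier :: "'a set \<Rightarrow> 'a plane_ext set" where
  "plane_carrier A = UNIV \<times> UNIV \<times> A \<times> UNIV \<times> UNIV"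

fun plane_form :: "('a \<Rightarrow> 'a \<Rightarrow> real) \<Rightarrow> 'a plane_ext \<Rightarrow> 'a plane_ext \<Rightarrow> real" where
  "plane_form \<omega> (s\<^sub>0, s\<^sub>1, x, t\<^sub>0, t\<^sub>1) (s\<^sub>0', s\<^sub>1', x', t\<^sub>0', t\<^sub>1') =
     \<omega> x x' + (s\<^sub>0 * t\<^sub>0' - t\<^sub>0 * s\<^sub>0') + (s\<^sub>1 * t\<^sub>1' - t\<^sub>1 * s\<^sub>1')"

text \<open>The six scalars \<open>\<epsilon>\<^sub>0, \<dots>, \<epsilon>\<^sub>5\<close> are \<open>\<epsilon> 0, \<dots>, \<epsilon> 5\<close>.\<close>

fun plane_bracket ::
    "('a::real_vector \<Rightarrow> 'a \<Rightarrow> 'a) \<Rightarrow> ('a \<Rightarrow> 'a \<Rightarrow> real) \<Rightarrow>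
     'a \<Rightarrow> 'a \<Rightarrow> 'a \<Rightarrow> 'a \<Rightarrow> 'a \<Rightarrow> 'a \<Rightarrow> ('a \<Rightarrow> 'a) \<Rightarrow> ('a \<Rightarrow> 'a) \<Rightarrow> (nat \<Rightarrow> real) \<Rightarrow>
     'a plane_ext \<Rightarrow> 'a plane_ext \<Rightarrow> 'a plane_ext" where
  "plane_bracket br \<omega> a\<^sub>0 a\<^sub>1 b\<^sub>0 b\<^sub>1 b\<^sub>2 z D\<^sub>0 D\<^sub>1 \<epsilon> (s\<^sub>0, s\<^sub>1, x, t\<^sub>0, t\<^sub>1) (s\<^sub>0', s\<^sub>1', x', t\<^sub>0', t\<^sub>1') =
     ((\<epsilon> 2 - \<epsilon> 1) * (s\<^sub>0 * s\<^sub>1' - s\<^sub>0' * s\<^sub>1)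
        + (s\<^sub>0 * \<omega> a\<^sub>0 x' - s\<^sub>0' * \<omega> a\<^sub>0 x) - (s\<^sub>1 * \<omega> a\<^sub>1 x' - s\<^sub>1' * \<omega> a\<^sub>1 x),
      - (\<epsilon> 0 + \<epsilon> 3) * (s\<^sub>0 * s\<^sub>1' - s\<^sub>0' * s\<^sub>1)
        + (s\<^sub>0 * \<omega> a\<^sub>1 x' - s\<^sub>0' * \<omega> a\<^sub>1 x) + (s\<^sub>1 * \<omega> a\<^sub>0 x' - s\<^sub>1' * \<omega> a\<^sub>0 x),
      (s\<^sub>0 * s\<^sub>1' - s\<^sub>0' * s\<^sub>1) *\<^sub>R z
        + (s\<^sub>0 *\<^sub>R D\<^sub>0 x' - s\<^sub>0' *\<^sub>R D\<^sub>0 x) + (s\<^sub>1 *\<^sub>R D\<^sub>1 x' - s\<^sub>1' *\<^sub>R D\<^sub>1 x) + br x x',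
      \<epsilon> 4 * (s\<^sub>0 * s\<^sub>1' - s\<^sub>0' * s\<^sub>1)
        + \<epsilon> 0 * (s\<^sub>0 * t\<^sub>0' - s\<^sub>0' * t\<^sub>0) - \<epsilon> 1 * (s\<^sub>0 * t\<^sub>1' - s\<^sub>0' * t\<^sub>1)
        + \<epsilon> 2 * (s\<^sub>1 * t\<^sub>0' - s\<^sub>1' * t\<^sub>0) - \<epsilon> 3 * (s\<^sub>1 * t\<^sub>1' - s\<^sub>1' * t\<^sub>1)
        + (s\<^sub>0 * \<omega> b\<^sub>0 x' - s\<^sub>0' * \<omega> b\<^sub>0 x) + (s\<^sub>1 * \<omega> (b\<^sub>1 + z) x' - s\<^sub>1' * \<omega> (b\<^sub>1 + z) x)
        - (t\<^sub>0 * \<omega> a\<^sub>0 x' - t\<^sub>0' * \<omega> a\<^sub>0 x) - (t\<^sub>1 * \<omega> a\<^sub>1 x' - t\<^sub>1' * \<omega> a\<^sub>1 x)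
        + (\<omega> (D\<^sub>0 x) x' + \<omega> x (D\<^sub>0 x')),
      \<epsilon> 5 * (s\<^sub>0 * s\<^sub>1' - s\<^sub>0' * s\<^sub>1)
        + \<epsilon> 1 * (s\<^sub>0 * t\<^sub>0' - s\<^sub>0' * t\<^sub>0) + \<epsilon> 0 * (s\<^sub>0 * t\<^sub>1' - s\<^sub>0' * t\<^sub>1)
        + \<epsilon> 3 * (s\<^sub>1 * t\<^sub>0' - s\<^sub>1' * t\<^sub>0) + \<epsilon> 2 * (s\<^sub>1 * t\<^sub>1' - s\<^sub>1' * t\<^sub>1)
        + (s\<^sub>0 * \<omega> b\<^sub>1 x' - s\<^sub>0' * \<omega> b\<^sub>1 x) + (s\<^sub>1 * \<omega> b\<^sub>2 x' - s\<^sub>1' * \<omega> b\<^sub>2 x)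
        + (t\<^sub>0 * \<omega> a\<^sub>1 x' - t\<^sub>0' * \<omega> a\<^sub>1 x) - (t\<^sub>1 * \<omega> a\<^sub>0 x' - t\<^sub>1' * \<omega> a\<^sub>0 x)
        + (\<omega> (D\<^sub>1 x) x' + \<omega> x (D\<^sub>1 x')))"

definition is_plane_double_extension ::
    "'b::real_vector set \<Rightarrow> ('b \<Rightarrow> 'b \<Rightarrow> 'b) \<Rightarrow> ('b \<Rightarrow> 'b \<Rightarrow> real) \<Rightarrow>
     'a::real_vector set \<Rightarrow> ('a \<Rightarrow> 'a \<Rightarrow> 'a) \<Rightarrow> ('a \<Rightarrow> 'a \<Rightarrow> real) \<Rightarrow> bool" where
  "is_plane_double_extension V br \<omega> A br\<^sub>A \<omega>\<^sub>A \<longleftrightarrow>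
     symplectic_lie_algebra A br\<^sub>A \<omega>\<^sub>A \<and>
     (\<exists>a\<^sub>0\<in>A. \<exists>a\<^sub>1\<in>A. \<exists>b\<^sub>0\<in>A. \<exists>b\<^sub>1\<in>A. \<exists>b\<^sub>2\<in>A. \<exists>z\<in>A. \<exists>D\<^sub>0 D\<^sub>1 \<epsilon>.
        linear_on A A D\<^sub>0 \<and> linear_on A A D\<^sub>1 \<and>
        symplectic_lie_algebra (plane_carrier A)
          (plane_bracket br\<^sub>A \<omega>\<^sub>A a\<^sub>0 a\<^sub>1 b\<^sub>0 b\<^sub>1 b\<^sub>2 z D\<^sub>0 D\<^sub>1 \<epsilon>) (plane_form \<omega>\<^sub>A) \<and>
        (\<exists>\<phi>. symplectic_lie_iso V br \<omega>
           (plane_carrier A) (plane_bracket br\<^sub>A \<omega>\<^sub>A a\<^sub>0 a\<^sub>1 b\<^sub>0 b\<^sub>1 b\<^sub>2 z D\<^sub>0 D\<^sub>1 \<epsilon>) (plane_form \<omega>\<^sub>A) \<phi>))"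


section \<open>Consistency of the definitions\<close>

lemma linear_on_zero: "linear_on V W f \<Longrightarrow> 0 \<in> V \<Longrightarrow> f 0 = 0"
  unfolding linear_on_def by (metis scaleR_zero_left)

lemma linear_on_sum:
  assumes f: "linear_on V W f" and V: "subspace V" and "finite B" "B \<subseteq> V"
  shows "f (\<Sum>b\<in>B. c b *\<^sub>R b) = (\<Sum>b\<in>B. c b *\<^sub>R f b)"
  using \<open>finite B\<close> \<open>B \<subseteq> V\<close>
proof (induction B rule: finite_induct)
  case empty
  then show ?case using linear_on_zero[OF f] subspace_0[OF V] by simp
next
  case (insert b B)
  have "c b *\<^sub>R b \<in> V" "(\<Sum>b\<in>B. c b *\<^sub>R b) \<in> V"
    using insert V by (auto intro!: subspace_sum subspace_scale)
  then show ?case using insert f unfolding linear_on_def by auto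
qed

lemma trace_sum_basis_indep:
  fixes V :: "'a::real_vector set"
  assumes f: "linear_on V V f"
    and B: "independent B" "span B = V" "finite B"
    and C: "independent C" "span C = V" "finite C"
  shows "(\<Sum>b\<in>B. representation B (f b) b) = (\<Sum>c\<in>C. representation C (f c) c)"
proof -
  have V: "subspace V" using B(2) subspace_span by blast
  have sub: "B \<subseteq> V" "C \<subseteq> V" using B C span_superset by blast+
  have fV: "f x \<in> V" if "x \<in> V" for x using f that unfolding linear_on_def by auto
  have expB: "(\<Sum>b\<in>B. representation B v b *\<^sub>R b) = v"
    and expC: "(\<Sum>c\<in>C. representation C v c *\<^sub>R c) = v" if "v \<in> V" for v
    using that B C by (auto intro!: real_vector.sum_representation_eq)
  have repB: "representation B (\<Sum>x\<in>X. k x *\<^sub>R g x) b = (\<Sum>x\<in>X. k x * representation B (g x) b)"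
    if "g ` X \<subseteq> V" for X :: "'a set" and k g b
    using that B V
    by (subst real_vector.representation_sum)
       (auto intro!: span_scale sum.cong simp: real_vector.representation_scale image_subset_iff)
  have repC: "representation C (\<Sum>x\<in>X. k x *\<^sub>R g x) c = (\<Sum>x\<in>X. k x * representation C (g x) c)"
    if "g ` X \<subseteq> V" for X :: "'a set" and k g c
    using that C V
    by (subst real_vector.representation_sum)
       (auto intro!: span_scale sum.cong simp: real_vector.representation_scale image_subset_iff)
  have 1: "representation B (f b) b =
      (\<Sum>c\<in>C. \<Sum>d\<in>C. representation C b c * representation C (f c) d * representation B d b)"
    if b: "b \<in> B" for b
  proof -
    have "f b = (\<Sum>c\<in>C. representation C b c *\<^sub>R f c)"
      using linear_on_sum[OF f V C(3) sub(2), of "representation C b"] expC[of b] b sub by auto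
    moreover have "f ` C \<subseteq> V" using fV sub by blast
    ultimately have "representation B (f b) b = (\<Sum>c\<in>C. representation C b c * representation B (f c) b)"
      using repB by metis
    moreover have "representation B (f c) b = (\<Sum>d\<in>C. representation C (f c) d * representation B d b)"
      if "c \<in> C" for c
      using repB[of "\<lambda>x. x" C "representation C (f c)" b] expC[of "f c"] fV sub that by auto
    ultimately show ?thesis by (simp add: sum_distrib_left mult.assoc)
  qed
  have 2: "(\<Sum>b\<in>B. representation C b c * representation B d b) = (if d = c then 1 else 0)"
    if "c \<in> C" "d \<in> C" for c d
  proof -
    have "representation C d c = (\<Sum>b\<in>B. representation B d b * representation C b c)"
      using repC[of "\<lambda>x. x" B "representation B d" c] expB[of d] sub that by auto
    moreover have "representation C d c = (if d = c then 1 else 0)"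
      using real_vector.representation_basis[OF C(1) that(2)] by simp
    ultimately show ?thesis by (simp add: mult.commute)
  qed
  have "(\<Sum>b\<in>B. representation B (f b) b) =
      (\<Sum>c\<in>C. \<Sum>d\<in>C. \<Sum>b\<in>B. representation C b c * representation C (f c) d * representation B d b)"
    using 1 by (simp add: sum.swap[of _ _ B])
  also have "\<dots> = (\<Sum>c\<in>C. \<Sum>d\<in>C. representation C (f c) d *
      (\<Sum>b\<in>B. representation C b c * representation B d b))"
    by (simp add: sum_distrib_left mult_ac)
  also have "\<dots> = (\<Sum>c\<in>C. \<Sum>d\<in>C. if d = c then representation C (f c) d else 0)"
    using 2 by (intro sum.cong refl) auto
  also have "\<dots> = (\<Sum>c\<in>C. representation C (f c) c)"
    using C(3) by (simp add: sum.delta)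
  finally show ?thesis .
qed

lemma trace_on_basis:
  assumes "linear_on V V f" "independent B" "span B = V" "finite B"
  shows "trace_on V f = (\<Sum>b\<in>B. representation B (f b) b)"
proof -
  define C where "C = (SOME C. independent C \<and> span C = V)"
  have C: "independent C \<and> span C = V"
    unfolding C_def by (rule someI[of _ B]) (use assms in auto)
  then have "finite C"
    using assms independent_span_bound[of B C] span_superset by blast
  then show ?thesis
    using trace_sum_basis_indep[OF assms(1) _ _ _ assms(2-4), of C] C
    by (simp add: trace_on_def Let_def flip: C_def)
qed

lemma line_bracket_relations:
  fixes \<epsilon> :: real
  assumes "symplectic_lie_algebra A br \<omega>" "p \<in> A" "q \<in> A" "linear_on A A D" "x \<in> A" "y \<in> A"
  defines "B \<equiv> line_bracket br \<omega> p q D \<epsilon>"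
    and "d\<^sub>0 \<equiv> (1, 0, 0)" and "e\<^sub>0 \<equiv> (0, 0, 1)" and "\<iota> \<equiv> \<lambda>x. (0, x, 0)"
  shows "B e\<^sub>0 d\<^sub>0 = \<epsilon> *\<^sub>R e\<^sub>0"
    and "B d\<^sub>0 (\<iota> x) = \<omega> p x *\<^sub>R d\<^sub>0 + \<iota> (D x) + \<omega> q x *\<^sub>R e\<^sub>0"
    and "B (\<iota> x) e\<^sub>0 = \<omega> p x *\<^sub>R e\<^sub>0"
    and "B (\<iota> x) (\<iota> y) = \<iota> (br x y) + (\<omega> (D x) y + \<omega> x (D y)) *\<^sub>R e\<^sub>0"
proof -
  interpret symplectic_lie_algebra A br \<omega> by fact
  have 0: "0 \<in> A" using subspace_0[OF subspace_carrier] .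
  have DA: "D u \<in> A" if "u \<in> A" for u using assms(4) that by (auto simp: linear_on_def)
  have z: "D 0 = 0" "\<And>u. u \<in> A \<Longrightarrow> \<omega> u 0 = 0" "\<And>u. u \<in> A \<Longrightarrow> \<omega> 0 u = 0"
      "\<And>u. u \<in> A \<Longrightarrow> br u 0 = 0" "\<And>u. u \<in> A \<Longrightarrow> br 0 u = 0"
    using bilinear_form bilinear_bracket assms(4) 0 linear_on_zero
    unfolding bilinear_on_def by (blast, blast, fastforce, blast, fastforce)
  show "B e\<^sub>0 d\<^sub>0 = \<epsilon> *\<^sub>R e\<^sub>0" "B d\<^sub>0 (\<iota> x) = \<omega> p x *\<^sub>R d\<^sub>0 + \<iota> (D x) + \<omega> q x *\<^sub>R e\<^sub>0"
    "B (\<iota> x) e\<^sub>0 = \<omega> p x *\<^sub>R e\<^sub>0"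
    "B (\<iota> x) (\<iota> y) = \<iota> (br x y) + (\<omega> (D x) y + \<omega> x (D y)) *\<^sub>R e\<^sub>0"
    using assms(2,3,5,6) 0 DA by (simp_all add: B_def d\<^sub>0_def e\<^sub>0_def \<iota>_def z)
qed

lemma line_bracket_skew:
  assumes "symplectic_lie_algebra A br \<omega>" "linear_on A A D" "u \<in> line_carrier A" "v \<in> line_carrier A"
  shows "line_bracket br \<omega> p q D \<epsilon> v u = - line_bracket br \<omega> p q D \<epsilon> u v"
proof -
  interpret symplectic_lie_algebra A br \<omega> by fact
  obtain s x t where u: "u = (s, x, t)" "x \<in> A" using assms(3) by (auto simp: line_carrier_def)
  obtain s' x' t' where v: "v = (s', x', t')" "x' \<in> A" using assms(4) by (auto simp: line_carrier_def)
  have add: "x + x' \<in> A" using u v subspace_add[OF subspace_carrier] by blast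
  have "br (x + x') (x + x') = br x x + br x x' + (br x' x + br x' x')"
    using bilinear_bracket u v add unfolding bilinear_on_def linear_on_def by simp
  then have br: "br x' x = - br x x'"
    using bracket_self u v add by (simp add: eq_neg_iff_add_eq_0 add.commute)
  have D: "D x \<in> A" "D x' \<in> A" using assms(2) u v by (auto simp: linear_on_def)
  show ?thesis
    using form_skew[OF \<open>D x \<in> A\<close> v(2)] form_skew[OF u(2) \<open>D x' \<in> A\<close>]
    by (simp add: u v br algebra_simps)
qed

lemma plane_bracket_relations:
  fixes \<epsilon> :: "nat \<Rightarrow> real"
  assumes "symplectic_lie_algebra A br \<omega>" "a\<^sub>0 \<in> A" "a\<^sub>1 \<in> A" "b\<^sub>0 \<in> A" "b\<^sub>1 \<in> A" "b\<^sub>2 \<in> A" "z \<in> A"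
    "linear_on A A D\<^sub>0" "linear_on A A D\<^sub>1" "x \<in> A" "y \<in> A"
  defines "B \<equiv> plane_bracket br \<omega> a\<^sub>0 a\<^sub>1 b\<^sub>0 b\<^sub>1 b\<^sub>2 z D\<^sub>0 D\<^sub>1 \<epsilon>"
    and "d\<^sub>0 \<equiv> (1, 0, 0, 0, 0)" and "d\<^sub>1 \<equiv> (0, 1, 0, 0, 0)"
    and "e\<^sub>0 \<equiv> (0, 0, 0, 1, 0)" and "e\<^sub>1 \<equiv> (0, 0, 0, 0, 1)"
    and "\<iota> \<equiv> \<lambda>x. (0, 0, x, 0, 0)"
  shows "B d\<^sub>0 e\<^sub>0 = \<epsilon> 0 *\<^sub>R e\<^sub>0 + \<epsilon> 1 *\<^sub>R e\<^sub>1"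
    and "B d\<^sub>0 e\<^sub>1 = - \<epsilon> 1 *\<^sub>R e\<^sub>0 + \<epsilon> 0 *\<^sub>R e\<^sub>1"
    and "B d\<^sub>1 e\<^sub>0 = \<epsilon> 2 *\<^sub>R e\<^sub>0 + \<epsilon> 3 *\<^sub>R e\<^sub>1"
    and "B d\<^sub>1 e\<^sub>1 = - \<epsilon> 3 *\<^sub>R e\<^sub>0 + \<epsilon> 2 *\<^sub>R e\<^sub>1"
    and "B d\<^sub>0 d\<^sub>1 =
      (\<epsilon> 2 - \<epsilon> 1) *\<^sub>R d\<^sub>0 - (\<epsilon> 0 + \<epsilon> 3) *\<^sub>R d\<^sub>1 + \<iota> z + \<epsilon> 4 *\<^sub>R e\<^sub>0 + \<epsilon> 5 *\<^sub>R e\<^sub>1"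
    and "B d\<^sub>0 (\<iota> x) =
      \<omega> a\<^sub>0 x *\<^sub>R d\<^sub>0 + \<omega> a\<^sub>1 x *\<^sub>R d\<^sub>1 + \<iota> (D\<^sub>0 x) + \<omega> b\<^sub>0 x *\<^sub>R e\<^sub>0 + \<omega> b\<^sub>1 x *\<^sub>R e\<^sub>1"
    and "B d\<^sub>1 (\<iota> x) =
      - \<omega> a\<^sub>1 x *\<^sub>R d\<^sub>0 + \<omega> a\<^sub>0 x *\<^sub>R d\<^sub>1 + \<iota> (D\<^sub>1 x) + \<omega> (b\<^sub>1 + z) x *\<^sub>R e\<^sub>0 + \<omega> b\<^sub>2 x *\<^sub>R e\<^sub>1"
    and "B e\<^sub>0 (\<iota> x) = - \<omega> a\<^sub>0 x *\<^sub>R e\<^sub>0 + \<omega> a\<^sub>1 x *\<^sub>R e\<^sub>1"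
    and "B e\<^sub>1 (\<iota> x) = - \<omega> a\<^sub>1 x *\<^sub>R e\<^sub>0 - \<omega> a\<^sub>0 x *\<^sub>R e\<^sub>1"
    and "B (\<iota> x) (\<iota> y) = \<iota> (br x y)
      + (\<omega> (D\<^sub>0 x) y + \<omega> x (D\<^sub>0 y)) *\<^sub>R e\<^sub>0 + (\<omega> (D\<^sub>1 x) y + \<omega> x (D\<^sub>1 y)) *\<^sub>R e\<^sub>1"
    and "B e\<^sub>0 e\<^sub>1 = 0"
proof -
  interpret symplectic_lie_algebra A br \<omega> by fact
  have 0: "0 \<in> A" using subspace_0[OF subspace_carrier] .
  have bz: "b\<^sub>1 + z \<in> A" using assms subspace_add[OF subspace_carrier] by blast
  have DA: "D\<^sub>0 u \<in> A" "D\<^sub>1 u \<in> A" if "u \<in> A" for u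
    using assms(8,9) that by (auto simp: linear_on_def)
  have zz: "D\<^sub>0 0 = 0" "D\<^sub>1 0 = 0" "\<And>u. u \<in> A \<Longrightarrow> \<omega> u 0 = 0" "\<And>u. u \<in> A \<Longrightarrow> \<omega> 0 u = 0"
      "\<And>u. u \<in> A \<Longrightarrow> br u 0 = 0" "\<And>u. u \<in> A \<Longrightarrow> br 0 u = 0"
    using bilinear_form bilinear_bracket assms(8,9) 0 linear_on_zero
    unfolding bilinear_on_def by (blast, blast, blast, fastforce, blast, fastforce)
  note defs = B_def d\<^sub>0_def d\<^sub>1_def e\<^sub>0_def e\<^sub>1_def \<iota>_def
  show "B d\<^sub>0 e\<^sub>0 = \<epsilon> 0 *\<^sub>R e\<^sub>0 + \<epsilon> 1 *\<^sub>R e\<^sub>1"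
    "B d\<^sub>0 e\<^sub>1 = - \<epsilon> 1 *\<^sub>R e\<^sub>0 + \<epsilon> 0 *\<^sub>R e\<^sub>1"
    "B d\<^sub>1 e\<^sub>0 = \<epsilon> 2 *\<^sub>R e\<^sub>0 + \<epsilon> 3 *\<^sub>R e\<^sub>1"
    "B d\<^sub>1 e\<^sub>1 = - \<epsilon> 3 *\<^sub>R e\<^sub>0 + \<epsilon> 2 *\<^sub>R e\<^sub>1"
    "B d\<^sub>0 d\<^sub>1 =
      (\<epsilon> 2 - \<epsilon> 1) *\<^sub>R d\<^sub>0 - (\<epsilon> 0 + \<epsilon> 3) *\<^sub>R d\<^sub>1 + \<iota> z + \<epsilon> 4 *\<^sub>R e\<^sub>0 + \<epsilon> 5 *\<^sub>R e\<^sub>1"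
    "B d\<^sub>0 (\<iota> x) =
      \<omega> a\<^sub>0 x *\<^sub>R d\<^sub>0 + \<omega> a\<^sub>1 x *\<^sub>R d\<^sub>1 + \<iota> (D\<^sub>0 x) + \<omega> b\<^sub>0 x *\<^sub>R e\<^sub>0 + \<omega> b\<^sub>1 x *\<^sub>R e\<^sub>1"
    "B d\<^sub>1 (\<iota> x) =
      - \<omega> a\<^sub>1 x *\<^sub>R d\<^sub>0 + \<omega> a\<^sub>0 x *\<^sub>R d\<^sub>1 + \<iota> (D\<^sub>1 x) + \<omega> (b\<^sub>1 + z) x *\<^sub>R e\<^sub>0 + \<omega> b\<^sub>2 x *\<^sub>R e\<^sub>1"
    "B e\<^sub>0 (\<iota> x) = - \<omega> a\<^sub>0 x *\<^sub>R e\<^sub>0 + \<omega> a\<^sub>1 x *\<^sub>R e\<^sub>1"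
    "B e\<^sub>1 (\<iota> x) = - \<omega> a\<^sub>1 x *\<^sub>R e\<^sub>0 - \<omega> a\<^sub>0 x *\<^sub>R e\<^sub>1"
    "B (\<iota> x) (\<iota> y) = \<iota> (br x y)
      + (\<omega> (D\<^sub>0 x) y + \<omega> x (D\<^sub>0 y)) *\<^sub>R e\<^sub>0 + (\<omega> (D\<^sub>1 x) y + \<omega> x (D\<^sub>1 y)) *\<^sub>R e\<^sub>1"
    "B e\<^sub>0 e\<^sub>1 = 0"
    using assms(2-7,10,11) 0 bz DA by (simp_all add: defs zz zero_prod_def)
qed

lemma plane_bracket_skew:
  assumes "symplectic_lie_algebra A br \<omega>" "linear_on A A D\<^sub>0" "linear_on A A D\<^sub>1"
    "u \<in> plane_carrier A" "v \<in> plane_carrier A"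
  shows "plane_bracket br \<omega> a\<^sub>0 a\<^sub>1 b\<^sub>0 b\<^sub>1 b\<^sub>2 z D\<^sub>0 D\<^sub>1 \<epsilon> v u =
    - plane_bracket br \<omega> a\<^sub>0 a\<^sub>1 b\<^sub>0 b\<^sub>1 b\<^sub>2 z D\<^sub>0 D\<^sub>1 \<epsilon> u v"
proof -
  interpret symplectic_lie_algebra A br \<omega> by fact
  obtain s\<^sub>0 s\<^sub>1 x t\<^sub>0 t\<^sub>1 where u: "u = (s\<^sub>0, s\<^sub>1, x, t\<^sub>0, t\<^sub>1)" "x \<in> A"
    using assms(4) by (auto simp: plane_carrier_def)
  obtain s\<^sub>0' s\<^sub>1' x' t\<^sub>0' t\<^sub>1' where v: "v = (s\<^sub>0', s\<^sub>1', x', t\<^sub>0', t\<^sub>1')" "x' \<in> A"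
    using assms(5) by (auto simp: plane_carrier_def)
  have add: "x + x' \<in> A" using u v subspace_add[OF subspace_carrier] by blast
  have "br (x + x') (x + x') = br x x + br x x' + (br x' x + br x' x')"
    using bilinear_bracket u v add unfolding bilinear_on_def linear_on_def by simp
  then have br: "br x' x = - br x x'"
    using bracket_self u v add by (simp add: eq_neg_iff_add_eq_0 add.commute)
  have D: "D\<^sub>0 x \<in> A" "D\<^sub>0 x' \<in> A" "D\<^sub>1 x \<in> A" "D\<^sub>1 x' \<in> A"
    using assms(2,3) u v by (auto simp: linear_on_def)
  show ?thesis
    using form_skew[OF D(1) v(2)] form_skew[OF u(2) D(2)] form_skew[OF D(3) v(2)] form_skew[OF u(2) D(4)]
    by (simp add: u v br algebra_simps)
qed

end

theory Submission
  imports Defs "HOL-Computational_Algebra.Fundamental_Theorem_Algebra"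
begin

text \<open>A unimodular symplectic Lie algebra is solvable, so by Lie's theorem the complexification of the
  given isotropic ideal contains a common eigenvector \<open>u + \<i> v\<close> of the adjoint representation.
  The real span of \<open>u\<close> and \<open>v\<close> is an isotropic ideal of dimension one or two on which
  \<open>V\<close> acts by complex scalars, and the symplectic reduction by this ideal
  exhibits \<open>V\<close> as a double extension by a line or by a plane.

  Solvability avoids the Levi decomposition. A nonsolvable complex Lie algebra has a minimal nonzero
  perfect subalgebra \<open>S\<close>, all of whose proper subalgebras are solvable. A maximal one has
  codimension one, and triangularizing it shows that the trace form of a nontrivial irreducible
  representation of \<open>S\<close> is nonzero; the Casimir operator then shows that the cocycle
  \<open>\<omega>\<close> of \<open>S\<close> with values in \<open>V\<^sup>*\<close> is exact, that is,
  \<open>\<omega> x z = \<omega> y [x, z]\<close> for some \<open>y\<close> and all \<open>x\<close> in \<open>S\<close>.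
  In terms of the left-symmetric product of the flat symplectic connection this says that the right
  multiplication by \<open>y\<close> is \<open>-1\<close> on \<open>S\<close>, whereas unimodularity makes it
  nilpotent.\<close>

section \<open>Traces and dual families on finite-dimensional subspaces\<close>

text \<open>S is only known to be perfect with solvable proper subalgebras; it need not be simple,
  and its trace form on an irreducible M may be degenerate. The Casimir argument survives because
  the radical T of the form is a proper ideal, hence solvable. T acts trivially on M, since its
  common weight space is all of M and a perfect algebra acts by traceless operators. A cocycle
  vanishes on T, since otherwise a proper subalgebra would supplement T in S. So everything factors
  through S/T, where the form is nondegenerate. The trace form is nonzero because the diagonal
  entries of the subalgebra of codimension one, along the chain v, e v, e (e v), ..., form an
  arithmetic progression: if their sum and their sum of squares vanish and M has dimension at least
  two, the progression is constant, the subalgebra is an ideal, and S is not perfect. Isotropy of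
  the given ideal enters only as \<open>\<omega> u v = 0\<close>: it makes the span of u and v
  isotropic, hence half of a hyperbolic subspace whose orthogonal complement carries the reduced
  algebra.\<close>

no_notation vector_scalar_mult (infixl "*s" 70)

text \<open>The same trace theory is used over the reals and over the complex numbers, so the
  scalars are a parameter. The ambient type may be infinite-dimensional; finiteness is imposed on
  subspaces by \<open>fd\<close>.\<close>

locale vspace = vector_space scale
  for scale :: "'a::field \<Rightarrow> 'b::ab_group_add \<Rightarrow> 'b"  (infixr "*s" 75)
begin

abbreviation lin :: "('b \<Rightarrow> 'b) \<Rightarrow> bool" where
  "lin \<equiv> Vector_Spaces.linear scale scale"

abbreviation lfun :: "('b \<Rightarrow> 'a) \<Rightarrow> bool" where
  "lfun \<equiv> Vector_Spaces.linear scale (*)"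

lemma lin_iff: "lin f \<longleftrightarrow> (\<forall>x y. f (x + y) = f x + f y) \<and> (\<forall>c x. f (c *s x) = c *s f x)"
  using vector_space_axioms by (auto simp: Vector_Spaces.linear_iff)

lemma vector_space_field: "vector_space ((*) :: 'a \<Rightarrow> 'a \<Rightarrow> 'a)"
  by unfold_locales (auto simp: algebra_simps)

lemma lfun_iff: "lfun f \<longleftrightarrow> (\<forall>x y. f (x + y) = f x + f y) \<and> (\<forall>c x. f (c *s x) = c * f x)"
  using vector_space_axioms vector_space_field by (auto simp: Vector_Spaces.linear_iff)

lemma
  assumes "lin f"
  shows lin_add: "f (x + y) = f x + f y"
    and lin_scale: "f (c *s x) = c *s f x"
    and lin_zero: "f 0 = 0"
    and lin_diff: "f (x - y) = f x - f y"
    and lin_minus: "f (- x) = - f x"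
    and lin_sum: "f (sum g I) = (\<Sum>i\<in>I. f (g i))"
proof -
  interpret Vector_Spaces.linear scale scale f by fact
  show "f (x + y) = f x + f y" "f (c *s x) = c *s f x" "f 0 = 0" "f (x - y) = f x - f y"
    "f (- x) = - f x" "f (sum g I) = (\<Sum>i\<in>I. f (g i))"
    by (simp_all add: add scale diff neg sum)
qed

lemma
  assumes "lfun f"
  shows lfun_add: "f (x + y) = f x + f y"
    and lfun_scale: "f (c *s x) = c * f x"
    and lfun_zero: "f 0 = 0"
    and lfun_diff: "f (x - y) = f x - f y"
    and lfun_minus: "f (- x) = - f x"
    and lfun_sum: "f (sum g I) = (\<Sum>i\<in>I. f (g i))"
proof -
  interpret Vector_Spaces.linear scale "(*)" f by fact
  show "f (x + y) = f x + f y" "f (c *s x) = c * f x" "f 0 = 0" "f (x - y) = f x - f y"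
    "f (- x) = - f x" "f (sum g I) = (\<Sum>i\<in>I. f (g i))"
    by (simp_all add: add scale diff neg sum)
qed

lemma lin_compose: "lin f \<Longrightarrow> lin g \<Longrightarrow> lin (\<lambda>x. f (g x))"
  by (auto simp: lin_iff)

lemma lfun_compose: "lfun f \<Longrightarrow> lin g \<Longrightarrow> lfun (\<lambda>x. f (g x))"
  by (auto simp: lin_iff lfun_iff)

lemma lin_ident: "lin (\<lambda>x. x)"
  by (simp add: lin_iff)

lemma lin_funpow: "lin f \<Longrightarrow> lin (f ^^ k)"
  by (induction k) (auto simp: lin_iff)

lemma lin_combination: "(\<And>i. i \<in> I \<Longrightarrow> lfun (f i)) \<Longrightarrow> lin (\<lambda>x. \<Sum>i\<in>I. f i x *s v i)"
  by (auto simp: lin_iff lfun_iff scale_sum_right scale_left_distrib sum.distrib intro!: sum.cong)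

lemma lin_span: "lin f \<Longrightarrow> (\<And>x. x \<in> X \<Longrightarrow> f x \<in> S) \<Longrightarrow> subspace S \<Longrightarrow> x \<in> span X \<Longrightarrow> f x \<in> S"
  by (rotate_tac 3, induction rule: span_induct_alt)
     (auto simp: lin_add lin_scale lin_zero subspace_0 intro!: subspace_add subspace_scale)

lemma lfun_span_zero: "lfun f \<Longrightarrow> (\<And>x. x \<in> X \<Longrightarrow> f x = 0) \<Longrightarrow> x \<in> span X \<Longrightarrow> f x = 0"
  by (rotate_tac 2, induction rule: span_induct_alt) (auto simp: lfun_add lfun_scale lfun_zero)

definition fd :: "'b set \<Rightarrow> bool" where
  "fd M \<longleftrightarrow> subspace M \<and> (\<exists>B. finite B \<and> M \<subseteq> span B)"

lemma fd_subspace: "fd M \<Longrightarrow> subspace M"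
  by (simp add: fd_def)

lemma fd_mono: "fd M \<Longrightarrow> subspace N \<Longrightarrow> N \<subseteq> M \<Longrightarrow> fd N"
  by (auto simp: fd_def)

lemma fd_span: "finite B \<Longrightarrow> fd (span B)"
  by (auto simp: fd_def)

text \<open>A basis with its dual basis. The functionals are linear on the whole ambient type, and
  the vectors are indexed so that orbits \<open>(f ^^ i) v\<close> can serve directly as
  bases.\<close>

definition coords :: "'b set \<Rightarrow> 'i set \<Rightarrow> ('i \<Rightarrow> 'b) \<Rightarrow> ('i \<Rightarrow> 'b \<Rightarrow> 'a) \<Rightarrow> bool" where
  "coords M I v c \<longleftrightarrow> finite I \<and> (\<forall>i\<in>I. v i \<in> M \<and> lfun (c i)) \<and>
     (\<forall>i\<in>I. \<forall>j\<in>I. c i (v j) = (if i = j then 1 else 0)) \<and>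
     (\<forall>x\<in>M. (\<Sum>i\<in>I. c i x *s v i) = x)"

lemma
  assumes "coords M I v c"
  shows coords_finite: "finite I"
    and coords_mem: "i \<in> I \<Longrightarrow> v i \<in> M"
    and coords_lfun: "i \<in> I \<Longrightarrow> lfun (c i)"
    and coords_dual: "i \<in> I \<Longrightarrow> j \<in> I \<Longrightarrow> c i (v j) = (if i = j then 1 else 0)"
    and coords_expand: "x \<in> M \<Longrightarrow> (\<Sum>i\<in>I. c i x *s v i) = x"
  using assms by (auto simp: coords_def)

text \<open>\<open>representation B\<close> is linear only on \<open>span B\<close>; coordinates in
  an ambient basis extending B are linear everywhere and agree with it there.\<close>

lemma coords_of_independent:
  assumes "independent B" "finite B"
  defines "c \<equiv> \<lambda>b x. representation (extend_basis B) x b"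
  shows "coords (span B) B (\<lambda>b. b) c"
proof -
  have E: "independent (extend_basis B)" "span (extend_basis B) = UNIV" "B \<subseteq> extend_basis B"
    using independent_extend_basis[OF assms(1)] span_extend_basis[OF assms(1)]
      extend_basis_superset[OF assms(1)] by auto
  have l: "lfun (c b)" for b
    unfolding c_def lfun_iff using E by (auto simp: representation_add representation_scale)
  have d: "c b b' = (if b = b' then 1 else 0)" if "b' \<in> B" for b b'
    unfolding c_def using representation_basis[OF E(1), of b'] that E by auto
  have "(\<Sum>b\<in>B. c b x *s b) = x" if "x \<in> span B" for x
  proof -
    have "x = (\<Sum>b\<in>B. representation B x b *s b)"
      using sum_representation_eq[OF assms(1) that assms(2) subset_refl] by simp
    moreover have "representation B x b = c b x" if "b \<in> B" for b
      unfolding c_def using representation_extend[OF E(1) \<open>x \<in> span B\<close> E(3)] by simp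
    ultimately show ?thesis by simp
  qed
  then show ?thesis
    using l d assms(2) by (auto simp: coords_def span_base)
qed

lemma fd_basis_extend:
  assumes "fd M" "subspace N" "N \<subseteq> M"
  obtains B C where "B \<subseteq> C" "independent C" "finite C" "span B = N" "span C = M"
proof -
  obtain B where B: "B \<subseteq> N" "independent B" "N \<subseteq> span B"
    using basis_exists by metis
  obtain C where C: "B \<subseteq> C" "C \<subseteq> M" "independent C" "M \<subseteq> span C"
    using maximal_independent_subset_extend[of B M] B assms(3) by (metis subset_trans)
  obtain F where F: "finite F" "M \<subseteq> span F" and M: "subspace M"
    using assms(1) by (auto simp: fd_def)
  have "finite C" using independent_span_bound[of F C] F C by auto
  moreover have "span B = N" "span C = M"
    using B C M assms span_subspace by auto
  ultimately show ?thesis using that B C by blast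
qed

lemma coords_extend:
  assumes "fd M" "subspace N" "N \<subseteq> M"
  obtains I J :: "'b set" and v c where "J \<subseteq> I" "coords N J v c" "coords M I v c"
proof -
  obtain B C where BC: "B \<subseteq> C" "independent C" "finite C" "span B = N" "span C = M"
    using fd_basis_extend[OF assms] .
  let ?c = "\<lambda>b x. representation (extend_basis C) x b"
  have c: "coords M C (\<lambda>b. b) ?c"
    using coords_of_independent[OF BC(2,3)] BC by simp
  have "(\<Sum>b\<in>B. ?c b x *s b) = x" if "x \<in> N" for x
  proof -
    have "x \<in> M" using that assms by auto
    have "coords N B (\<lambda>b. b) (\<lambda>b x. representation (extend_basis B) x b)"
      using coords_of_independent[of B] BC independent_mono finite_subset by blast
    then have x: "x = (\<Sum>b\<in>B. representation (extend_basis B) x b *s b)"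
      using that BC coords_expand by fastforce
    have f: "finite B" using BC finite_subset by blast
    have "?c b x = representation (extend_basis B) x b" if "b \<in> B" for b
    proof -
      have l: "lfun (?c b)" using coords_lfun[OF c] that BC(1) by blast
      have "?c b (\<Sum>a\<in>B. representation (extend_basis B) x a *s a)
          = (\<Sum>a\<in>B. representation (extend_basis B) x a * ?c b a)"
        by (simp add: lfun_sum[OF l] lfun_scale[OF l])
      also have "\<dots> = (\<Sum>a\<in>B. if a = b then representation (extend_basis B) x a else 0)"
        using coords_dual[OF c, of b] that BC(1) by (intro sum.cong refl) (auto simp: subset_iff)
      also have "\<dots> = representation (extend_basis B) x b" using f that by simp
      finally show ?thesis using x by simp
    qed
    then show ?thesis using x by simp
  qed
  moreover have "\<And>b. b \<in> B \<Longrightarrow> b \<in> N" using BC span_base by blast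
  ultimately have "coords N B (\<lambda>b. b) ?c"
    unfolding coords_def
    using coords_lfun[OF c] coords_dual[OF c] BC(1) finite_subset[OF BC(1,3)]
    by (intro conjI ballI) blast+
  from that[OF BC(1) this c] show ?thesis .
qed

lemma coords_exists:
  assumes "fd M"
  obtains I :: "'b set" and v c where "coords M I v c"
  by (rule coords_extend[OF assms fd_subspace[OF assms] subset_refl])

lemma coords_span:
  assumes "coords M I v c" "subspace M"
  shows "span (v ` I) = M"
proof
  show "span (v ` I) \<subseteq> M" using assms by (intro span_minimal) (auto simp: coords_mem)
  show "M \<subseteq> span (v ` I)"
  proof
    fix x assume "x \<in> M"
    then have "x = (\<Sum>i\<in>I. c i x *s v i)" using coords_expand[OF assms(1)] by simp
    moreover have "(\<Sum>i\<in>I. c i x *s v i) \<in> span (v ` I)"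
      by (intro span_sum span_scale span_base imageI)
    ultimately show "x \<in> span (v ` I)" by simp
  qed
qed

lemma dim_less:
  assumes "fd M" "subspace N" "N \<subset> M"
  shows "dim N < dim M"
proof -
  obtain B C where BC: "B \<subseteq> C" "independent C" "finite C" "span B = N" "span C = M"
    using fd_basis_extend[of M N] assms by blast
  then have "B \<subset> C" using assms(3) by blast
  moreover have "dim N = card B" "dim M = card C"
    using BC dim_span_eq_card_independent independent_mono by metis+
  ultimately show ?thesis using BC(3) by (simp add: psubset_card_mono)
qed

text \<open>Dropping the coordinates that belong to N projects M onto the span of the remaining
  basis vectors. The pair \<open>C\<close>, \<open>\<pi>\<close> stands in for the quotient of M by
  N throughout.\<close>

lemma complement_exists:
  assumes "fd M" "subspace N" "N \<subseteq> M"
  obtains C \<pi> where "subspace C" "C \<subseteq> M" "lin \<pi>" "\<And>x. \<pi> x \<in> C" "\<And>x. x \<in> C \<Longrightarrow> \<pi> x = x"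
    "\<And>x. x \<in> N \<Longrightarrow> \<pi> x = 0" "\<And>x. x \<in> M \<Longrightarrow> x - \<pi> x \<in> N"
proof -
  obtain I J :: "'b set" and v c where J: "J \<subseteq> I" "coords N J v c" "coords M I v c"
    using coords_extend[OF assms] .
  define \<pi> where "\<pi> x = (\<Sum>i\<in>I-J. c i x *s v i)" for x
  have fin: "finite I" "finite J" using J coords_finite by blast+
  have l: "lin \<pi>" unfolding \<pi>_def using J by (intro lin_combination) (auto simp: coords_lfun)
  have \<pi>v: "\<pi> (v i) = v i" if "i \<in> I - J" for i
  proof -
    have "\<pi> (v i) = (\<Sum>j\<in>I-J. if j = i then v i else 0)"
      unfolding \<pi>_def using that by (intro sum.cong refl) (auto simp: coords_dual[OF J(3)])
    then show ?thesis using that fin by simp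
  qed
  have \<pi>v0: "\<pi> (v i) = 0" if "i \<in> J" for i
    unfolding \<pi>_def using that J(1) by (intro sum.neutral) (auto simp: coords_dual[OF J(3)] subset_iff)
  have 1: "\<pi> x \<in> span (v ` (I - J))" for x
    unfolding \<pi>_def by (intro span_sum span_scale span_base) auto
  have 2: "\<pi> x = x" if "x \<in> span (v ` (I - J))" for x
    using that by (induction rule: span_induct_alt) (use l \<pi>v in \<open>auto simp: lin_add lin_scale lin_zero\<close>)
  have 3: "\<pi> x = 0" if "x \<in> N" for x
  proof -
    have "x \<in> span (v ` J)" using that coords_span[OF J(2) assms(2)] by simp
    then show ?thesis
      by (induction rule: span_induct_alt) (use l \<pi>v0 in \<open>auto simp: lin_add lin_scale lin_zero\<close>)
  qed
  have 4: "x - \<pi> x \<in> N" if "x \<in> M" for x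
  proof -
    have "x = (\<Sum>i\<in>I. c i x *s v i)" using coords_expand[OF J(3) that] by simp
    also have "\<dots> = \<pi> x + (\<Sum>i\<in>J. c i x *s v i)"
      unfolding \<pi>_def using J(1) fin by (simp add: sum.subset_diff)
    finally have "x - \<pi> x = (\<Sum>i\<in>J. c i x *s v i)" by (simp add: algebra_simps)
    also have "\<dots> \<in> N" using assms(2) coords_mem[OF J(2)]
      by (intro subspace_sum subspace_scale) auto
    finally show ?thesis .
  qed
  have "span (v ` (I - J)) \<subseteq> M"
    using fd_subspace[OF assms(1)] coords_mem[OF J(3)] by (intro span_minimal) auto
  with 1 2 3 4 l that[of "span (v ` (I - J))" \<pi>] show ?thesis by auto
qed

text \<open>Both sides are the same double sum of products of matrix entries. With the identity for
  g it yields independence of the basis, with M = N the commutation rule for traces.\<close>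

lemma coords_trace_commute:
  assumes "coords M I v c" "coords N J w d" "lin f" "lin g" "f ` M \<subseteq> N" "g ` N \<subseteq> M"
  shows "(\<Sum>i\<in>I. c i (g (f (v i)))) = (\<Sum>j\<in>J. d j (f (g (w j))))"
proof -
  have "c i (g (f (v i))) = (\<Sum>j\<in>J. d j (f (v i)) * c i (g (w j)))" if "i \<in> I" for i
  proof -
    have "f (v i) \<in> N" using assms coords_mem[OF assms(1) that] by auto
    then have "f (v i) = (\<Sum>j\<in>J. d j (f (v i)) *s w j)" using coords_expand[OF assms(2)] by simp
    then have "c i (g (f (v i))) = c i (g (\<Sum>j\<in>J. d j (f (v i)) *s w j))" by simp
    then show ?thesis using assms(4) coords_lfun[OF assms(1) that]
      by (simp add: lin_sum lin_scale lfun_sum lfun_scale)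
  qed
  moreover have "d j (f (g (w j))) = (\<Sum>i\<in>I. c i (g (w j)) * d j (f (v i)))" if "j \<in> J" for j
  proof -
    have "g (w j) \<in> M" using assms coords_mem[OF assms(2) that] by auto
    then have "g (w j) = (\<Sum>i\<in>I. c i (g (w j)) *s v i)" using coords_expand[OF assms(1)] by simp
    then have "d j (f (g (w j))) = d j (f (\<Sum>i\<in>I. c i (g (w j)) *s v i))" by simp
    then show ?thesis using assms(3) coords_lfun[OF assms(2) that]
      by (simp add: lin_sum lin_scale lfun_sum lfun_scale)
  qed
  ultimately show ?thesis
    using sum.swap[of "\<lambda>i j. d j (f (v i)) * c i (g (w j))" J I] by (simp add: mult.commute)
qed

text \<open>A choice cannot range over types, so the index type is fixed here;
  \<open>tr_coords\<close> then admits any index type, such as the natural numbers for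
  chains.\<close>

definition tr :: "'b set \<Rightarrow> ('b \<Rightarrow> 'b) \<Rightarrow> 'a" where
  "tr M f = (let (I, v, c) = (SOME (I :: 'b set, v, c). coords M I v c) in \<Sum>i\<in>I. c i (f (v i)))"

lemma tr_coords_all:
  assumes "fd M"
  obtains I :: "'b set" and v c where "coords M I v c" "\<And>f. tr M f = (\<Sum>i\<in>I. c i (f (v i)))"
proof -
  obtain J w d where Jwd: "(SOME (I :: 'b set, v, c). coords M I v c) = (J, w, d)"
    by (metis prod_cases3)
  obtain I' :: "'b set" and v' c' where "coords M I' v' c'" using coords_exists[OF assms(1)] .
  then have "coords M J w d"
    using someI[of "\<lambda>(I :: 'b set, v, c). coords M I v c" "(I', v', c')"] Jwd by simp
  then show ?thesis by (rule that) (simp add: tr_def Jwd)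
qed

lemma tr_coords:
  assumes "fd M" "lin f" "f ` M \<subseteq> M" "coords M I v c"
  shows "tr M f = (\<Sum>i\<in>I. c i (f (v i)))"
proof -
  obtain J :: "'b set" and w d where "coords M J w d" and t: "\<And>f. tr M f = (\<Sum>i\<in>J. d i (f (w i)))"
    using tr_coords_all[OF assms(1)] by blast
  from coords_trace_commute[OF this(1) assms(4), of f "\<lambda>x. x"] show ?thesis
    using assms by (auto simp: t lin_iff)
qed

lemma tr_commute:
  assumes "fd M" "lin f" "lin g" "f ` M \<subseteq> M" "g ` M \<subseteq> M"
  shows "tr M (\<lambda>x. f (g x)) = tr M (\<lambda>x. g (f x))"
proof -
  obtain I :: "'b set" and v c where c: "coords M I v c" using coords_exists[OF assms(1)] .
  show ?thesis
    using tr_coords[OF assms(1) lin_compose[OF assms(2,3)] _ c] tr_coords[OF assms(1) lin_compose[OF assms(3,2)] _ c]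
      coords_trace_commute[OF c c assms(2,3)] assms by (auto simp: image_subset_iff)
qed

text \<open>Linearity of the trace needs no hypotheses on the maps, since \<open>tr\<close> is defined by one fixed choice
  of coordinates.\<close>

lemma
  assumes "fd M"
  shows tr_add: "tr M (\<lambda>x. f x + g x) = tr M f + tr M g"
    and tr_diff: "tr M (\<lambda>x. f x - g x) = tr M f - tr M g"
    and tr_scale: "tr M (\<lambda>x. a *s f x) = a * tr M f"
    and tr_zero: "tr M (\<lambda>x. 0) = 0"
proof -
  obtain I :: "'b set" and v c where c: "coords M I v c" and t: "\<And>f. tr M f = (\<Sum>i\<in>I. c i (f (v i)))"
    using tr_coords_all[OF assms] by blast
  note l = lfun_add[OF coords_lfun[OF c]] lfun_diff[OF coords_lfun[OF c]] lfun_scale[OF coords_lfun[OF c]]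
    lfun_zero[OF coords_lfun[OF c]]
  show "tr M (\<lambda>x. f x + g x) = tr M f + tr M g" "tr M (\<lambda>x. f x - g x) = tr M f - tr M g"
    "tr M (\<lambda>x. a *s f x) = a * tr M f" "tr M (\<lambda>x. 0) = 0"
    by (simp_all add: t l sum.distrib sum_subtractf sum_distrib_left)
qed

lemma tr_sum: "fd M \<Longrightarrow> tr M (\<lambda>x. \<Sum>i\<in>I. f i x) = (\<Sum>i\<in>I. tr M (f i))"
  by (induction I rule: infinite_finite_induct) (auto simp: tr_zero tr_add)

lemma tr_cong:
  assumes "fd M" "\<And>x. x \<in> M \<Longrightarrow> f x = g x"
  shows "tr M f = tr M g"
proof -
  obtain I :: "'b set" and v c where c: "coords M I v c" and t: "\<And>f. tr M f = (\<Sum>i\<in>I. c i (f (v i)))"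
    using tr_coords_all[OF assms(1)] by blast
  show ?thesis using assms(2) by (simp add: t coords_mem[OF c])
qed

lemma tr_ident:
  assumes "fd M" "coords M I v c"
  shows "tr M (\<lambda>x. x) = of_nat (card I)"
  using tr_coords[OF assms(1) lin_ident _ assms(2)] coords_dual[OF assms(2)] by simp

lemma tr_commutator:
  assumes "fd M" "lin f" "lin g" "f ` M \<subseteq> M" "g ` M \<subseteq> M"
  shows "tr M (\<lambda>x. f (g x) - g (f x)) = 0"
  using tr_commute[OF assms] by (simp add: tr_diff[OF assms(1)])

text \<open>Induction in the manner of Gram-Schmidt: independence of the functionals on K supplies a
  vector where the new functional differs from what the old dual vectors predict.\<close>

lemma dual_family:
  assumes "finite I" "subspace K" "\<And>i. i \<in> I \<Longrightarrow> lfun (f i)"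
    and "\<And>a. (\<And>k. k \<in> K \<Longrightarrow> (\<Sum>i\<in>I. a i * f i k) = 0) \<Longrightarrow> \<forall>i\<in>I. a i = 0"
  shows "\<exists>g. (\<forall>i\<in>I. g i \<in> K) \<and> (\<forall>i\<in>I. \<forall>j\<in>I. f i (g j) = (if i = j then 1 else 0))"
  using assms(1,3,4)
proof (induction I rule: finite_induct)
  case empty
  then show ?case by simp
next
  case (insert b I)
  have "\<exists>g. (\<forall>i\<in>I. g i \<in> K) \<and> (\<forall>i\<in>I. \<forall>j\<in>I. f i (g j) = (if i = j then 1 else 0))"
  proof (rule insert.IH)
    fix a assume a: "\<And>k. k \<in> K \<Longrightarrow> (\<Sum>i\<in>I. a i * f i k) = 0"
    have "\<forall>i\<in>insert b I. (a(b := 0)) i = 0"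
    proof (rule insert.prems(2))
      fix k assume "k \<in> K"
      moreover have "(\<Sum>i\<in>I. (a(b := 0)) i * f i k) = (\<Sum>i\<in>I. a i * f i k)"
        using insert.hyps by (intro sum.cong) auto
      ultimately show "(\<Sum>i\<in>insert b I. (a(b := 0)) i * f i k) = 0"
        using insert.hyps a by simp
    qed
    then show "\<forall>i\<in>I. a i = 0" using insert.hyps by (metis fun_upd_other insertCI)
  qed (use insert.prems in auto)
  then obtain g where g: "\<And>i. i \<in> I \<Longrightarrow> g i \<in> K"
    "\<And>i j. i \<in> I \<Longrightarrow> j \<in> I \<Longrightarrow> f i (g j) = (if i = j then 1 else 0)" by blast
  \<comment> \<open>The coefficients of \<open>f b\<close> minus its interpolation by the old
    functionals, a nontrivial combination because of the 1 at b.\<close>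
  define a where "a = (\<lambda>i. - f b (g i))(b := 1)"
  have "\<exists>k\<in>K. (\<Sum>i\<in>insert b I. a i * f i k) \<noteq> 0"
  proof (rule ccontr)
    assume "\<not> ?thesis"
    then have "\<forall>i\<in>insert b I. a i = 0" using insert.prems(2)[of a] by blast
    then show False by (simp add: a_def)
  qed
  then obtain k where k: "k \<in> K" "(\<Sum>i\<in>insert b I. a i * f i k) \<noteq> 0" by blast
  have sum_a: "(\<Sum>i\<in>insert b I. a i * f i k) = f b k - (\<Sum>i\<in>I. f b (g i) * f i k)"
  proof -
    have "(\<Sum>i\<in>I. a i * f i k) = (\<Sum>i\<in>I. - (f b (g i) * f i k))"
      using insert.hyps by (intro sum.cong) (auto simp: a_def)
    then show ?thesis using insert.hyps by (simp add: a_def sum_negf)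
  qed
  \<comment> \<open>Removing the components along \<open>g\<close> kills the old functionals and
    leaves \<open>f b k'\<close> equal to the nonzero value just found.\<close>
  define k' where "k' = k - (\<Sum>i\<in>I. f i k *s g i)"
  have fk': "f j k' = f j k - (\<Sum>i\<in>I. f i k * f j (g i))" if "j \<in> insert b I" for j
    using insert.prems(1)[OF that] by (simp add: k'_def lfun_diff lfun_sum lfun_scale)
  have k'K: "k' \<in> K"
    unfolding k'_def using g k assms(2) by (intro subspace_diff subspace_sum subspace_scale) auto
  have k'I: "f j k' = 0" if "j \<in> I" for j
  proof -
    have "(\<Sum>i\<in>I. f i k * f j (g i)) = (\<Sum>i\<in>I. if i = j then f i k else 0)"
      using that g by (intro sum.cong) auto
    then show ?thesis using that insert.hyps fk'[of j] by simp
  qed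
  have k'b: "f b k' \<noteq> 0" using fk'[of b] k(2) sum_a by (simp add: mult.commute)
  define gb where "gb = inverse (f b k') *s k'"
  define h where "h = (\<lambda>i. g i - f b (g i) *s gb)(b := gb)"
  have gb: "f b gb = 1" "\<And>j. j \<in> I \<Longrightarrow> f j gb = 0" "gb \<in> K"
    using k'b k'I k'K insert.prems(1) assms(2)
    by (auto simp: gb_def lfun_scale intro!: subspace_scale)
  have "\<forall>i\<in>insert b I. h i \<in> K"
    using g gb assms(2) by (auto simp: h_def intro!: subspace_diff subspace_scale)
  moreover have "f i (h j) = (if i = j then 1 else 0)" if "i \<in> insert b I" "j \<in> insert b I" for i j
    using that g gb insert.hyps insert.prems(1)[OF that(1)]
    by (auto simp: h_def lfun_diff lfun_scale)
  ultimately show ?case by blast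
qed

text \<open>A relation among the functionals \<open>\<lambda>k. \<beta> k (v i)\<close> is a vector
  of M annihilated by K, so nondegeneracy on the M side makes them independent. The pairing will be
  a cocycle, a trace form or the symplectic form.\<close>

lemma dual_coords:
  assumes M: "coords M I v c" and "subspace K" "\<And>k. lfun (\<beta> k)" "\<And>x. lfun (\<lambda>k. \<beta> k x)"
    and nd: "\<And>x. x \<in> M \<Longrightarrow> (\<And>k. k \<in> K \<Longrightarrow> \<beta> k x = 0) \<Longrightarrow> x = 0" and "subspace M"
  shows "\<exists>g. (\<forall>i\<in>I. g i \<in> K) \<and> (\<forall>i\<in>I. \<forall>j\<in>I. \<beta> (g i) (v j) = (if i = j then 1 else 0))"
proof -
  have "\<exists>g. (\<forall>i\<in>I. g i \<in> K) \<and>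
      (\<forall>i\<in>I. \<forall>j\<in>I. (\<lambda>k. \<beta> k (v i)) (g j) = (if i = j then 1 else 0))"
  proof (rule dual_family)
    fix a assume a: "\<And>k. k \<in> K \<Longrightarrow> (\<Sum>i\<in>I. a i * \<beta> k (v i)) = 0"
    define x where "x = (\<Sum>i\<in>I. a i *s v i)"
    have "x \<in> M" unfolding x_def using coords_mem[OF M] \<open>subspace M\<close>
      by (intro subspace_sum subspace_scale) auto
    moreover have "\<beta> k x = 0" if "k \<in> K" for k
      using a[OF that] assms(3)[of k] by (simp add: x_def lfun_sum lfun_scale)
    ultimately have x0: "x = 0" using nd by blast
    show "\<forall>i\<in>I. a i = 0"
    proof
      fix i assume i: "i \<in> I"
      have "c i x = (\<Sum>j\<in>I. if j = i then a j else 0)"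
        unfolding x_def lfun_sum[OF coords_lfun[OF M i]] using i coords_lfun[OF M i]
        by (intro sum.cong) (auto simp: lfun_scale coords_dual[OF M])
      then show "a i = 0" using x0 i coords_finite[OF M] lfun_zero[OF coords_lfun[OF M i]] by simp
    qed
  qed (use assms coords_finite in auto)
  then show ?thesis by (metis (lifting))
qed


section \<open>Polynomials in an operator, nilpotency from traces, eigenvectors\<close>

definition papply :: "('b \<Rightarrow> 'b) \<Rightarrow> 'a poly \<Rightarrow> 'b \<Rightarrow> 'b" where
  "papply f p v = fold_coeffs (\<lambda>a w. a *s v + f w) p 0"

lemma papply_0 [simp]: "papply f 0 v = 0"
  by (simp add: papply_def)

lemma papply_pCons: "lin f \<Longrightarrow> papply f (pCons a p) v = a *s v + f (papply f p v)"
  by (cases "p = 0 \<and> a = 0") (auto simp: papply_def lin_zero)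

lemma papply_const: "lin f \<Longrightarrow> papply f [:a:] v = a *s v"
  by (simp add: papply_pCons lin_zero)

lemma lin_papply: "lin f \<Longrightarrow> lin (papply f p)"
proof (induction p)
  case 0
  then show ?case by (simp add: lin_iff)
next
  case (pCons a p)
  note IH = pCons.IH[OF pCons.prems]
  show ?case
    unfolding lin_iff using pCons.prems
    by (simp add: papply_pCons lin_add[OF IH] lin_scale[OF IH] lin_add[OF pCons.prems]
        lin_scale[OF pCons.prems] algebra_simps)
qed

lemma papply_add: "lin f \<Longrightarrow> papply f (p + q) v = papply f p v + papply f q v"
  by (induction p q rule: poly_induct2) (auto simp: papply_pCons lin_add algebra_simps)

lemma papply_smult: "lin f \<Longrightarrow> papply f (smult a p) v = a *s papply f p v"
  by (induction p) (auto simp: papply_pCons lin_scale algebra_simps)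

lemma papply_diff: "lin f \<Longrightarrow> papply f (p - q) v = papply f p v - papply f q v"
  using papply_add[of f p "- q" v] papply_smult[of f "- 1" q v] by simp

lemma papply_monom: "lin f \<Longrightarrow> papply f (monom a k) v = a *s (f ^^ k) v"
  by (induction k) (auto simp: monom_0 monom_Suc papply_const papply_pCons lin_scale lin_zero)

lemma papply_mult: "lin f \<Longrightarrow> papply f (p * q) v = papply f p (papply f q v)"
  by (induction p) (auto simp: papply_pCons papply_add papply_smult)

lemma papply_comm: "lin f \<Longrightarrow> papply f p (papply f q v) = papply f q (papply f p v)"
  by (metis papply_mult mult.commute)

lemma papply_funpow: "lin f \<Longrightarrow> papply f ([:0, 1:] ^ k) v = (f ^^ k) v"
  by (induction k arbitrary: v) (auto simp: one_pCons papply_mult papply_pCons papply_const lin_zero)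

lemma papply_closed:
  assumes "subspace M" "lin f" "f ` M \<subseteq> M" "v \<in> M"
  shows "papply f p v \<in> M"
  using assms by (induction p) (auto simp: papply_pCons subspace_0 intro!: subspace_add subspace_scale)

text \<open>Take the least d for which \<open>(f ^^ d) v\<close> depends on its predecessors:
  minimality makes the orbit up to d independent, the dependence makes its span invariant.\<close>

lemma chain_coords:
  assumes "fd M" "lin f" "f ` M \<subseteq> M" "v \<in> M" "v \<noteq> 0"
  obtains d c where "d > 0" "coords (span ((\<lambda>i. (f ^^ i) v) ` {..<d})) {..<d} (\<lambda>i. (f ^^ i) v) c"
    "span ((\<lambda>i. (f ^^ i) v) ` {..<d}) \<subseteq> M"
    "f ` span ((\<lambda>i. (f ^^ i) v) ` {..<d}) \<subseteq> span ((\<lambda>i. (f ^^ i) v) ` {..<d})"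
proof -
  define w where "w i = (f ^^ i) v" for i
  have wM: "w i \<in> M" for i unfolding w_def using assms by (induction i) auto
  obtain B where B: "finite B" "M \<subseteq> span B" using assms(1) by (auto simp: fd_def)
  have indep: "independent (w ` {..<n}) \<and> inj_on w {..<n}" if "\<And>i. i < n \<Longrightarrow> w i \<notin> span (w ` {..<i})" for n
    using that
  proof (induction n)
    case (Suc n)
    have n: "w n \<notin> span (w ` {..<n})" by (rule Suc.prems) simp
    have I: "independent (w ` {..<n})" "inj_on w {..<n}" using Suc by simp_all
    have "w n \<notin> w ` {..<n}" using n span_superset[of "w ` {..<n}"] by blast
    then show ?case
      using independent_insertI[OF n I(1)] I(2) by (simp add: lessThan_Suc)
  qed (simp add: independent_empty)
  have "\<exists>d. w d \<in> span (w ` {..<d})"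
  proof (rule ccontr)
    assume "\<not> ?thesis"
    then have "independent (w ` {..<Suc (card B)})" "inj_on w {..<Suc (card B)}" using indep by blast+
    then have "card (w ` {..<Suc (card B)}) \<le> card B"
      using independent_span_bound[of B] B wM by blast
    then show False using \<open>inj_on w {..<Suc (card B)}\<close> by (simp add: card_image)
  qed
  then obtain d where d: "w d \<in> span (w ` {..<d})" "\<And>i. i < d \<Longrightarrow> w i \<notin> span (w ` {..<i})"
    using exists_least_iff[of "\<lambda>d. w d \<in> span (w ` {..<d})"] by blast
  have "d > 0" using d(1) assms(5) by (cases d) (auto simp: w_def)
  have I: "independent (w ` {..<d})" "inj_on w {..<d}" using indep d(2) by blast+
  define c where "c b x = representation (extend_basis (w ` {..<d})) x b" for b x
  have c: "coords (span (w ` {..<d})) (w ` {..<d}) (\<lambda>b. b) c"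
    unfolding c_def using coords_of_independent[OF I(1)] by simp
  have "coords (span (w ` {..<d})) {..<d} w (\<lambda>i. c (w i))"
    unfolding coords_def
  proof (intro conjI ballI)
    fix x assume "x \<in> span (w ` {..<d})"
    then show "(\<Sum>i<d. c (w i) x *s w i) = x"
      using coords_expand[OF c] by (simp add: sum.reindex[OF I(2)])
  next
    fix i j assume "i \<in> {..<d}" "j \<in> {..<d}"
    then show "c (w i) (w j) = (if i = j then 1 else 0)"
      using coords_dual[OF c, of "w i" "w j"] I(2) by (auto simp: inj_on_eq_iff)
  next
    fix i assume "i \<in> {..<d}"
    then show "w i \<in> span (w ` {..<d})" "lfun (c (w i))"
      using coords_lfun[OF c, of "w i"] by (auto intro: span_base)
  qed simp
  moreover have "span (w ` {..<d}) \<subseteq> M"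
    using wM fd_subspace[OF assms(1)] by (intro span_minimal) auto
  moreover have "f ` span (w ` {..<d}) \<subseteq> span (w ` {..<d})"
  proof -
    have "f (w i) \<in> span (w ` {..<d})" if "i < d" for i
    proof -
      have "f (w i) = w (Suc i)" by (simp add: w_def)
      then show ?thesis using that d(1) span_base[of "w (Suc i)" "w ` {..<d}"]
        by (cases "Suc i = d") auto
    qed
    then show ?thesis using lin_span[OF assms(2), of "w ` {..<d}" "span (w ` {..<d})"] by auto
  qed
  ultimately show ?thesis using that[of d "\<lambda>i. c (w i)"] \<open>d > 0\<close> unfolding w_def by blast
qed

text \<open>Invariance of the cyclic subspace expresses \<open>(f ^^ d) v\<close> by lower powers;
  the difference is a monic polynomial of degree d.\<close>

lemma annihilating_poly_vector:
  assumes "fd M" "lin f" "f ` M \<subseteq> M" "v \<in> M"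
  shows "\<exists>p. p \<noteq> 0 \<and> papply f p v = 0"
proof (cases "v = 0")
  case True
  then show ?thesis by (intro exI[of _ 1]) (simp add: lin_zero[OF lin_papply[OF assms(2)]])
next
  case False
  obtain d c where d: "coords (span ((\<lambda>i. (f ^^ i) v) ` {..<d})) {..<d} (\<lambda>i. (f ^^ i) v) c"
    "f ` span ((\<lambda>i. (f ^^ i) v) ` {..<d}) \<subseteq> span ((\<lambda>i. (f ^^ i) v) ` {..<d})" "d > 0"
    using chain_coords[OF assms False] by metis
  have "(f ^^ (d - 1)) v \<in> span ((\<lambda>i. (f ^^ i) v) ` {..<d})"
    using d(3) by (intro span_base) auto
  then have "(f ^^ d) v \<in> span ((\<lambda>i. (f ^^ i) v) ` {..<d})"
    using d(2,3) by (cases d) auto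
  moreover have "\<exists>q. (\<forall>i\<ge>d. coeff q i = 0) \<and> papply f q v = u"
    if "u \<in> span ((\<lambda>i. (f ^^ i) v) ` {..<d})" for u
    using that
  proof (induction rule: span_induct_alt)
    case base
    show ?case by (rule exI[of _ 0]) simp
  next
    case (step a x y)
    then obtain q i where "\<forall>i\<ge>d. coeff q i = 0" "papply f q v = y" "i < d" "x = (f ^^ i) v"
      by blast
    then show ?case using assms(2)
      by (intro exI[of _ "monom a i + q"]) (auto simp: papply_add papply_monom)
  qed
  ultimately obtain q where q: "\<forall>i\<ge>d. coeff q i = 0" "papply f q v = (f ^^ d) v" by blast
  have "coeff (monom 1 d - q) d = 1" using q(1) by simp
  then have "monom 1 d - q \<noteq> 0" by auto
  moreover have "papply f (monom 1 d - q) v = 0"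
    using assms(2) q(2) by (simp add: papply_diff papply_monom)
  ultimately show ?thesis by blast
qed

lemma annihilating_poly:
  assumes "fd M" "lin f" "f ` M \<subseteq> M"
  obtains p where "p \<noteq> 0" "\<And>v. v \<in> M \<Longrightarrow> papply f p v = 0"
proof -
  obtain I :: "'b set" and v c where c: "coords M I v c" using coords_exists[OF assms(1)] .
  have "\<forall>i\<in>I. \<exists>p. p \<noteq> 0 \<and> papply f p (v i) = 0"
    using annihilating_poly_vector[OF assms] coords_mem[OF c] by blast
  then obtain p where p: "\<And>i. i \<in> I \<Longrightarrow> p i \<noteq> 0 \<and> papply f (p i) (v i) = 0" by metis
  have fin: "finite I" using coords_finite[OF c] .
  have *: "papply f (prod p I) (v i) = 0" if "i \<in> I" for i
  proof -
    have "prod p I = prod p (I - {i}) * p i" using that fin by (simp add: prod.remove mult.commute)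
    then show ?thesis
      using p[OF that] assms(2) lin_zero[OF lin_papply[OF assms(2)]] by (simp add: papply_mult)
  qed
  have "papply f (prod p I) x = 0" if "x \<in> M" for x
  proof -
    have "papply f (prod p I) x = papply f (prod p I) (\<Sum>i\<in>I. c i x *s v i)"
      using coords_expand[OF c that] by simp
    also have "\<dots> = 0"
      using * by (simp add: lin_sum[OF lin_papply[OF assms(2)]] lin_scale[OF lin_papply[OF assms(2)]])
    finally show ?thesis .
  qed
  moreover have "prod p I \<noteq> 0" using p fin by simp
  ultimately show ?thesis using that by blast
qed

text \<open>In a basis adapted to N the projection has diagonal entries 1 on J and 0 elsewhere, so
  its trace is the dimension of N as a field element, which characteristic zero prevents from
  vanishing unless N does.\<close>

lemma tr_idempotent_zero:
  assumes "fd M" "subspace N" "N \<subseteq> M" "lin P" "P ` M \<subseteq> N" "\<And>x. x \<in> N \<Longrightarrow> P x = x"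
    and "tr M P = 0" and char: "\<And>n. of_nat (Suc n) \<noteq> (0 :: 'a)"
  shows "N = {0}"
proof -
  obtain I J :: "'b set" and v c where J: "J \<subseteq> I" "coords N J v c" "coords M I v c"
    using coords_extend[OF assms(1-3)] .
  have "P ` M \<subseteq> M" using assms by auto
  then have "tr M P = (\<Sum>i\<in>I. c i (P (v i)))" using tr_coords[OF assms(1,4) _ J(3)] by simp
  also have "\<dots> = (\<Sum>i\<in>I. if i \<in> J then 1 else 0)"
  proof (intro sum.cong refl)
    fix i assume i: "i \<in> I"
    show "c i (P (v i)) = (if i \<in> J then 1 else 0)"
    proof (cases "i \<in> J")
      case True
      then show ?thesis using assms(6) coords_mem[OF J(2) True] coords_dual[OF J(3) i i] by simp
    next
      case False
      have "P (v i) \<in> N" using coords_mem[OF J(3) i] assms(5) by auto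
      then have "P (v i) \<in> span (v ` J)" using coords_span[OF J(2) assms(2)] by simp
      moreover have "c i (v j) = 0" if "j \<in> J" for j
        using coords_dual[OF J(3) i, of j] that J(1) False by auto
      ultimately show ?thesis using lfun_span_zero[OF coords_lfun[OF J(3) i], of "v ` J"] False by auto
    qed
  qed
  also have "\<dots> = of_nat (card J)"
    using J(1) coords_finite[OF J(3)] by (simp add: sum.If_cases Int_absorb1)
  finally have "card J = 0" using assms(7) char by (cases "card J") auto
  then have "J = {}" using coords_finite[OF J(2)] by simp
  then have "\<And>x. x \<in> N \<Longrightarrow> x = 0" using coords_expand[OF J(2)] by simp
  then show ?thesis using subspace_0[OF assms(2)] by auto
qed

text \<open>The factor \<open>f ^^ Suc k\<close> excludes a constant term, about whose trace nothing
  is assumed. Each further coefficient of p raises the power of f, hence the induction over all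
  k.\<close>

lemma tr_papply_zero:
  assumes "fd M" "lin f" and t: "\<And>k. tr M (f ^^ Suc k) = 0"
  shows "tr M (\<lambda>x. papply f p ((f ^^ Suc k) x)) = 0"
proof (induction p arbitrary: k)
  case 0
  then show ?case using tr_zero[OF assms(1)] by simp
next
  case (pCons a p)
  have comm: "f (papply f p w) = papply f p (f w)" for w
    using papply_comm[OF assms(2), of p "[:0, 1:]" w] assms(2) by (simp add: papply_pCons lin_zero)
  have eq: "(\<lambda>x. papply f (pCons a p) ((f ^^ Suc k) x))
      = (\<lambda>x. a *s (f ^^ Suc k) x + papply f p ((f ^^ Suc (Suc k)) x))"
    using assms(2) by (simp add: papply_pCons comm)
  have "tr M (\<lambda>x. a *s (f ^^ Suc k) x + papply f p ((f ^^ Suc (Suc k)) x))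
      = tr M (\<lambda>x. a *s (f ^^ Suc k) x) + tr M (\<lambda>x. papply f p ((f ^^ Suc (Suc k)) x))"
    by (rule tr_add[OF assms(1)])
  then show ?case
    unfolding eq
    using pCons.IH[of "Suc k"] t[of k] tr_scale[OF assms(1), of a "f ^^ Suc k"] by simp
qed

text \<open>Fitting decomposition without eigenvalues: on a high image N the map f is inverted by a
  polynomial in f, so a projection onto N is a polynomial in f without constant term and has trace
  zero.\<close>

lemma nilpotent_if_traces_zero:
  assumes M: "fd M" and f: "lin f" "f ` M \<subseteq> M" and t: "\<And>k. tr M (f ^^ Suc k) = 0"
    and char: "\<And>n. of_nat (Suc n) \<noteq> (0 :: 'a)"
  obtains k where "\<And>x. x \<in> M \<Longrightarrow> (f ^^ k) x = 0"
proof -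
  obtain p where p: "p \<noteq> 0" "\<And>v. v \<in> M \<Longrightarrow> papply f p v = 0"
    using annihilating_poly[OF M f] by blast
  obtain m q where q: "p = [:0, 1:] ^ m * q" "poly q 0 \<noteq> 0"
    using order_decomp[OF p(1), of 0] by (auto simp: poly_eq_0_iff_dvd)
  \<comment> \<open>One more than m, so that the exponent stays positive even if m = 0: only
    positive powers are known to be traceless.\<close>
  define K where "K = Suc m"
  obtain q0 h where h: "q = pCons q0 h" by (cases q)
  \<comment> \<open>With X for the variable, q = q0 + X h vanishes at f on N, so - h / q0 evaluated
    at f inverts f there.\<close>
  define g where "g = smult (- inverse q0) h"
  have q0: "q0 \<noteq> 0" using q(2) h by simp
  define N where "N = (f ^^ K) ` M"
  have fk: "(f ^^ k) ` M \<subseteq> M" for k using f(2) by (induction k) auto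
  have sM: "subspace M" using M fd_subspace by blast
  have sN: "subspace N"
    using sM lin_funpow[OF f(1), of K] unfolding N_def subspace_def
    by (auto simp: image_iff) (metis lin_zero, metis lin_add, metis lin_scale)
  have gN: "f (papply f g y) = y" if "y \<in> N" for y
  proof -
    obtain x where x: "x \<in> M" "y = (f ^^ K) x" using \<open>y \<in> N\<close> unfolding N_def by blast
    have "papply f q y = papply f (q * [:0, 1:] ^ K) x"
      using x f(1) by (simp only: papply_mult papply_funpow)
    also have "q * [:0, 1:] ^ K = [:0, 1:] * p" by (simp only: q(1) K_def power_Suc mult_ac)
    also have "papply f \<dots> x = 0" using p(2)[OF x(1)] f(1) by (simp only: papply_mult) (simp add: papply_pCons lin_zero)
    finally have "q0 *s y + f (papply f h y) = 0" using f(1) by (simp add: h papply_pCons)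
    then have "f (papply f h y) = - (q0 *s y)" by (simp add: eq_neg_iff_add_eq_0 add.commute)
    then show ?thesis
      unfolding g_def papply_smult[OF f(1)] lin_scale[OF f(1)] using q0 by simp
  qed
  define P where "P x = papply f (g ^ K) ((f ^^ K) x)" for x
  have "lin P" unfolding P_def by (rule lin_compose[OF lin_papply[OF f(1)] lin_funpow[OF f(1)]])
  have comm: "papply f p ((f ^^ k) x) = (f ^^ k) (papply f p x)" for p k x
    using papply_comm[OF f(1), of p "[:0, 1:] ^ k" x] by (simp only: papply_funpow[OF f(1)])
  have "P ` M \<subseteq> N"
    using papply_closed[OF sM f] by (auto simp: P_def comm N_def)
  moreover have "P x = x" if "x \<in> N" for x
  proof -
    have "(f ^^ k) (papply f (g ^ k) x) = x" for k
    proof (induction k)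
      case 0
      then show ?case using f(1) by (simp add: one_pCons papply_const)
    next
      case (Suc k)
      have "(f ^^ Suc k) (papply f (g ^ Suc k) x) = f ((f ^^ k) (papply f (g ^ k) (papply f g x)))"
        using f(1) by (simp only: power_Suc2 papply_mult) simp
      also have "\<dots> = f (papply f g ((f ^^ k) (papply f (g ^ k) x)))"
        using f(1) by (simp only: comm[symmetric] papply_comm[OF f(1), of "g ^ k" g])
      also have "\<dots> = x" using Suc gN[OF that] by simp
      finally show ?case .
    qed
    then show ?thesis by (simp add: P_def comm)
  qed
  moreover have "tr M P = 0" unfolding P_def K_def using tr_papply_zero[OF M f(1) t] by blast
  ultimately have "N = {0}"
    using tr_idempotent_zero[OF M sN _ \<open>lin P\<close>] fk[of K] char by (auto simp: N_def)
  then show ?thesis using that[of K] by (auto simp: N_def)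
qed

end

locale cvspace = vspace scale for scale :: "complex \<Rightarrow> 'b::ab_group_add \<Rightarrow> 'b" (infixr "*s" 75)
begin

text \<open>A nonzero polynomial of least degree annihilating u has a root \<mu>. Dividing out the
  linear factor leaves q with \<open>papply f q u\<close> nonzero by minimality, and this is an
  eigenvector.\<close>

lemma eigenvector_exists:
  assumes "fd M" "lin f" "f ` M \<subseteq> M" "M \<noteq> {0}"
  obtains v \<mu> where "v \<in> M" "v \<noteq> 0" "f v = \<mu> *s v"
proof -
  obtain u where u: "u \<in> M" "u \<noteq> 0" using assms subspace_0[OF fd_subspace] by blast
  obtain p where p: "p \<noteq> 0 \<and> papply f p u = 0"
    and min: "\<And>q. degree q < degree p \<Longrightarrow> \<not> (q \<noteq> 0 \<and> papply f q u = 0)"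
    using exists_least_iff[of "\<lambda>n. \<exists>p. degree p = n \<and> p \<noteq> 0 \<and> papply f p u = 0"]
      annihilating_poly_vector[OF assms(1-3) u(1)] by metis
  have "degree p \<noteq> 0"
  proof
    assume "degree p = 0"
    then obtain a where "p = [:a:]" by (metis degree_eq_zeroE)
    then show False using p u assms(2) by (auto simp: papply_const)
  qed
  then have "\<not> constant (poly p)" by (simp add: constant_degree)
  then obtain \<mu> where "poly p \<mu> = 0" using fundamental_theorem_of_algebra by blast
  then obtain q where q: "p = [:-\<mu>, 1:] * q" by (auto simp: poly_eq_0_iff_dvd dvd_def)
  then have q0: "q \<noteq> 0" using p by auto
  then have "degree p = Suc (degree q)" unfolding q by (subst degree_mult_eq) auto
  then have "papply f q u \<noteq> 0" using min[of q] q0 by simp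
  moreover have "f (papply f q u) = \<mu> *s papply f q u"
    using p assms(2) unfolding q papply_mult[OF assms(2)] by (simp add: papply_pCons lin_zero)
  moreover have "papply f q u \<in> M" using papply_closed assms u fd_subspace by blast
  ultimately show ?thesis using that by blast
qed

end

section \<open>Solvable Lie algebras of operators\<close>

text \<open>The bracket identities hold on the whole type, and subalgebras are subsets; this frees
  bracket calculations from membership conditions.\<close>

locale complex_lie = cvspace scale
  for scale :: "complex \<Rightarrow> 'b::ab_group_add \<Rightarrow> 'b" (infixr "*s" 75) +
  fixes br :: "'b \<Rightarrow> 'b \<Rightarrow> 'b"
  assumes lin_br_right: "lin (br x)" and lin_br_left: "lin (\<lambda>x. br x y)"
    and br_self: "br x x = 0"
    and br_br: "br (br x y) z = br x (br y z) - br y (br x z)"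
begin

lemma br_skew: "br y x = - br x y"
proof -
  have "br (x + y) (x + y) = br x x + br x y + (br y x + br y y)"
    by (simp add: lin_add[OF lin_br_right] lin_add[OF lin_br_left] algebra_simps)
  then show ?thesis by (simp add: br_self eq_neg_iff_add_eq_0 add.commute)
qed

definition subalg :: "'b set \<Rightarrow> bool" where
  "subalg S \<longleftrightarrow> fd S \<and> (\<forall>x\<in>S. \<forall>y\<in>S. br x y \<in> S)"

definition der :: "'b set \<Rightarrow> 'b set" where
  "der S = span {br x y |x y. x \<in> S \<and> y \<in> S}"

definition perfect :: "'b set \<Rightarrow> bool" where
  "perfect S \<longleftrightarrow> subalg S \<and> der S = S"

text \<open>In finite dimension, a Lie algebra is solvable iff it has no nonzero perfect subalgebra.\<close>

definition solvable :: "'b set \<Rightarrow> bool" where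
  "solvable S \<longleftrightarrow> subalg S \<and> (\<forall>P\<subseteq>S. perfect P \<longrightarrow> P = {0})"

text \<open>Linearity is global, so traces and functionals compose freely. Invariance and the
  bracket rule are asked only on S and M, so that composing with a projection can model a
  quotient.\<close>

definition rep :: "'b set \<Rightarrow> 'b set \<Rightarrow> ('b \<Rightarrow> 'b \<Rightarrow> 'b) \<Rightarrow> bool" where
  "rep S M act \<longleftrightarrow> fd M \<and> (\<forall>x. lin (act x)) \<and> (\<forall>m. lin (\<lambda>x. act x m)) \<and>
     (\<forall>x\<in>S. \<forall>m\<in>M. act x m \<in> M) \<and>
     (\<forall>x\<in>S. \<forall>y\<in>S. \<forall>m\<in>M. act (br x y) m = act x (act y m) - act y (act x m))"

lemma
  assumes "rep S M act"
  shows rep_fd: "fd M"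
    and rep_lin_right: "lin (act x)"
    and rep_lin_left: "lin (\<lambda>x. act x m)"
    and rep_closed: "x \<in> S \<Longrightarrow> m \<in> M \<Longrightarrow> act x m \<in> M"
    and rep_br: "x \<in> S \<Longrightarrow> y \<in> S \<Longrightarrow> m \<in> M \<Longrightarrow> act (br x y) m = act x (act y m) - act y (act x m)"
  using assms by (auto simp: rep_def)

lemma rep_image: "rep S M act \<Longrightarrow> x \<in> S \<Longrightarrow> act x ` M \<subseteq> M"
  using rep_closed by blast

lemma rep_mono: "rep S M act \<Longrightarrow> T \<subseteq> S \<Longrightarrow> rep T M act"
  by (auto simp: rep_def subset_iff)

lemma rep_subspace: "rep S M act \<Longrightarrow> subspace N \<Longrightarrow> N \<subseteq> M \<Longrightarrow>
    (\<And>x m. x \<in> S \<Longrightarrow> m \<in> N \<Longrightarrow> act x m \<in> N) \<Longrightarrow> rep S N act"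
  unfolding rep_def using fd_mono by (intro conjI) blast+

lemma subalg_fd: "subalg S \<Longrightarrow> fd S"
  and subalg_subspace: "subalg S \<Longrightarrow> subspace S"
  and subalg_br: "subalg S \<Longrightarrow> x \<in> S \<Longrightarrow> y \<in> S \<Longrightarrow> br x y \<in> S"
  by (auto simp: subalg_def fd_subspace)

lemma rep_adjoint: "subalg S \<Longrightarrow> subalg T \<Longrightarrow> T \<subseteq> S \<Longrightarrow> rep T S br"
  by (auto simp: rep_def subalg_fd subalg_br lin_br_left lin_br_right br_br subset_iff)

lemma solvable_subalg: "solvable S \<Longrightarrow> subalg T \<Longrightarrow> T \<subseteq> S \<Longrightarrow> solvable T"
  by (auto simp: solvable_def)

lemma der_subset: "subalg S \<Longrightarrow> der S \<subseteq> S"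
  unfolding der_def by (intro span_minimal) (auto simp: subalg_br subalg_subspace)

lemma subspace_der: "subspace (der S)"
  by (simp add: der_def)

lemma br_in_der: "x \<in> S \<Longrightarrow> y \<in> S \<Longrightarrow> br x y \<in> der S"
  unfolding der_def by (intro span_base) blast

lemma subalg_subspaceI: "subalg S \<Longrightarrow> subspace T \<Longrightarrow> T \<subseteq> S \<Longrightarrow>
    (\<And>x y. x \<in> T \<Longrightarrow> y \<in> T \<Longrightarrow> br x y \<in> T) \<Longrightarrow> subalg T"
  unfolding subalg_def using fd_mono by blast

lemma subalg_der: "subalg S \<Longrightarrow> subalg (der S)"
  by (rule subalg_subspaceI[OF _ subspace_der der_subset]) (auto dest: subsetD[OF der_subset] intro: br_in_der)

lemma subalg_0: "subalg {0}"
proof -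
  have "fd {0}" using fd_span[of "{}"] by simp
  then show ?thesis by (simp add: subalg_def lin_zero[OF lin_br_right])
qed

text \<open>Since N is invariant, \<open>\<pi> (act a (\<pi> u)) = \<pi> (act a u)\<close>: the
  inner projection changes its argument only by an element of N.\<close>

lemma rep_quotient:
  assumes "rep S M act" "subspace N" "N \<subseteq> M" "\<And>x m. x \<in> S \<Longrightarrow> m \<in> N \<Longrightarrow> act x m \<in> N"
    and "subspace C" "C \<subseteq> M" "lin \<pi>" "\<And>x. \<pi> x \<in> C" "\<And>x. x \<in> N \<Longrightarrow> \<pi> x = 0"
    "\<And>x. x \<in> M \<Longrightarrow> x - \<pi> x \<in> N"
  shows "rep S C (\<lambda>x m. \<pi> (act x m))"
  unfolding rep_def
proof (intro conjI ballI allI)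
  show "fd C" using fd_mono[OF rep_fd[OF assms(1)] assms(5,6)] .
  show "lin (\<lambda>m. \<pi> (act x m))" for x
    by (rule lin_compose[OF assms(7) rep_lin_right[OF assms(1)]])
  show "lin (\<lambda>x. \<pi> (act x m))" for m by (rule lin_compose[OF assms(7) rep_lin_left[OF assms(1)]])
  show "\<pi> (act x m) \<in> C" for x m by (rule assms(8))
  fix x y m assume x: "x \<in> S" "y \<in> S" "m \<in> C"
  have *: "\<pi> (act a (\<pi> u)) = \<pi> (act a u)" if "a \<in> S" "u \<in> M" for a u
  proof -
    have "\<pi> (act a (u - \<pi> u)) = 0" by (intro assms(4,9,10) that)
    then show ?thesis
      by (simp add: lin_diff[OF rep_lin_right[OF assms(1)]] lin_diff[OF assms(7)])
  qed
  have "m \<in> M" using x assms(6) by blast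
  moreover from this have "act x m \<in> M" "act y m \<in> M" using x rep_closed[OF assms(1)] by auto
  ultimately
  show "\<pi> (act (br x y) m) = \<pi> (act x (\<pi> (act y m))) - \<pi> (act y (\<pi> (act x m)))"
    using x * rep_br[OF assms(1), of x y m] lin_diff[OF assms(7)] by simp
qed

section \<open>Triangular chains and Lie's theorem\<close>

lemma triangular_invariant:
  fixes w :: "nat \<Rightarrow> 'b"
  assumes "lin f" "\<And>k. k < d \<Longrightarrow> f (w k) - \<mu> k *s w k \<in> span (w ` {..<k})" "k \<le> d" "u \<in> span (w ` {..<k})"
  shows "f u \<in> span (w ` {..<k})"
proof (rule lin_span[OF assms(1) _ subspace_span assms(4)])
  fix x assume "x \<in> w ` {..<k}"
  then obtain i where i: "i < k" "x = w i" by auto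
  have "span (w ` {..<i}) \<subseteq> span (w ` {..<k})" using i by (intro span_mono image_mono) (auto simp: lessThan_subset_iff)
  then have "f (w i) - \<mu> i *s w i \<in> span (w ` {..<k})" using assms(2)[of i] assms(3) i by auto
  moreover have "\<mu> i *s w i \<in> span (w ` {..<k})" using i by (intro span_scale span_base) auto
  ultimately show "f x \<in> span (w ` {..<k})" using span_add i by force
qed

lemma triangular_trace:
  fixes w :: "nat \<Rightarrow> 'b"
  assumes c: "coords (span (w ` {..<d})) {..<d} w c" and "lin f"
    and "\<And>k. k < d \<Longrightarrow> f (w k) - \<mu> k *s w k \<in> span (w ` {..<k})"
  shows "tr (span (w ` {..<d})) f = (\<Sum>k<d. \<mu> k)"
proof -
  have "fd (span (w ` {..<d}))" by (simp add: fd_span)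
  moreover have "f ` span (w ` {..<d}) \<subseteq> span (w ` {..<d})"
    using triangular_invariant[of f d w \<mu> d] assms by auto
  ultimately have "tr (span (w ` {..<d})) f = (\<Sum>k<d. c k (f (w k)))"
    using tr_coords[OF _ assms(2) _ c] by blast
  also have "\<dots> = (\<Sum>k<d. \<mu> k)"
  proof (intro sum.cong refl)
    fix k assume k: "k \<in> {..<d}"
    have l: "lfun (c k)" using coords_lfun[OF c k] .
    have "c k (w i) = 0" if "i < k" for i using coords_dual[OF c k, of i] that k by auto
    then have "c k (f (w k) - \<mu> k *s w k) = 0"
      using lfun_span_zero[OF l, of "w ` {..<k}"] assms(3) k by blast
    then show "c k (f (w k)) = \<mu> k"
      using coords_dual[OF c k k] by (simp add: lfun_diff[OF l] lfun_scale[OF l])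
  qed
  finally show ?thesis .
qed

text \<open>The square of a triangular operator has the squares on its diagonal; this turns the
  trace form into a sum of squares of weights.\<close>

lemma triangular_square:
  fixes w :: "nat \<Rightarrow> 'b"
  assumes "lin f" "\<And>k. k < d \<Longrightarrow> f (w k) - \<mu> k *s w k \<in> span (w ` {..<k})" "k < d"
  shows "f (f (w k)) - (\<mu> k)\<^sup>2 *s w k \<in> span (w ` {..<k})"
proof -
  let ?u = "f (w k) - \<mu> k *s w k"
  have "f ?u \<in> span (w ` {..<k})"
    by (rule triangular_invariant[of f d w \<mu> k, OF assms(1)]) (use assms in auto)
  moreover have "\<mu> k *s ?u \<in> span (w ` {..<k})" using assms by (intro span_scale) auto
  moreover have "f (f (w k)) - (\<mu> k)\<^sup>2 *s w k = f ?u + \<mu> k *s ?u"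
    by (simp add: lin_diff[OF assms(1)] lin_scale[OF assms(1)] power2_eq_square algebra_simps)
  ultimately show ?thesis using span_add by metis
qed

text \<open>Moving y past e produces the bracket of y and e, which modulo H is
  \<open>\<alpha> y\<close> times e, so each step of the chain adds \<alpha> to the weight. For an
  ideal \<alpha> is zero, as in Lie's theorem; for a subalgebra of codimension one it measures the
  failure to be an ideal.\<close>

lemma weight_chain:
  assumes r: "rep S M act" and H: "H \<subseteq> S" "e \<in> S" "\<And>y. y \<in> H \<Longrightarrow> br y e - \<alpha> y *s e \<in> H"
    and v: "v \<in> M" "\<And>y. y \<in> H \<Longrightarrow> act y v = \<theta> y *s v" and y: "y \<in> H"
  defines "w \<equiv> \<lambda>i. (act e ^^ i) v"
  shows "act y (w k) - (\<theta> y + of_nat k * \<alpha> y) *s w k \<in> span (w ` {..<k})"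
  using y
proof (induction k arbitrary: y)
  case 0
  then show ?case using v by (simp add: w_def)
next
  case (Suc k)
  have l: "lin (act x)" "lin (\<lambda>x. act x m)" for x m
    using rep_lin_right[OF r] rep_lin_left[OF r] by blast+
  have wM: "w i \<in> M" for i unfolding w_def using v(1) rep_closed[OF r H(2)] by (induction i) auto
  have wSuc: "act e (w i) = w (Suc i)" for i by (simp add: w_def)
  \<comment> \<open>The remainder is a different element of H, which is why the induction has to
    cover all y at once.\<close>
  define h where "h = br y e - \<alpha> y *s e"
  have hH: "h \<in> H" using H Suc.prems h_def by auto
  have up: "span (w ` {..<k}) \<subseteq> span (w ` {..<Suc k})" by (intro span_mono image_mono) auto
  have wk: "w k \<in> span (w ` {..<Suc k})" by (intro span_base) auto
  define \<mu> where "\<mu> = \<theta> y + of_nat k * \<alpha> y"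
  define u where "u = act y (w k) - \<mu> *s w k"
  have u: "u \<in> span (w ` {..<k})" using Suc.IH[OF Suc.prems] by (simp add: u_def \<mu>_def)
  have eu: "act e u \<in> span (w ` {..<Suc k})"
    by (rule lin_span[OF l(1) _ subspace_span u]) (auto simp: wSuc intro!: span_base)
  have "act h (w k) - (\<theta> h + of_nat k * \<alpha> h) *s w k \<in> span (w ` {..<Suc k})"
    using Suc.IH[OF hH] up by auto
  then have hw: "act h (w k) \<in> span (w ` {..<Suc k})"
    using span_add[OF _ span_scale[OF wk, of "\<theta> h + of_nat k * \<alpha> h"]] by force
  have "act y (w (Suc k)) = act (br y e) (w k) + act e (act y (w k))"
    using rep_br[OF r _ H(2) wM, of y k] H(1) Suc.prems by (auto simp: wSuc)
  also have "act (br y e) (w k) = act h (w k) + \<alpha> y *s w (Suc k)"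
    unfolding h_def by (simp add: lin_diff[OF l(2)] lin_scale[OF l(2)] wSuc)
  also have "act e (act y (w k)) = \<mu> *s w (Suc k) + act e u"
    unfolding u_def by (simp add: lin_diff[OF l(1)] lin_scale[OF l(1)] wSuc)
  finally have "act y (w (Suc k)) - (\<theta> y + of_nat (Suc k) * \<alpha> y) *s w (Suc k) = act h (w k) + act e u"
    by (simp add: \<mu>_def algebra_simps)
  then show ?case using span_add[OF hw eu] by metis
qed

text \<open>On the cyclic space of v under z, elements of J are triangular with constant diagonal,
  so \<open>br y z\<close> has trace d times \<open>\<theta> (br y z)\<close>. As a commutator it is
  traceless, so that weight is zero and y commutes with z on v.\<close>

lemma weight_space_invariant:
  assumes r: "rep S M act" and J: "J \<subseteq> S" "\<And>x y. x \<in> S \<Longrightarrow> y \<in> J \<Longrightarrow> br x y \<in> J" "subspace J"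
    and v: "v \<in> M" "\<And>y. y \<in> J \<Longrightarrow> act y v = \<theta> y *s v" and z: "z \<in> S" and y: "y \<in> J"
  shows "act y (act z v) = \<theta> y *s act z v"
proof (cases "v = 0")
  case True
  then show ?thesis using lin_zero[OF rep_lin_right[OF r]] by simp
next
  case False
  define w where "w i = (act z ^^ i) v" for i
  obtain d c where d: "d > 0" and c: "coords (span (w ` {..<d})) {..<d} w c"
    and W: "span (w ` {..<d}) \<subseteq> M" "act z ` span (w ` {..<d}) \<subseteq> span (w ` {..<d})"
    using chain_coords[OF rep_fd[OF r] rep_lin_right[OF r] rep_image[OF r z] v(1) False]
    unfolding w_def by metis
  let ?W = "span (w ` {..<d})"
  have brJ: "br x z \<in> J" if "x \<in> J" for x
    using J(2)[OF z that] br_skew[of x z] subspace_neg[OF J(3)] by simp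
  have tri: "act x (w k) - \<theta> x *s w k \<in> span (w ` {..<k})" if "x \<in> J" for x k
    using weight_chain[OF r J(1) z, of "\<lambda>_. 0" v \<theta>] v that brJ by (simp add: w_def)
  have fdW: "fd ?W" by (simp add: fd_span)
  have "tr ?W (act (br y z)) = of_nat d * \<theta> (br y z)"
    using triangular_trace[OF c rep_lin_right[OF r] tri[OF brJ[OF y]]] by simp
  moreover have "tr ?W (act (br y z)) = tr ?W (\<lambda>m. act y (act z m) - act z (act y m))"
    using rep_br[OF r _ z] W(1) y J(1) by (intro tr_cong[OF fdW]) blast
  moreover have "\<dots> = 0"
    using triangular_invariant[of "act y" d w "\<lambda>_. \<theta> y" d] tri[OF y] rep_lin_right[OF r] W(2)
    by (intro tr_commutator[OF fdW]) auto
  ultimately have "\<theta> (br y z) = 0" using d by simp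
  then have "act (br y z) v = 0" using v(2)[OF brJ[OF y]] by simp
  then show ?thesis
    using rep_br[OF r _ z v(1), of y] J(1) y v(2)[OF y] lin_scale[OF rep_lin_right[OF r]] by auto
qed

lemma subspace_weight_space:
  assumes "rep S M act"
  shows "subspace {m \<in> M. \<forall>y\<in>J. act y m = \<theta> y *s m}"
proof -
  note l = rep_lin_right[OF assms]
  show ?thesis
    using fd_subspace[OF rep_fd[OF assms]]
    by (auto simp: subspace_def lin_zero[OF l] lin_add[OF l] lin_scale[OF l] algebra_simps)
qed

text \<open>Lie's theorem. A nonzero solvable S is not perfect and so has an ideal of codimension
  one; a weight space of this ideal is invariant under a complementary element z, and an eigenvector
  of z in it is common to all of S.\<close>

lemma solvable_common_eigenvector:
  assumes "solvable S" "rep S M act" "M \<noteq> {0}"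
  shows "\<exists>v \<theta>. v \<in> M \<and> v \<noteq> 0 \<and> (\<forall>x\<in>S. act x v = \<theta> x *s v)"
  using assms(1,2)
proof (induction "dim S" arbitrary: S rule: less_induct)
  case less
  have S: "subalg S" using less.prems by (simp add: solvable_def)
  note r = less.prems(2)
  have l: "lin (act x)" "lin (\<lambda>x. act x m)" for x m
    using rep_lin_right[OF r] rep_lin_left[OF r] by blast+
  show ?case
  proof (cases "S = {0}")
    case True
    obtain v where "v \<in> M" "v \<noteq> 0" using assms(3) fd_subspace[OF rep_fd[OF r]] subspace_0 by blast
    then show ?thesis using True lin_zero[OF l(2)]
      by (intro exI[of _ v] exI[of _ "\<lambda>_. 0"]) simp
  next
    case False
    then have dS: "der S \<noteq> S" using less.prems S by (auto simp: solvable_def perfect_def)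
    obtain I J :: "'b set" and w c where J: "J \<subseteq> I" and cJ: "coords (der S) J w c" and cI: "coords S I w c"
      using coords_extend[OF subalg_fd[OF S] subspace_der der_subset[OF S]] .
    have "I \<noteq> J" using coords_span[OF cJ subspace_der] coords_span[OF cI subalg_subspace[OF S]] dS by blast
    then obtain i where i: "i \<in> I" "i \<notin> J" using J by blast
    have ci: "lfun (c i)" using coords_lfun[OF cI i(1)] .
    have cder: "c i x = 0" if "x \<in> der S" for x
    proof (rule lfun_span_zero[OF ci])
      show "x \<in> span (w ` J)" using that coords_span[OF cJ subspace_der] by simp
      show "c i u = 0" if "u \<in> w ` J" for u using that i J coords_dual[OF cI i(1)] by auto
    qed
    \<comment> \<open>The kernel of a coordinate vanishing on \<open>der S\<close>: a hyperplane
      containing all brackets, hence an ideal.\<close>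
    define K where "K = {x \<in> S. c i x = 0}"
    have sK: "subspace K" using subalg_subspace[OF S] ci
      unfolding K_def subspace_def by (auto simp: lfun_iff lfun_zero)
    have ideal: "br x y \<in> K" if "x \<in> S" "y \<in> S" for x y
      using subalg_br[OF S that] cder[OF br_in_der[OF that]] by (simp add: K_def)
    have KS: "K \<subseteq> S" by (auto simp: K_def)
    have K: "solvable K"
      by (rule solvable_subalg[OF less.prems(1) subalg_subspaceI[OF S sK KS] KS]) (use KS ideal in blast)
    define z where "z = w i"
    have z: "z \<in> S" "c i z = 1" using coords_mem[OF cI i(1)] coords_dual[OF cI i(1) i(1)] by (auto simp: z_def)
    then have "z \<notin> K" by (simp add: K_def)
    then have "K \<subset> S" using KS z(1) by blast
    then have "dim K < dim S" using dim_less[OF subalg_fd[OF S] sK] by blast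
    then obtain v \<theta> where v: "v \<in> M" "v \<noteq> 0" "\<And>x. x \<in> K \<Longrightarrow> act x v = \<theta> x *s v"
      using less.hyps[of K] K rep_mono[OF r KS] by metis
    define M' where "M' = {m \<in> M. \<forall>y\<in>K. act y m = \<theta> y *s m}"
    have "fd M'" unfolding M'_def by (rule fd_mono[OF rep_fd[OF r] subspace_weight_space[OF r]]) auto
    moreover have "act z ` M' \<subseteq> M'"
      using weight_space_invariant[OF r KS _ sK _ _ z(1), of _ \<theta>] ideal KS rep_closed[OF r z(1)]
      unfolding M'_def by blast
    moreover have "M' \<noteq> {0}" using v by (auto simp: M'_def)
    ultimately obtain u \<mu> where u: "u \<in> M'" "u \<noteq> 0" "act z u = \<mu> *s u"
      using eigenvector_exists[OF _ l(1)] by blast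
    have "act x u = (\<theta> (x - c i x *s z) + c i x * \<mu>) *s u" if "x \<in> S" for x
    proof -
      have "x - c i x *s z \<in> K"
        using that z subalg_subspace[OF S]
        by (auto simp: K_def lfun_diff[OF ci] lfun_scale[OF ci] intro!: subspace_diff subspace_scale)
      then have "act (x - c i x *s z) u = \<theta> (x - c i x *s z) *s u" using u(1) by (simp add: M'_def)
      then show ?thesis using u(3) by (simp add: lin_diff[OF l(2)] lin_scale[OF l(2)] algebra_simps)
    qed
    moreover have "u \<in> M" using u(1) by (simp add: M'_def)
    ultimately show ?thesis using u(2)
      by (intro exI[of _ u] exI[of _ "\<lambda>x. \<theta> (x - c i x *s z) + c i x * \<mu>"]) blast
  qed
qed


section \<open>Minimal perfect subalgebras and their trace forms\<close>

definition minimal_perfect :: "'b set \<Rightarrow> bool" where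
  "minimal_perfect S \<longleftrightarrow> perfect S \<and> S \<noteq> {0} \<and> (\<forall>T. subalg T \<longrightarrow> T \<subset> S \<longrightarrow> solvable T)"

lemma
  assumes "minimal_perfect S"
  shows minimal_perfect_subalg: "subalg S"
    and minimal_perfect_der: "der S = S"
    and minimal_perfect_nonzero: "S \<noteq> {0}"
    and minimal_perfect_solvable: "subalg T \<Longrightarrow> T \<subset> S \<Longrightarrow> solvable T"
  using assms by (auto simp: minimal_perfect_def perfect_def)

lemma perfect_subalg: "perfect S \<Longrightarrow> subalg S"
  by (simp add: perfect_def)

lemma minimal_perfect_exists:
  assumes "perfect P" "P \<noteq> {0}"
  shows "\<exists>S. S \<subseteq> P \<and> minimal_perfect S"
  using assms
proof (induction "dim P" arbitrary: P rule: less_induct)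
  case less
  show ?case
  proof (cases "minimal_perfect P")
    case False
    then obtain T where T: "subalg T" "T \<subset> P" "\<not> solvable T"
      using less.prems unfolding minimal_perfect_def by blast
    then obtain Q where Q: "Q \<subseteq> T" "perfect Q" "Q \<noteq> {0}" unfolding solvable_def by blast
    have "dim Q < dim P"
      using Q(1) T(2) by (intro dim_less[OF subalg_fd[OF perfect_subalg[OF less.prems(1)]]
            subalg_subspace[OF perfect_subalg[OF Q(2)]]]) blast
    then obtain S where "S \<subseteq> Q" "minimal_perfect S" using less.hyps[OF _ Q(2,3)] by blast
    then show ?thesis using Q(1) T(2) by blast
  qed blast
qed

text \<open>The bracket of e with itself drops out. When both differences lie in H, only brackets
  within H and brackets of H with e remain.\<close>

lemma br_decompose: "br x y = br (x - a *s e) (y - b *s e) + b *s br (x - a *s e) e - a *s br (y - b *s e) e"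
proof -
  have "br x y = br ((x - a *s e) + a *s e) ((y - b *s e) + b *s e)" by simp
  also have "\<dots> = br (x - a *s e) (y - b *s e) + b *s br (x - a *s e) e + a *s br e (y - b *s e)"
    unfolding lin_add[OF lin_br_right] lin_add[OF lin_br_left] lin_scale[OF lin_br_right]
      lin_scale[OF lin_br_left] br_self by (simp add: algebra_simps)
  also have "br e (y - b *s e) = - br (y - b *s e) e" by (rule br_skew)
  finally show ?thesis by simp
qed

text \<open>A maximal proper subalgebra is solvable, so Lie's theorem applies to its action on the quotient.\<close>

lemma minimal_perfect_codim_one:
  assumes S: "minimal_perfect S"
  obtains H e \<alpha> where "subalg H" "H \<subset> S" "e \<in> S" "\<And>x. x \<in> S \<Longrightarrow> \<exists>a. x - a *s e \<in> H"
    "\<And>y. y \<in> H \<Longrightarrow> br y e - \<alpha> y *s e \<in> H"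
proof -
  note sS = minimal_perfect_subalg[OF S]
  define Q where "Q n \<longleftrightarrow> (\<exists>H. subalg H \<and> H \<subset> S \<and> dim H = n)" for n
  have "Q (dim {0})" unfolding Q_def
    using subalg_0 minimal_perfect_nonzero[OF S] subspace_0[OF subalg_subspace[OF sS]] by blast
  moreover have "\<And>n. Q n \<Longrightarrow> n \<le> dim S"
    unfolding Q_def using dim_less[OF subalg_fd[OF sS]] subalg_subspace less_imp_le by blast
  ultimately obtain n where n: "Q n" "\<And>m. Q m \<Longrightarrow> m \<le> n"
    using Greatest_le_nat GreatestI_nat by metis
  then obtain H where H: "subalg H" "H \<subset> S" "dim H = n" unfolding Q_def by blast
  have HS: "H \<subseteq> S" using H(2) by blast
  note sH = subalg_subspace[OF H(1)]
  obtain C \<pi> where C: "subspace C" "C \<subseteq> S" "lin \<pi>" "\<And>x. \<pi> x \<in> C" "\<And>x. x \<in> C \<Longrightarrow> \<pi> x = x"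
    "\<And>x. x \<in> H \<Longrightarrow> \<pi> x = 0" "\<And>x. x \<in> S \<Longrightarrow> x - \<pi> x \<in> H"
    using complement_exists[OF subalg_fd[OF sS] sH HS] by blast
  have r: "rep H C (\<lambda>x m. \<pi> (br x m))"
    by (rule rep_quotient[OF rep_adjoint[OF sS H(1) HS] sH HS subalg_br[OF H(1)] C(1,2,3,4,6,7)])
  have "C \<noteq> {0}"
  proof
    assume 0: "C = {0}"
    have "x \<in> H" if "x \<in> S" for x using C(4)[of x] C(7)[OF that] 0 by simp
    then show False using H(2) by blast
  qed
  then obtain e \<alpha> where e: "e \<in> C" "e \<noteq> 0" "\<And>x. x \<in> H \<Longrightarrow> \<pi> (br x e) = \<alpha> x *s e"
    using solvable_common_eigenvector[OF minimal_perfect_solvable[OF S H(1,2)] r] by blast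
  have eS: "e \<in> S" using e(1) C(2) by blast
  have He: "br y e - \<alpha> y *s e \<in> H" if "y \<in> H" for y
    using C(7)[OF subalg_br[OF sS, of y e]] that HS eS e(3)[OF that] by auto
  \<comment> \<open>H plus the line of e. It is closed under the bracket because e is an eigenvector
    of H modulo H, so the maximal dimension of H forces T = S.\<close>
  define T where "T = {x \<in> S. \<exists>a. x - a *s e \<in> H}"
  have HT: "H \<subseteq> T" unfolding T_def using HS by (auto intro!: exI[of _ 0])
  have sT: "subspace T"
  proof (rule subspaceI)
    show "0 \<in> T" using HT subspace_0[OF sH] by blast
    fix x assume "x \<in> T"
    then obtain a where x: "x \<in> S" "x - a *s e \<in> H" by (auto simp: T_def)
    have "c *s x - (c * a) *s e = c *s (x - a *s e)" for c by (simp add: algebra_simps)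
    then show "c *s x \<in> T" for c
      unfolding T_def using subspace_scale[OF sH x(2)] subspace_scale[OF subalg_subspace[OF sS] x(1)]
      by (intro CollectI conjI exI[of _ "c * a"]) simp_all
    fix y assume "y \<in> T"
    then obtain b where y: "y \<in> S" "y - b *s e \<in> H" by (auto simp: T_def)
    have *: "(x + y) - (a + b) *s e = (x - a *s e) + (y - b *s e)" by (simp add: algebra_simps)
    have "(x + y) - (a + b) *s e \<in> H" unfolding * by (rule subspace_add[OF sH x(2) y(2)])
    then show "x + y \<in> T"
      unfolding T_def using subspace_add[OF subalg_subspace[OF sS] x(1) y(1)] by blast
  qed
  have "e \<in> T" unfolding T_def using eS subspace_0[OF sH] by (auto intro!: exI[of _ 1])
  have brT: "br h e \<in> T" if "h \<in> H" for h
    unfolding T_def using He[OF that] subalg_br[OF sS] HS eS that by blast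
  have "br x y \<in> T" if xy: "x \<in> T" "y \<in> T" for x y
  proof -
    obtain a b where ab: "x - a *s e \<in> H" "y - b *s e \<in> H" using xy by (auto simp: T_def)
    show ?thesis
      unfolding br_decompose[of x y a e b]
      using subsetD[OF HT subalg_br[OF H(1) ab]] brT[OF ab(1)] brT[OF ab(2)]
      by (intro subspace_add[OF sT] subspace_diff[OF sT] subspace_scale[OF sT])
  qed
  then have T: "subalg T" by (intro subalg_subspaceI[OF sS sT]) (auto simp: T_def)
  have "e \<notin> H" using C(5)[OF e(1)] C(6) e(2) by auto
  then have "dim H < dim T" using HT \<open>e \<in> T\<close> by (intro dim_less[OF subalg_fd[OF T] sH]) blast
  then have "\<not> T \<subset> S" using n(2)[of "dim T"] T H(3) unfolding Q_def by force
  then have "T = S" unfolding T_def by blast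
  then have "\<And>x. x \<in> S \<Longrightarrow> \<exists>a. x - a *s e \<in> H" unfolding T_def by blast
  then show ?thesis using that[of H e \<alpha>] H(1,2) eS He by blast
qed

text \<open>Complex squares may cancel, but the first equation makes x a real multiple of a, so the
  second is \<open>a\<^sup>2\<close> times a sum of squares of reals. The terms for k = 0 and k = 1
  cannot both vanish.\<close>

lemma arithmetic_progression_zero:
  fixes x a :: complex
  assumes "(\<Sum>k<d. x + of_nat k * a) = 0" "(\<Sum>k<d. (x + of_nat k * a)\<^sup>2) = 0" "d \<ge> 2"
  shows "a = 0"
proof (rule ccontr)
  assume a: "a \<noteq> 0"
  define \<rho> :: real where "\<rho> = - (\<Sum>k<d. real k) / real d"
  have "of_nat d * x + (\<Sum>k<d. of_nat k) * a = 0"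
    using assms(1) by (simp add: sum.distrib sum_distrib_right)
  then have "x = - ((\<Sum>k<d. of_nat k) / of_nat d) * a"
    using assms(3) by (simp add: field_simps eq_neg_iff_add_eq_0)
  then have x: "x = of_real \<rho> * a" by (simp add: \<rho>_def)
  have "(\<Sum>k<d. (x + of_nat k * a)\<^sup>2) = a\<^sup>2 * of_real (\<Sum>k<d. (\<rho> + real k)\<^sup>2)"
    by (simp add: x sum_distrib_left power2_eq_square algebra_simps)
  then have "(\<Sum>k<d. (\<rho> + real k)\<^sup>2) = 0" using assms(2) a by (metis mult_eq_0_iff of_real_eq_0_iff power_not_zero)
  then have "\<And>k. k < d \<Longrightarrow> (\<rho> + real k)\<^sup>2 = 0" by (simp add: sum_nonneg_eq_0_iff)
  from this[of 0] this[of 1] show False using assms(3) by simp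
qed

lemma tr_rep_br:
  assumes r: "rep S M act" and "x \<in> S" "y \<in> S"
  shows "tr M (act (br x y)) = 0"
  using rep_br[OF r assms(2,3)] tr_commutator[OF rep_fd[OF r] rep_lin_right[OF r] rep_lin_right[OF r]
    rep_image[OF r assms(2)] rep_image[OF r assms(3)]]
  by (subst tr_cong[OF rep_fd[OF r]]) auto

lemma lfun_tr_rep: "rep S M act \<Longrightarrow> lfun (\<lambda>x. tr M (act x))"
proof -
  assume r: "rep S M act"
  note l = rep_lin_left[OF r]
  have "act (x + y) = (\<lambda>m. act x m + act y m)" "act (c *s x) = (\<lambda>m. c *s act x m)" for x y c
    by (auto simp: lin_add[OF l] lin_scale[OF l])
  then show ?thesis by (simp add: lfun_iff tr_add[OF rep_fd[OF r]] tr_scale[OF rep_fd[OF r]])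
qed

lemma tr_rep_perfect:
  assumes r: "rep S M act" and "der S = S" "x \<in> S"
  shows "tr M (act x) = 0"
proof (rule lfun_span_zero[OF lfun_tr_rep[OF r]])
  show "x \<in> span {br x y |x y. x \<in> S \<and> y \<in> S}" using assms(2,3) by (simp add: der_def)
qed (use tr_rep_br[OF r] in blast)

definition irreducible_rep :: "'b set \<Rightarrow> 'b set \<Rightarrow> ('b \<Rightarrow> 'b \<Rightarrow> 'b) \<Rightarrow> bool" where
  "irreducible_rep S M act \<longleftrightarrow> rep S M act \<and> M \<noteq> {0} \<and>
     (\<forall>N. subspace N \<longrightarrow> N \<subseteq> M \<longrightarrow> (\<forall>x\<in>S. \<forall>m\<in>N. act x m \<in> N) \<longrightarrow> N = {0} \<or> N = M)"

lemma irreducible_full: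
  assumes "irreducible_rep S M act" "subspace N" "N \<subseteq> M" "\<And>x m. x \<in> S \<Longrightarrow> m \<in> N \<Longrightarrow> act x m \<in> N"
    and "v \<in> N" "v \<noteq> 0"
  shows "N = M"
  using assms unfolding irreducible_rep_def by blast

text \<open>If the form vanished, each y in H and its square would be traceless on M. By
  irreducibility the chain of e through a common eigenvector of H spans M, so the weights
  \<open>\<theta> y + of_nat k * \<alpha> y\<close> are the whole diagonal of y and \<alpha> must
  vanish. Then all brackets of S lie in H, against perfectness.\<close>

lemma trace_form_nonzero:
  assumes S: "minimal_perfect S" and irr: "irreducible_rep S M act" and nt: "x0 \<in> S" "m0 \<in> M" "act x0 m0 \<noteq> 0"
  shows "\<exists>x\<in>S. \<exists>y\<in>S. tr M (\<lambda>m. act x (act y m)) \<noteq> 0"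
proof (rule ccontr)
  assume "\<not> ?thesis"
  then have sq: "tr M (\<lambda>m. act x (act x m)) = 0" if "x \<in> S" for x using that by blast
  note sS = minimal_perfect_subalg[OF S]
  have r: "rep S M act" and M0: "M \<noteq> {0}" using irr by (auto simp: irreducible_rep_def)
  have l: "lin (act x)" "lin (\<lambda>x. act x m)" for x m
    using rep_lin_right[OF r] rep_lin_left[OF r] by blast+
  have tr0: "tr M (act x) = 0" if "x \<in> S" for x
    using tr_rep_perfect[OF r minimal_perfect_der[OF S] that] .
  obtain H e \<alpha> where H: "subalg H" "H \<subset> S" "e \<in> S" "\<And>x. x \<in> S \<Longrightarrow> \<exists>a. x - a *s e \<in> H"
    "\<And>y. y \<in> H \<Longrightarrow> br y e - \<alpha> y *s e \<in> H" using minimal_perfect_codim_one[OF S] by blast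
  have HS: "H \<subseteq> S" using H(2) by blast
  obtain v \<theta> where v: "v \<in> M" "v \<noteq> 0" "\<And>y. y \<in> H \<Longrightarrow> act y v = \<theta> y *s v"
    using solvable_common_eigenvector[OF minimal_perfect_solvable[OF S H(1,2)] rep_mono[OF r HS] M0] by blast
  define w where "w i = (act e ^^ i) v" for i
  obtain d c where d: "d > 0" and c: "coords (span (w ` {..<d})) {..<d} w c"
    and W: "span (w ` {..<d}) \<subseteq> M" "act e ` span (w ` {..<d}) \<subseteq> span (w ` {..<d})"
    using chain_coords[OF rep_fd[OF r] l(1) rep_image[OF r H(3)] v(1,2)]
    unfolding w_def by metis
  have tri: "act y (w k) - (\<theta> y + of_nat k * \<alpha> y) *s w k \<in> span (w ` {..<k})" if "y \<in> H" for y k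
    using weight_chain[OF r HS H(3,5) v(1,3) that] by (simp add: w_def)
  have Winv: "act x m \<in> span (w ` {..<d})" if "x \<in> S" "m \<in> span (w ` {..<d})" for x m
  proof -
    obtain a where a: "x - a *s e \<in> H" using H(4) \<open>x \<in> S\<close> by blast
    have "act (x - a *s e) m \<in> span (w ` {..<d})"
      using triangular_invariant[OF l(1) tri[OF a] order_refl that(2)] .
    moreover have "a *s act e m \<in> span (w ` {..<d})" using W(2) that(2) by (intro span_scale) blast
    ultimately have "act (x - a *s e) m + a *s act e m \<in> span (w ` {..<d})" by (rule span_add)
    then show ?thesis by (simp add: lin_diff[OF l(2)] lin_scale[OF l(2)])
  qed
  have "v \<in> span (w ` {..<d})" using d by (intro span_base) (auto simp: w_def image_iff intro!: bexI[of _ 0])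
  then have WM: "span (w ` {..<d}) = M"
    using irreducible_full[OF irr subspace_span W(1) Winv] v(2) by blast
  have sum1: "(\<Sum>k<d. \<theta> y + of_nat k * \<alpha> y) = 0" if "y \<in> H" for y
    using triangular_trace[OF c l(1) tri[OF that]] tr0[of y] HS that WM by auto
  have sum2: "(\<Sum>k<d. (\<theta> y + of_nat k * \<alpha> y)\<^sup>2) = 0" if "y \<in> H" for y
    using triangular_trace[OF c lin_compose[OF l(1) l(1)] triangular_square[OF l(1) tri[OF that]]]
      sq[of y] HS that WM by auto
  \<comment> \<open>In dimension one S acts by scalars, and these are zero because their traces are;
    the nontrivial action at \<open>m0\<close> excludes this.\<close>
  have "d \<noteq> 1"
  proof
    assume d1: "d = 1"
    have "M = span {v}" using WM by (simp add: d1 w_def lessThan_Suc)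
    obtain a where a: "act x0 v = a *s v"
      using rep_closed[OF r nt(1) v(1)] unfolding \<open>M = span {v}\<close> span_singleton by blast
    have x0: "act x0 m = a *s m" if "m \<in> M" for m
      using that a unfolding \<open>M = span {v}\<close> span_singleton by (auto simp: lin_scale[OF l(1)] mult.commute)
    have c0: "lfun (c 0)" "c 0 v = 1" using coords_lfun[OF c, of 0] coords_dual[OF c, of 0 0] d1 by (auto simp: w_def)
    have "tr M (act x0) = (\<Sum>k<d. c k (act x0 (w k)))"
      using tr_coords[OF rep_fd[OF r] l(1) rep_image[OF r nt(1)]] c WM by simp
    also have "\<dots> = a" using c0 a by (simp add: d1 w_def lfun_scale)
    finally have "a = 0" using tr0[OF nt(1)] by simp
    then show False using x0[OF nt(2)] nt(3) by simp
  qed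
  then have "d \<ge> 2" using d by simp
  then have \<alpha>0: "\<alpha> y = 0" if "y \<in> H" for y
    using arithmetic_progression_zero[OF sum1[OF that] sum2[OF that]] by blast
  then have He: "br y e \<in> H" if "y \<in> H" for y using H(5)[OF that] that by simp
  note sH = subalg_subspace[OF H(1)]
  have "br x y \<in> H" if "x \<in> S" "y \<in> S" for x y
  proof -
    obtain a b where ab: "x - a *s e \<in> H" "y - b *s e \<in> H" using H(4)[OF \<open>x \<in> S\<close>] H(4)[OF \<open>y \<in> S\<close>] by blast
    show ?thesis
      unfolding br_decompose[of x y a e b]
      using subalg_br[OF H(1) ab] He[OF ab(1)] He[OF ab(2)]
      by (intro subspace_add[OF sH] subspace_diff[OF sH] subspace_scale[OF sH])
  qed
  then have "der S \<subseteq> H" unfolding der_def by (intro span_minimal sH) blast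
  then show False using minimal_perfect_der[OF S] H(2) by blast
qed


section \<open>Exactness of cocycles over a minimal perfect subalgebra\<close>

lemma tr_ident_nonzero:
  assumes "fd M" "M \<noteq> {0}"
  shows "tr M (\<lambda>m. m) \<noteq> 0"
proof -
  obtain I :: "'b set" and v c where c: "coords M I v c" using coords_exists[OF assms(1)] .
  have "I \<noteq> {}"
  proof
    assume "I = {}"
    then have "M \<subseteq> {0}" using coords_expand[OF c] by auto
    then show False using assms fd_subspace subspace_0 by blast
  qed
  then show ?thesis using tr_ident[OF assms(1) c] coords_finite[OF c] by simp
qed

text \<open>A weight space of T is S-invariant, hence all of M, so T acts by scalars; a traceless
  scalar on a nonzero space is zero.\<close>

lemma solvable_ideal_acts_trivially:
  assumes irr: "irreducible_rep S M act" and S: "subalg S" "der S = S"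
    and T: "solvable T" "T \<subseteq> S" "\<And>x y. x \<in> S \<Longrightarrow> y \<in> T \<Longrightarrow> br x y \<in> T" and t: "t \<in> T" "m \<in> M"
  shows "act t m = 0"
proof -
  have r: "rep S M act" and M0: "M \<noteq> {0}" using irr by (auto simp: irreducible_rep_def)
  have sT: "subspace T" using T(1) subalg_subspace by (simp add: solvable_def)
  obtain v \<theta> where v: "v \<in> M" "v \<noteq> 0" "\<And>x. x \<in> T \<Longrightarrow> act x v = \<theta> x *s v"
    using solvable_common_eigenvector[OF T(1) rep_mono[OF r T(2)] M0] by blast
  define N where "N = {m \<in> M. \<forall>y\<in>T. act y m = \<theta> y *s m}"
  have "N = M"
  proof (rule irreducible_full[OF irr])
    show "subspace N" unfolding N_def by (rule subspace_weight_space[OF r])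
    show "act x m \<in> N" if "x \<in> S" "m \<in> N" for x m
      using weight_space_invariant[OF r T(2,3) sT _ _ that(1), of m \<theta>] that rep_closed[OF r]
      unfolding N_def by blast
    show "v \<in> N" "v \<noteq> 0" "N \<subseteq> M" using v by (auto simp: N_def)
  qed
  then have \<theta>: "act y m = \<theta> y *s m" if "y \<in> T" "m \<in> M" for y m using that by (auto simp: N_def)
  have "tr M (act t) = tr M (\<lambda>m. \<theta> t *s m)" using \<theta> t by (intro tr_cong[OF rep_fd[OF r]]) auto
  also have "\<dots> = \<theta> t * tr M (\<lambda>m. m)" by (rule tr_scale[OF rep_fd[OF r]])
  finally have "\<theta> t * tr M (\<lambda>m. m) = 0" using tr_rep_perfect[OF r S(2)] t T(2) by auto
  moreover have "tr M (\<lambda>m. m) \<noteq> 0" using tr_ident_nonzero[OF rep_fd[OF r] M0] .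
  ultimately show ?thesis using \<theta> t by simp
qed

text \<open>Shrink A to a subalgebra B of least dimension that still supplements T. Replacing
  arguments by representatives in B changes a bracket only by elements of T, so, S being perfect,
  \<open>der B\<close> supplements T as well and B is perfect. Inside the solvable A this means B =
  {0}, and T would be all of S.\<close>

lemma perfect_sum_ideal:
  assumes S: "minimal_perfect S" and A: "subalg A" "A \<subset> S"
    and T: "subspace T" "T \<subset> S" "\<And>x y. x \<in> S \<Longrightarrow> y \<in> T \<Longrightarrow> br x y \<in> T"
    and sum: "\<And>x. x \<in> S \<Longrightarrow> \<exists>a\<in>A. x - a \<in> T"
  shows False
proof -
  note sS = minimal_perfect_subalg[OF S]
  define Q where "Q B \<longleftrightarrow> subalg B \<and> B \<subseteq> A \<and> (\<forall>x\<in>S. \<exists>a\<in>B. x - a \<in> T)" for B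
  have "Q A" using A sum by (simp add: Q_def)
  then obtain B where B: "Q B" and min: "\<And>B'. Q B' \<Longrightarrow> dim B \<le> dim B'"
    using arg_min_natI[of Q A dim] arg_min_nat_le[of Q _ dim] by metis
  have sB: "subalg B" "B \<subseteq> A" and dec: "\<And>x. x \<in> S \<Longrightarrow> \<exists>a\<in>B. x - a \<in> T" using B by (auto simp: Q_def)
  have "\<exists>a\<in>der B. x - a \<in> T" if "x \<in> S" for x
  proof -
    have "x \<in> span {br x y |x y. x \<in> S \<and> y \<in> S}" using that minimal_perfect_der[OF S] by (simp add: der_def)
    then show ?thesis
    proof (induction rule: span_induct_alt)
      case base
      show ?case using subspace_0[OF subspace_der] subspace_0[OF T(1)] by (intro bexI[of _ 0]) simp_all
    next
      case (step k u y)
      then obtain p q b where u: "u = br p q" "p \<in> S" "q \<in> S" and b: "b \<in> der B" "y - b \<in> T" by blast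
      obtain p' q' where p': "p' \<in> B" "p - p' \<in> T" and q': "q' \<in> B" "q - q' \<in> T"
        using dec[OF u(2)] dec[OF u(3)] by blast
      have "p' \<in> S" using p' sB A by blast
      have "u - br p' q' = br p' (q - q') - br q (p - p')"
        using br_skew[of q "p - p'"] by (simp add: u(1) lin_diff[OF lin_br_right] lin_diff[OF lin_br_left] br_skew[of q])
      then have "u - br p' q' \<in> T"
        using T(3)[OF \<open>p' \<in> S\<close> q'(2)] T(3)[OF u(3) p'(2)] subspace_diff[OF T(1)] by simp
      then have "k *s (u - br p' q') + (y - b) \<in> T"
        using b(2) by (intro subspace_add[OF T(1)] subspace_scale[OF T(1)])
      moreover have "k *s (u - br p' q') + (y - b) = k *s u + y - (k *s br p' q' + b)"
        by (simp add: algebra_simps)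
      ultimately have "k *s u + y - (k *s br p' q' + b) \<in> T" by metis
      moreover have "k *s br p' q' + b \<in> der B"
        using br_in_der[OF p'(1) q'(1)] b(1) by (intro subspace_add subspace_scale subspace_der)
      ultimately show ?case by blast
    qed
  qed
  then have "Q (der B)" using subalg_der[OF sB(1)] der_subset[OF sB(1)] sB(2) by (auto simp: Q_def)
  then have "\<not> der B \<subset> B" using min dim_less[OF subalg_fd[OF sB(1)] subspace_der] by (metis not_less)
  then have "perfect B" using der_subset[OF sB(1)] sB(1) by (auto simp: perfect_def)
  then have "B = {0}" using minimal_perfect_solvable[OF S A] sB(2) by (auto simp: solvable_def)
  then have "x \<in> T" if "x \<in> S" for x using dec[OF that] by simp
  then show False using T(2) by blast
qed

text \<open>A 1-cocycle with values in the dual of \<open>M\<close>, written as a bilinear map.\<close>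

definition cocycle :: "'b set \<Rightarrow> 'b set \<Rightarrow> ('b \<Rightarrow> 'b \<Rightarrow> 'b) \<Rightarrow> ('b \<Rightarrow> 'b \<Rightarrow> complex) \<Rightarrow> bool" where
  "cocycle S M act \<phi> \<longleftrightarrow> (\<forall>x. lfun (\<phi> x)) \<and> (\<forall>m. lfun (\<lambda>x. \<phi> x m)) \<and>
     (\<forall>x\<in>S. \<forall>y\<in>S. \<forall>m\<in>M. \<phi> (br x y) m = \<phi> x (act y m) - \<phi> y (act x m))"

lemma
  assumes "cocycle S M act \<phi>"
  shows cocycle_lfun_right: "lfun (\<phi> x)" and cocycle_lfun_left: "lfun (\<lambda>x. \<phi> x m)"
    and cocycle_br: "x \<in> S \<Longrightarrow> y \<in> S \<Longrightarrow> m \<in> M \<Longrightarrow> \<phi> (br x y) m = \<phi> x (act y m) - \<phi> y (act x m)"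
  using assms by (auto simp: cocycle_def)

text \<open>For t in T the cocycle rule reads
  \<open>\<phi> (br x t) m = - \<phi> t (act x m)\<close>, so the common kernel N of T in M is
  invariant, hence {0} or M. If it were {0}, every x in S could be corrected by an element of T into
  the subalgebra A of elements annihilated by \<phi>, so that S = A + T, against
  \<open>perfect_sum_ideal\<close>.\<close>

lemma cocycle_vanishes_on_ideal:
  assumes S: "minimal_perfect S" and irr: "irreducible_rep S M act" and \<phi>: "cocycle S M act \<phi>"
    and T: "subspace T" "T \<subset> S" "\<And>x y. x \<in> S \<Longrightarrow> y \<in> T \<Longrightarrow> br x y \<in> T"
    and triv: "\<And>t m. t \<in> T \<Longrightarrow> m \<in> M \<Longrightarrow> act t m = 0" and t: "t \<in> T" "m \<in> M"
  shows "\<phi> t m = 0"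
proof -
  note sS = minimal_perfect_subalg[OF S]
  have TS: "T \<subseteq> S" using T(2) by blast
  have r: "rep S M act" and M0: "M \<noteq> {0}" using irr by (auto simp: irreducible_rep_def)
  note l = cocycle_lfun_right[OF \<phi>] cocycle_lfun_left[OF \<phi>]
  define N where "N = {z \<in> M. \<forall>t\<in>T. \<phi> t z = 0}"
  have sM: "subspace M" using fd_subspace[OF rep_fd[OF r]] .
  have sN: "subspace N"
    using sM by (auto simp: N_def subspace_def lfun_zero[OF l(1)] lfun_add[OF l(1)] lfun_scale[OF l(1)])
  have Ninv: "act x z \<in> N" if "x \<in> S" "z \<in> N" for x z
  proof -
    have z: "z \<in> M" using that(2) by (simp add: N_def)
    have "\<phi> t (act x z) = 0" if "t \<in> T" for t
      using cocycle_br[OF \<phi> \<open>x \<in> S\<close> subsetD[OF TS that] z] T(3)[OF \<open>x \<in> S\<close> that] triv[OF that z] \<open>z \<in> N\<close>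
      by (simp add: N_def lfun_zero[OF l(1)])
    then show ?thesis using rep_closed[OF r that(1) z] by (simp add: N_def)
  qed
  have "N = {0} \<or> N = M"
    using irr sN Ninv unfolding irreducible_rep_def N_def by blast
  moreover have "N \<noteq> {0}"
  proof
    assume N0: "N = {0}"
    obtain I :: "'b set" and v c where c: "coords M I v c" using coords_exists[OF rep_fd[OF r]] .
    have "\<exists>g. (\<forall>i\<in>I. g i \<in> T) \<and> (\<forall>i\<in>I. \<forall>j\<in>I. \<phi> (g i) (v j) = (if i = j then 1 else 0))"
    proof (rule dual_coords[OF c T(1) l _ sM])
      fix x assume "x \<in> M" "\<And>k. k \<in> T \<Longrightarrow> \<phi> k x = 0"
      then show "x = 0" using N0 by (auto simp: N_def)
    qed
    then obtain g where g: "\<And>i. i \<in> I \<Longrightarrow> g i \<in> T"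
      "\<And>i j. i \<in> I \<Longrightarrow> j \<in> I \<Longrightarrow> \<phi> (g i) (v j) = (if i = j then 1 else 0)" by blast
    define A where "A = {x \<in> S. \<forall>z\<in>M. \<phi> x z = 0}"
    have sA: "subspace A" using subalg_subspace[OF sS]
      by (auto simp: A_def subspace_def lfun_zero[OF l(2)] lfun_add[OF l(2)] lfun_scale[OF l(2)])
    have A: "subalg A"
      by (rule subalg_subspaceI[OF sS sA])
        (auto simp: A_def cocycle_br[OF \<phi>] rep_closed[OF r] subalg_br[OF sS])
    have dec: "\<exists>a\<in>A. x - a \<in> T" if x: "x \<in> S" for x
    proof -
      define k where "k = (\<Sum>i\<in>I. \<phi> x (v i) *s g i)"
      have kT: "k \<in> T" unfolding k_def using g(1) by (intro subspace_sum[OF T(1)] subspace_scale[OF T(1)])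
      have v0: "\<phi> (x - k) (v j) = 0" if "j \<in> I" for j
      proof -
        have "\<phi> k (v j) = (\<Sum>i\<in>I. if i = j then \<phi> x (v i) else 0)"
          unfolding k_def lfun_sum[OF l(2)] lfun_scale[OF l(2)] using g(2) that by (intro sum.cong) auto
        then show ?thesis using that coords_finite[OF c] by (simp add: lfun_diff[OF l(2)])
      qed
      have "\<phi> (x - k) z = 0" if "z \<in> M" for z
        using lfun_span_zero[OF l(1), of "v ` I" "x - k" z] v0 that coords_span[OF c sM] by auto
      then have "x - k \<in> A"
        using x kT TS subspace_diff[OF subalg_subspace[OF sS]] by (auto simp: A_def)
      then show ?thesis using kT by (intro bexI[of _ "x - k"]) simp_all
    qed
    have "A \<noteq> S"
    proof
      assume "A = S"
      then have "N = M" using TS by (auto simp: A_def N_def)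
      then show False using N0 M0 by simp
    qed
    then have "A \<subset> S" by (auto simp: A_def)
    then show False using perfect_sum_ideal[OF S A _ T dec] by blast
  qed
  ultimately have "N = M" by blast
  then show ?thesis using t by (auto simp: N_def)
qed

text \<open>Whitehead's argument with the trace form \<tau>. Its radical T is a proper ideal,
  solvable by minimality, on which both the action and \<phi> vanish; hence dual families for a
  complement of T suffice to build a Casimir operator. If the action is trivial, \<phi> vanishes on
  brackets and so on S.\<close>

lemma cocycle_exact_irreducible:
  assumes S: "minimal_perfect S" and irr: "irreducible_rep S M act" and \<phi>: "cocycle S M act \<phi>"
  shows "\<exists>\<psi>. lfun \<psi> \<and> (\<forall>x\<in>S. \<forall>m\<in>M. \<phi> x m = \<psi> (act x m))"
proof (cases "\<forall>x\<in>S. \<forall>m\<in>M. act x m = 0")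
  case True
  have r: "rep S M act" using irr by (auto simp: irreducible_rep_def)
  note l = cocycle_lfun_right[OF \<phi>] cocycle_lfun_left[OF \<phi>]
  have "\<phi> x m = 0" if "x \<in> S" "m \<in> M" for x m
  proof (rule lfun_span_zero[OF l(2)])
    show "x \<in> span {br x y |x y. x \<in> S \<and> y \<in> S}" using that minimal_perfect_der[OF S] by (simp add: der_def)
    show "\<phi> u m = 0" if "u \<in> {br x y |x y. x \<in> S \<and> y \<in> S}" for u
      using that True \<open>m \<in> M\<close> cocycle_br[OF \<phi>] lfun_zero[OF l(1)] by auto
  qed
  then show ?thesis by (intro exI[of _ "\<lambda>_. 0"]) (simp add: lfun_iff)
next
  case False
  then obtain x0 m0 where nt: "x0 \<in> S" "m0 \<in> M" "act x0 m0 \<noteq> 0" by blast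
  note sS = minimal_perfect_subalg[OF S] and dS = minimal_perfect_der[OF S]
  note subS = subalg_subspace[OF sS]
  have r: "rep S M act" and M0: "M \<noteq> {0}" using irr by (auto simp: irreducible_rep_def)
  note la = rep_lin_right[OF r] rep_lin_left[OF r]
  note l = cocycle_lfun_right[OF \<phi>] cocycle_lfun_left[OF \<phi>]
  note fdM = rep_fd[OF r]
  note sM = fd_subspace[OF fdM]
  define \<tau> where "\<tau> x y = tr M (\<lambda>m. act x (act y m))" for x y
  have \<tau>lin: "lfun (\<tau> x)" "lfun (\<lambda>x. \<tau> x y)" for x y
    by (auto simp: lfun_iff \<tau>_def lin_add[OF la(1)] lin_add[OF la(2)] lin_scale[OF la(1)]
        lin_scale[OF la(2)] tr_add[OF fdM] tr_scale[OF fdM])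
  have \<tau>sym: "\<tau> x y = \<tau> y x" if "x \<in> S" "y \<in> S" for x y
    unfolding \<tau>_def using tr_commute[OF fdM la(1) la(1)] rep_image[OF r] that by blast
  have \<tau>inv: "\<tau> (br x y) z = \<tau> x (br y z)" if "x \<in> S" "y \<in> S" "z \<in> S" for x y z
  proof -
    have "\<tau> (br x y) z = tr M (\<lambda>m. act x (act y (act z m)) - act y (act x (act z m)))"
      unfolding \<tau>_def by (rule tr_cong[OF fdM]) (use rep_br[OF r] rep_closed[OF r] that in simp)
    moreover have "\<tau> x (br y z) = tr M (\<lambda>m. act x (act y (act z m)) - act x (act z (act y m)))"
      unfolding \<tau>_def by (rule tr_cong[OF fdM]) (use rep_br[OF r] that in \<open>simp add: lin_diff[OF la(1)]\<close>)
    moreover have "tr M (\<lambda>m. act y ((\<lambda>m. act x (act z m)) m)) = tr M (\<lambda>m. (\<lambda>m. act x (act z m)) (act y m))"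
      using rep_image[OF r] that rep_closed[OF r]
      by (intro tr_commute[OF fdM la(1) lin_compose[OF la(1) la(1)]]) auto
    ultimately show ?thesis by (simp add: tr_diff[OF fdM])
  qed
  define T where "T = {x \<in> S. \<forall>y\<in>S. \<tau> x y = 0}"
  have sT: "subspace T" using subS
    by (auto simp: T_def subspace_def lfun_zero[OF \<tau>lin(2)] lfun_add[OF \<tau>lin(2)] lfun_scale[OF \<tau>lin(2)])
  have TS: "T \<subseteq> S" by (auto simp: T_def)
  have Tid: "br x y \<in> T" if "x \<in> S" "y \<in> T" for x y
  proof -
    have y: "y \<in> S" using that TS by blast
    have "\<tau> (br y x) z = 0" if "z \<in> S" for z
      using \<tau>inv[OF y \<open>x \<in> S\<close> that] subalg_br[OF sS \<open>x \<in> S\<close> that] \<open>y \<in> T\<close> by (simp add: T_def)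
    then have "br y x \<in> T" using subalg_br[OF sS y that(1)] by (simp add: T_def)
    then show ?thesis using br_skew[of x y] subspace_neg[OF sT] by simp
  qed
  have "T \<noteq> S" using trace_form_nonzero[OF S irr nt] by (auto simp: T_def \<tau>_def)
  then have TS': "T \<subset> S" using TS by blast
  have "subalg T" by (rule subalg_subspaceI[OF sS sT TS]) (use Tid TS in blast)
  then have solT: "solvable T" using minimal_perfect_solvable[OF S _ TS'] by blast
  have Tact: "act t m = 0" if "t \<in> T" "m \<in> M" for t m
    using solvable_ideal_acts_trivially[OF irr sS dS solT TS Tid that] .
  have T\<phi>: "\<phi> t m = 0" if "t \<in> T" "m \<in> M" for t m
    using cocycle_vanishes_on_ideal[OF S irr \<phi> sT TS' Tid Tact that] .
  obtain C \<pi> where C: "subspace C" "C \<subseteq> S" "lin \<pi>" "\<And>x. \<pi> x \<in> C" "\<And>x. x \<in> C \<Longrightarrow> \<pi> x = x"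
    "\<And>x. x \<in> T \<Longrightarrow> \<pi> x = 0" "\<And>x. x \<in> S \<Longrightarrow> x - \<pi> x \<in> T"
    using complement_exists[OF subalg_fd[OF sS] sT TS] by blast
  obtain I :: "'b set" and v c where c: "coords C I v c" using coords_exists[OF fd_mono[OF subalg_fd[OF sS] C(1,2)]] .
  have vS: "v i \<in> S" if "i \<in> I" for i using coords_mem[OF c that] C(2) by blast
  have "\<exists>g. (\<forall>i\<in>I. g i \<in> S) \<and> (\<forall>i\<in>I. \<forall>j\<in>I. \<tau> (g i) (v j) = (if i = j then 1 else 0))"
  proof (rule dual_coords[OF c subS \<tau>lin _ C(1)])
    fix x assume x: "x \<in> C" "\<And>k. k \<in> S \<Longrightarrow> \<tau> k x = 0"
    then have "x \<in> T" using C(2) \<tau>sym by (auto simp: T_def)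
    then show "x = 0" using C(5)[OF x(1)] C(6) by simp
  qed
  then obtain g where g: "\<And>i. i \<in> I \<Longrightarrow> g i \<in> S"
    "\<And>i j. i \<in> I \<Longrightarrow> j \<in> I \<Longrightarrow> \<tau> (g i) (v j) = (if i = j then 1 else 0)" by blast
  have fin: "finite I" using coords_finite[OF c] .
  \<comment> \<open>Expansions in the dual families hold only modulo the radical. This suffices
    because every bilinear expression F inserted below vanishes when one argument lies in T.\<close>
  have exp_v: "y - (\<Sum>j\<in>I. \<tau> (g j) y *s v j) \<in> T" if y: "y \<in> S" for y
  proof -
    have 1: "\<tau> (g j) y = c j (\<pi> y)" if j: "j \<in> I" for j
    proof -
      have "y - \<pi> y \<in> T" "y - \<pi> y \<in> S" using C(7)[OF y] TS by auto
      then have "\<tau> (g j) (y - \<pi> y) = 0" using \<tau>sym[OF g(1)[OF j], of "y - \<pi> y"] g(1)[OF j] by (simp add: T_def)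
      then have "\<tau> (g j) y = \<tau> (g j) (\<pi> y)" by (simp add: lfun_diff[OF \<tau>lin(1)])
      also have "\<dots> = \<tau> (g j) (\<Sum>i\<in>I. c i (\<pi> y) *s v i)" using coords_expand[OF c C(4)] by simp
      also have "\<dots> = (\<Sum>i\<in>I. if i = j then c i (\<pi> y) else 0)"
        unfolding lfun_sum[OF \<tau>lin(1)] lfun_scale[OF \<tau>lin(1)] using g(2) j by (intro sum.cong) auto
      finally show ?thesis using j fin by simp
    qed
    have "(\<Sum>j\<in>I. \<tau> (g j) y *s v j) = \<pi> y" using 1 coords_expand[OF c C(4)[of y]] by simp
    then show ?thesis using C(7)[OF y] by simp
  qed
  have exp_g: "y - (\<Sum>i\<in>I. \<tau> y (v i) *s g i) \<in> T" if y: "y \<in> S" for y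
  proof -
    define D where "D = y - (\<Sum>i\<in>I. \<tau> y (v i) *s g i)"
    have DS: "D \<in> S" unfolding D_def using y g(1) by (intro subspace_diff[OF subS] subspace_sum[OF subS] subspace_scale[OF subS])
    have Dv: "\<tau> D (v j) = 0" if "j \<in> I" for j
    proof -
      have "\<tau> (\<Sum>i\<in>I. \<tau> y (v i) *s g i) (v j) = (\<Sum>i\<in>I. if i = j then \<tau> y (v i) else 0)"
        unfolding lfun_sum[OF \<tau>lin(2)] lfun_scale[OF \<tau>lin(2)] using g(2) that by (intro sum.cong) auto
      then show ?thesis using that fin by (simp add: D_def lfun_diff[OF \<tau>lin(2)])
    qed
    have "\<tau> D u = 0" if u: "u \<in> S" for u
    proof -
      have "\<tau> D (u - (\<Sum>j\<in>I. \<tau> (g j) u *s v j)) = 0"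
        using exp_v[OF u] \<tau>sym[OF DS] DS TS by (auto simp: T_def)
      then show ?thesis
        using Dv by (simp add: lfun_diff[OF \<tau>lin(1)] lfun_sum[OF \<tau>lin(1)] lfun_scale[OF \<tau>lin(1)])
    qed
    then show ?thesis using DS by (simp add: T_def D_def)
  qed
  text \<open>Invariance of the Casimir tensor \<open>\<Sum>i. v i \<otimes> g i\<close>.\<close>
  have casimir: "(\<Sum>i\<in>I. F (br x (v i)) (g i)) + (\<Sum>i\<in>I. F (v i) (br x (g i))) = 0"
    if x: "x \<in> S" and F: "\<And>a. lfun (F a)" "\<And>b. lfun (\<lambda>a. F a b)"
      "\<And>a b. a \<in> T \<Longrightarrow> b \<in> S \<Longrightarrow> F a b = 0" "\<And>a b. a \<in> S \<Longrightarrow> b \<in> T \<Longrightarrow> F a b = 0"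
    for x and F :: "'b \<Rightarrow> 'b \<Rightarrow> complex"
  proof -
    have 1: "F (br x (v i)) (g i) = (\<Sum>j\<in>I. \<tau> (g j) (br x (v i)) * F (v j) (g i))" if "i \<in> I" for i
      using F(3)[OF exp_v[OF subalg_br[OF sS x vS[OF that]]] g(1)[OF that]]
      by (simp add: lfun_diff[OF F(2)] lfun_sum[OF F(2)] lfun_scale[OF F(2)])
    have 2: "F (v j) (br x (g j)) = (\<Sum>i\<in>I. - \<tau> (g j) (br x (v i)) * F (v j) (g i))" if j: "j \<in> I" for j
    proof -
      have "\<tau> (br x (g j)) (v i) = - \<tau> (g j) (br x (v i))" if "i \<in> I" for i
        using \<tau>inv[OF g(1)[OF j] x vS[OF that]] br_skew[of x "g j"] by (simp add: lfun_minus[OF \<tau>lin(2)])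
      then show ?thesis
        using F(4)[OF vS[OF j] exp_g[OF subalg_br[OF sS x g(1)[OF j]]]]
        by (simp add: lfun_diff[OF F(1)] lfun_sum[OF F(1)] lfun_minus[OF F(1)] lfun_scale[OF F(1)])
    qed
    have "(\<Sum>i\<in>I. F (br x (v i)) (g i)) = (\<Sum>j\<in>I. \<Sum>i\<in>I. \<tau> (g j) (br x (v i)) * F (v j) (g i))"
      using 1 by (subst sum.swap) simp
    moreover have "(\<Sum>i\<in>I. F (v i) (br x (g i))) = (\<Sum>j\<in>I. \<Sum>i\<in>I. - \<tau> (g j) (br x (v i)) * F (v j) (g i))"
      using 2 by simp
    ultimately show ?thesis by (simp add: sum_negf)
  qed
  define Z where "Z m = (\<Sum>i\<in>I. act (v i) (act (g i) m))" for m
  have linZ: "lin Z"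
    by (simp add: Z_def lin_iff lin_add[OF la(1)] lin_scale[OF la(1)] sum.distrib scale_sum_right)
  have ZM: "Z m \<in> M" if "m \<in> M" for m
    unfolding Z_def using that vS g(1) rep_closed[OF r] by (intro subspace_sum[OF sM]) blast
  obtain IM :: "'b set" and vM cM where cM: "coords M IM vM cM" using coords_exists[OF fdM] .
  have Zcomm: "act x (Z m) = Z (act x m)" if x: "x \<in> S" and m: "m \<in> M" for x m
  proof -
    have "cM k (act x (Z m)) = cM k (Z (act x m))" if k: "k \<in> IM" for k
    proof -
      note lk = coords_lfun[OF cM k]
      have "(\<Sum>i\<in>I. cM k (act (br x (v i)) (act (g i) m))) + (\<Sum>i\<in>I. cM k (act (v i) (act (br x (g i)) m))) = 0"
        using casimir[OF x, of "\<lambda>a b. cM k (act a (act b m))"] lk Tact rep_closed[OF r _ m] m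
        by (simp add: lfun_iff lin_add[OF la(1)] lin_add[OF la(2)] lin_scale[OF la(1)]
            lin_scale[OF la(2)] lin_zero[OF la(1)] lfun_zero[OF lk])
      moreover have "act (br x (v i)) (act (g i) m) + act (v i) (act (br x (g i)) m)
          = act x (act (v i) (act (g i) m)) - act (v i) (act (g i) (act x m))" if "i \<in> I" for i
        using rep_br[OF r x vS[OF that] rep_closed[OF r g(1)[OF that] m]] rep_br[OF r x g(1)[OF that] m]
        by (simp add: lin_diff[OF la(1)])
      ultimately have "(\<Sum>i\<in>I. cM k (act x (act (v i) (act (g i) m)) - act (v i) (act (g i) (act x m)))) = 0"
        by (simp flip: sum.distrib lfun_add[OF lk])
      then show ?thesis
        by (simp add: Z_def lin_sum[OF la(1)] lfun_sum[OF lk] lfun_diff[OF lk] sum_subtractf)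
    qed
    then have "(\<Sum>k\<in>IM. cM k (act x (Z m)) *s vM k) = (\<Sum>k\<in>IM. cM k (Z (act x m)) *s vM k)" by simp
    then show ?thesis
      using coords_expand[OF cM rep_closed[OF r x ZM[OF m]]] coords_expand[OF cM ZM[OF rep_closed[OF r x m]]]
      by simp
  qed
  obtain m1 \<mu> where m1: "m1 \<in> M" "m1 \<noteq> 0" "Z m1 = \<mu> *s m1"
    using eigenvector_exists[OF fdM linZ _ M0] ZM by blast
  define N where "N = {m \<in> M. Z m = \<mu> *s m}"
  have "N = M"
  proof (rule irreducible_full[OF irr])
    show "subspace N" using sM
      by (auto simp: N_def subspace_def lin_zero[OF linZ] lin_add[OF linZ] lin_scale[OF linZ] algebra_simps)
    show "act x m \<in> N" if "x \<in> S" "m \<in> N" for x m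
      using that rep_closed[OF r] Zcomm[of x m] by (auto simp: N_def lin_scale[OF la(1)])
    show "m1 \<in> N" "m1 \<noteq> 0" "N \<subseteq> M" using m1 by (auto simp: N_def)
  qed
  then have Z\<mu>: "Z m = \<mu> *s m" if "m \<in> M" for m using that by (auto simp: N_def)
  \<comment> \<open>Each dual pair contributes 1, so the trace is the dimension of S modulo T,
    nonzero since T is proper. Hence the scalar by which Z acts is nonzero.\<close>
  have "tr M Z = (\<Sum>i\<in>I. \<tau> (v i) (g i))"
    unfolding Z_def \<tau>_def by (rule tr_sum[OF fdM])
  also have "\<dots> = of_nat (card I)" using \<tau>sym[OF vS g(1)] g(2) by simp
  finally have "\<mu> * tr M (\<lambda>m. m) = of_nat (card I)"
    using tr_scale[OF fdM, of \<mu> "\<lambda>m. m"] tr_cong[OF fdM, of Z "\<lambda>m. \<mu> *s m"] Z\<mu> by simp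
  moreover have "I \<noteq> {}"
  proof
    assume "I = {}"
    then have "C \<subseteq> {0}" using coords_expand[OF c] by auto
    then have "x \<in> T" if "x \<in> S" for x using C(4)[of x] C(7)[OF that] by auto
    then show False using TS' by blast
  qed
  ultimately have \<mu>0: "\<mu> \<noteq> 0" using fin by auto
  \<comment> \<open>Casimir invariance for \<open>\<phi> a (act b m)\<close> gives \<open>\<phi> x
    (Z m) = (\<Sum>i\<in>I. \<phi> (v i) (act (g i) (act x m)))\<close>; dividing by the scalar of Z
    produces this primitive.\<close>
  define \<psi> where "\<psi> m = inverse \<mu> * (\<Sum>i\<in>I. \<phi> (v i) (act (g i) m))" for m
  have "lfun \<psi>"
    by (auto simp: lfun_iff \<psi>_def lin_add[OF la(1)] lin_scale[OF la(1)] lfun_add[OF l(1)]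
        lfun_scale[OF l(1)] sum.distrib sum_distrib_left algebra_simps)
  moreover have "\<phi> x m = \<psi> (act x m)" if x: "x \<in> S" and m: "m \<in> M" for x m
  proof -
    have "(\<Sum>i\<in>I. \<phi> (br x (v i)) (act (g i) m)) + (\<Sum>i\<in>I. \<phi> (v i) (act (br x (g i)) m)) = 0"
      using casimir[OF x, of "\<lambda>a b. \<phi> a (act b m)"] T\<phi> Tact rep_closed[OF r _ m] m
      by (auto simp: lfun_iff lin_add[OF la(2)] lin_scale[OF la(2)] lfun_add[OF l(1)] lfun_add[OF l(2)]
          lfun_scale[OF l(1)] lfun_scale[OF l(2)] lfun_zero[OF l(1)])
    moreover have "\<phi> (br x (v i)) (act (g i) m) + \<phi> (v i) (act (br x (g i)) m)
        = \<phi> x (act (v i) (act (g i) m)) - \<phi> (v i) (act (g i) (act x m))" if "i \<in> I" for i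
      using cocycle_br[OF \<phi> x vS[OF that] rep_closed[OF r g(1)[OF that] m]] rep_br[OF r x g(1)[OF that] m]
      by (simp add: lfun_diff[OF l(1)])
    ultimately have "(\<Sum>i\<in>I. \<phi> x (act (v i) (act (g i) m)) - \<phi> (v i) (act (g i) (act x m))) = 0"
      by (simp flip: sum.distrib)
    then have "\<phi> x (Z m) = (\<Sum>i\<in>I. \<phi> (v i) (act (g i) (act x m)))"
      by (simp add: Z_def lfun_sum[OF l(1)] sum_subtractf)
    then have "\<mu> * \<phi> x m = (\<Sum>i\<in>I. \<phi> (v i) (act (g i) (act x m)))" using Z\<mu>[OF m] by (simp add: lfun_scale[OF l(1)])
    then show ?thesis using \<mu>0 by (simp add: \<psi>_def flip: \<open>\<mu> * \<phi> x m = _\<close>)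
  qed
  ultimately show ?thesis by blast
qed

text \<open>Induction on the dimension of M. On a minimal invariant subspace N the cocycle has a
  primitive; after subtracting it the cocycle vanishes on N and descends to the quotient of M by
  N.\<close>

lemma cocycle_exact:
  assumes S: "minimal_perfect S" and "rep S M act" "cocycle S M act \<phi>"
  shows "\<exists>\<psi>. lfun \<psi> \<and> (\<forall>x\<in>S. \<forall>m\<in>M. \<phi> x m = \<psi> (act x m))"
  using assms(2,3)
proof (induction "dim M" arbitrary: M act \<phi> rule: less_induct)
  case less
  note r = less.prems(1) and \<phi> = less.prems(2)
  note l = cocycle_lfun_right[OF \<phi>] cocycle_lfun_left[OF \<phi>]
  note la = rep_lin_right[OF r] rep_lin_left[OF r]
  note sM = fd_subspace[OF rep_fd[OF r]]
  show ?case
  proof (cases "M = {0}")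
    case True
    then show ?thesis
      by (intro exI[of _ "\<lambda>_. 0"]) (simp add: lfun_zero[OF l(1)] lfun_iff)
  next
    case False
    define Q where "Q N \<longleftrightarrow> subspace N \<and> N \<subseteq> M \<and> N \<noteq> {0} \<and> (\<forall>x\<in>S. \<forall>m\<in>N. act x m \<in> N)" for N
    have "Q M" using False sM rep_closed[OF r] by (simp add: Q_def)
    then obtain N where N: "Q N" and min: "\<And>N'. Q N' \<Longrightarrow> dim N \<le> dim N'"
      using arg_min_natI[of Q M dim] arg_min_nat_le[of Q _ dim] by metis
    have N': "subspace N" "N \<subseteq> M" "N \<noteq> {0}" "\<And>x m. x \<in> S \<Longrightarrow> m \<in> N \<Longrightarrow> act x m \<in> N"
      using N by (auto simp: Q_def)
    have rN: "rep S N act" by (rule rep_subspace[OF r N'(1,2,4)])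
    have "irreducible_rep S N act"
      unfolding irreducible_rep_def
    proof (intro conjI allI impI rN N'(3))
      fix K assume K: "subspace K" "K \<subseteq> N" "\<forall>x\<in>S. \<forall>m\<in>K. act x m \<in> K"
      show "K = {0} \<or> K = N"
      proof (rule ccontr)
        assume "\<not> ?thesis"
        then have "Q K" "K \<subset> N" using K N'(2) by (auto simp: Q_def)
        then show False using min[of K] dim_less[OF rep_fd[OF rN] K(1)] by simp
      qed
    qed
    moreover have "cocycle S N act \<phi>" using \<phi> N'(2) by (auto simp: cocycle_def)
    ultimately obtain \<psi>1 where \<psi>1: "lfun \<psi>1" "\<And>x m. x \<in> S \<Longrightarrow> m \<in> N \<Longrightarrow> \<phi> x m = \<psi>1 (act x m)"
      using cocycle_exact_irreducible[OF S] by blast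
    define \<phi>' where "\<phi>' x m = \<phi> x m - \<psi>1 (act x m)" for x m
    have l': "lfun (\<phi>' x)" "lfun (\<lambda>x. \<phi>' x m)" for x m
      by (auto simp: \<phi>'_def lfun_iff lfun_add[OF l(1)] lfun_add[OF l(2)] lfun_scale[OF l(1)] lfun_scale[OF l(2)]
          lin_add[OF la(1)] lin_add[OF la(2)] lin_scale[OF la(1)] lin_scale[OF la(2)]
          lfun_add[OF \<psi>1(1)] lfun_scale[OF \<psi>1(1)] algebra_simps)
    have \<phi>'N: "\<phi>' x m = 0" if "x \<in> S" "m \<in> N" for x m using \<psi>1(2)[OF that] by (simp add: \<phi>'_def)
    obtain C \<pi> where C: "subspace C" "C \<subseteq> M" "lin \<pi>" "\<And>x. \<pi> x \<in> C" "\<And>x. x \<in> C \<Longrightarrow> \<pi> x = x"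
      "\<And>x. x \<in> N \<Longrightarrow> \<pi> x = 0" "\<And>x. x \<in> M \<Longrightarrow> x - \<pi> x \<in> N"
      using complement_exists[OF rep_fd[OF r] N'(1,2)] by blast
    have \<phi>'\<pi>: "\<phi>' x (\<pi> m) = \<phi>' x m" if "x \<in> S" "m \<in> M" for x m
      using \<phi>'N[OF that(1) C(7)[OF that(2)]] by (simp add: lfun_diff[OF l'(1)])
    have rC: "rep S C (\<lambda>x m. \<pi> (act x m))"
      by (rule rep_quotient[OF r N'(1,2,4) C(1,2,3,4,6,7)])
    have cC: "cocycle S C (\<lambda>x m. \<pi> (act x m)) \<phi>'"
      unfolding cocycle_def
    proof (intro conjI allI ballI l')
      fix x y m assume x: "x \<in> S" "y \<in> S" "m \<in> C"
      then have m: "m \<in> M" using C(2) by blast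
      show "\<phi>' (br x y) m = \<phi>' x (\<pi> (act y m)) - \<phi>' y (\<pi> (act x m))"
        using cocycle_br[OF \<phi> x(1,2) m] rep_br[OF r x(1,2) m] \<phi>'\<pi>[OF x(1) rep_closed[OF r x(2) m]]
          \<phi>'\<pi>[OF x(2) rep_closed[OF r x(1) m]]
        by (simp add: \<phi>'_def lfun_diff[OF \<psi>1(1)])
    qed
    have dC: "dim C < dim M"
    proof (rule dim_less[OF rep_fd[OF r] C(1)])
      have "C \<noteq> M"
      proof
        assume "C = M"
        then have "x = 0" if "x \<in> N" for x using C(5)[of x] C(6)[OF that] N'(2) that by auto
        then show False using N'(1,3) subspace_0 by blast
      qed
      then show "C \<subset> M" using C(2) by blast
    qed
    obtain \<psi>2 where \<psi>2: "lfun \<psi>2" "\<And>x m. x \<in> S \<Longrightarrow> m \<in> C \<Longrightarrow> \<phi>' x m = \<psi>2 (\<pi> (act x m))"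
      using less.hyps[OF dC rC cC] by blast
    have "\<phi> x m = \<psi>1 (act x m) + \<psi>2 (\<pi> (act x m))" if x: "x \<in> S" and m: "m \<in> M" for x m
    proof -
      have "\<pi> (act x (m - \<pi> m)) = 0" by (rule C(6)[OF N'(4)[OF x C(7)[OF m]]])
      then have "\<pi> (act x (\<pi> m)) = \<pi> (act x m)" by (simp add: lin_diff[OF la(1)] lin_diff[OF C(3)])
      then have "\<phi>' x m = \<psi>2 (\<pi> (act x m))" using \<psi>2(2)[OF x C(4)[of m]] \<phi>'\<pi>[OF x m] by simp
      then show ?thesis by (simp add: \<phi>'_def diff_eq_eq add.commute)
    qed
    moreover have "lfun (\<lambda>m. \<psi>1 m + \<psi>2 (\<pi> m))"
      using lfun_compose[OF \<psi>2(1) C(3)] \<psi>1(1) unfolding lfun_iff by (simp add: algebra_simps)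
    ultimately show ?thesis by (intro exI[of _ "\<lambda>m. \<psi>1 m + \<psi>2 (\<pi> m)"]) simp
  qed
qed

end

section \<open>Unimodular symplectic Lie algebras are solvable\<close>

locale complex_symplectic = complex_lie scale br
  for scale :: "complex \<Rightarrow> 'b::ab_group_add \<Rightarrow> 'b" (infixr "*s" 75) and br :: "'b \<Rightarrow> 'b \<Rightarrow> 'b" +
  fixes \<omega> :: "'b \<Rightarrow> 'b \<Rightarrow> complex" and G :: "'b set"
  assumes lfun_form: "lfun (\<omega> x)" and form_skew: "\<omega> y x = - \<omega> x y"
    and form_closed: "\<omega> (br x y) z + \<omega> (br y z) x + \<omega> (br z x) y = 0"
    and subalg_G: "subalg G"
    and form_nondegenerate: "x \<in> G \<Longrightarrow> (\<And>y. y \<in> G \<Longrightarrow> \<omega> x y = 0) \<Longrightarrow> x = 0"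
    and unimodular_G: "x \<in> G \<Longrightarrow> tr G (br x) = 0"
begin

lemma lfun_form_left: "lfun (\<lambda>x. \<omega> x y)"
  using lfun_form[of y] unfolding lfun_iff form_skew[of _ y] by simp

text \<open>Closedness rearranged: \<omega> is a 1-cocycle for the adjoint representation with
  values in the dual, in exactly the shape of \<open>cocycle\<close>.\<close>

lemma form_br: "\<omega> (br x y) z = \<omega> x (br y z) - \<omega> y (br x z)"
proof -
  have "\<omega> (br z x) y = \<omega> y (br x z)"
    using form_skew[of "br z x" y] br_skew[of z x] by (simp add: lfun_minus[OF lfun_form])
  moreover have "\<omega> (br x y) z = - (\<omega> (br y z) x + \<omega> (br z x) y)"
    using form_closed[of x y z] by (simp only: eq_neg_iff_add_eq_0 add.assoc)
  ultimately show ?thesis using form_skew[of "br y z" x] by simp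
qed

lemma form_eqI: "x \<in> G \<Longrightarrow> y \<in> G \<Longrightarrow> (\<And>z. z \<in> G \<Longrightarrow> \<omega> x z = \<omega> y z) \<Longrightarrow> x = y"
  using form_nondegenerate[of "x - y"] subspace_diff[OF subalg_subspace[OF subalg_G]]
  by (simp add: lfun_diff[OF lfun_form_left])

text \<open>The flat connection of a symplectic Lie algebra is a left-symmetric product
  \<open>x \<cdot> y\<close> with \<open>\<omega> (x \<cdot> y) z = - \<omega> y [x, z]\<close>. Unimodularity makes its right
  multiplications \<open>R y\<close> trace-free, and the left-symmetric identity
  \<open>[L x, R y] = R (x \<cdot> y) - R y \<circ> R x\<close> then forces \<open>tr (R x \<circ> R y ^ k) = 0\<close> for all \<open>k\<close>.\<close>

theorem no_perfect_subalgebra: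
  assumes "perfect P" "P \<subseteq> G"
  shows "P = {0}"
proof (rule ccontr)
  assume "P \<noteq> {0}"
  then obtain S where S: "S \<subseteq> P" "minimal_perfect S" using minimal_perfect_exists[OF assms(1)] by blast
  have SG: "S \<subseteq> G" using S(1) assms(2) by blast
  note fdG = subalg_fd[OF subalg_G] and sG = subalg_subspace[OF subalg_G] and brG = subalg_br[OF subalg_G]
  note lw = lfun_form lfun_form_left
  note lb = lin_br_right lin_br_left
  obtain I :: "'b set" and v c where c: "coords G I v c" using coords_exists[OF fdG] .
  note fin = coords_finite[OF c] and vG = coords_mem[OF c]
  have "\<exists>g. (\<forall>i\<in>I. g i \<in> G) \<and> (\<forall>i\<in>I. \<forall>j\<in>I. \<omega> (g i) (v j) = (if i = j then 1 else 0))"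
  proof (rule dual_coords[OF c sG lw _ sG])
    fix x assume "x \<in> G" "\<And>k. k \<in> G \<Longrightarrow> \<omega> k x = 0"
    then show "x = 0" using form_nondegenerate[of x] form_skew[of x] by simp
  qed
  then obtain g where g: "\<And>i. i \<in> I \<Longrightarrow> g i \<in> G"
    "\<And>i j. i \<in> I \<Longrightarrow> j \<in> I \<Longrightarrow> \<omega> (g i) (v j) = (if i = j then 1 else 0)" by blast
  have represent: "\<omega> (\<Sum>i\<in>I. f (v i) *s g i) z = f z" if f: "lfun f" and z: "z \<in> G" for f z
  proof -
    have "\<omega> (\<Sum>i\<in>I. f (v i) *s g i) (v j) = f (v j)" if j: "j \<in> I" for j
    proof -
      have "\<omega> (\<Sum>i\<in>I. f (v i) *s g i) (v j) = (\<Sum>i\<in>I. if i = j then f (v i) else 0)"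
        unfolding lfun_sum[OF lw(2)] lfun_scale[OF lw(2)] using g(2) j by (intro sum.cong) auto
      then show ?thesis using j fin by simp
    qed
    then have "\<omega> (\<Sum>i\<in>I. f (v i) *s g i) (\<Sum>j\<in>I. c j z *s v j) = f (\<Sum>j\<in>I. c j z *s v j)"
      unfolding lfun_sum[OF lw(1)] lfun_scale[OF lw(1)] lfun_sum[OF f] lfun_scale[OF f] by simp
    then show ?thesis using coords_expand[OF c z] by simp
  qed
  \<comment> \<open>\<open>R y x\<close> is the product x . y, so the second argument is the left
    factor. The sum is the vector that represents \<open>\<lambda>z. - \<omega> y (br x z)\<close>
    through \<omega>.\<close>
  define R where "R y x = (\<Sum>i\<in>I. - \<omega> y (br x (v i)) *s g i)" for y x
  have RG: "R y x \<in> G" for x y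
    unfolding R_def using g(1) by (intro subspace_sum[OF sG] subspace_scale[OF sG])
  have lR: "lin (R y)" "lin (\<lambda>y. R y x)" for x y
    by (auto simp: lin_iff R_def lin_add[OF lb(2)] lin_scale[OF lb(2)] lfun_add[OF lw(1)] lfun_add[OF lw(2)]
        lfun_scale[OF lw(1)] lfun_scale[OF lw(2)] scale_sum_right sum.distrib algebra_simps sum_negf sum_subtractf)
  have R\<omega>: "\<omega> (R y x) z = - \<omega> y (br x z)" if "z \<in> G" for x y z
  proof -
    have "lfun (\<lambda>z. - \<omega> y (br x z))"
      using lfun_compose[OF lw(1) lb(1)] by (simp add: lfun_iff)
    from represent[OF this that] show ?thesis by (simp add: R_def)
  qed
  have torsion: "R y x - R x y = br x y" if xy: "x \<in> G" "y \<in> G" for x y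
  proof (rule form_eqI)
    show "\<omega> (R y x - R x y) z = \<omega> (br x y) z" if z: "z \<in> G" for z
      by (simp add: lfun_diff[OF lw(2)] R\<omega>[OF z] form_br[of x y z])
  qed (auto simp: RG brG xy subspace_diff[OF sG])
  \<comment> \<open>Left multiplications form a representation: [x, y] . u = x . (y . u) - y . (x .
    u).\<close>
  have flat: "R u (br x y) = R (R u y) x - R (R u x) y" if xy: "x \<in> G" "y \<in> G" for x y u
  proof (rule form_eqI)
    show "\<omega> (R u (br x y)) z = \<omega> (R (R u y) x - R (R u x) y) z" if z: "z \<in> G" for z
      using brG[OF xy(1) z] brG[OF xy(2) z]
      by (simp add: lfun_diff[OF lw(2)] R\<omega> z br_br lfun_diff[OF lw(1)])
  qed (auto simp: RG subspace_diff[OF sG])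
  have RGi: "R y ` G \<subseteq> G" for y using RG by blast
  have LGi: "(\<lambda>y. R y x) ` G \<subseteq> G" for x using RG by blast
  \<comment> \<open>Left multiplication by y is minus the \<omega>-adjoint of \<open>br y\<close>,
    hence traceless by unimodularity; \<open>R y\<close> differs from it by
    \<open>br y\<close>.\<close>
  have trR: "tr G (R y) = 0" if y: "y \<in> G" for y
  proof -
    have cg: "coords G I g (\<lambda>i x. \<omega> x (v i))"
      unfolding coords_def
    proof (intro conjI ballI)
      fix x assume x: "x \<in> G"
      show "(\<Sum>i\<in>I. \<omega> x (v i) *s g i) = x"
        using represent[OF lw(1)] g(1) x
        by (intro form_eqI) (auto intro!: subspace_sum[OF sG] subspace_scale[OF sG])
    qed (use fin g lw in auto)
    have "tr G (\<lambda>u. R u y) = (\<Sum>i\<in>I. \<omega> (R (g i) y) (v i))"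
      by (rule tr_coords[OF fdG lR(2) LGi cg])
    also have "\<dots> = - (\<Sum>i\<in>I. \<omega> (g i) (br y (v i)))" using vG by (simp add: R\<omega> sum_negf)
    also have "(\<Sum>i\<in>I. \<omega> (g i) (br y (v i))) = (\<Sum>i\<in>I. c i (br y (v i)))"
    proof (intro sum.cong refl)
      fix i assume i: "i \<in> I"
      have "\<omega> (g i) (br y (v i)) = \<omega> (g i) (\<Sum>j\<in>I. c j (br y (v i)) *s v j)"
        using coords_expand[OF c brG[OF y vG[OF i]]] by simp
      also have "\<dots> = (\<Sum>j\<in>I. if i = j then c j (br y (v i)) else 0)"
        unfolding lfun_sum[OF lw(1)] lfun_scale[OF lw(1)] using g(2) i by (intro sum.cong) auto
      finally show "\<omega> (g i) (br y (v i)) = c i (br y (v i))" using i fin by simp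
    qed
    also have "\<dots> = tr G (br y)"
      by (rule tr_coords[OF fdG lb(1) _ c, symmetric]) (use brG[OF y] in blast)
    finally have L: "tr G (\<lambda>u. R u y) = 0" using unimodular_G[OF y] by simp
    have "tr G (R y) = tr G (\<lambda>u. R u y - br y u)"
      using torsion[OF _ y] br_skew[of y] by (intro tr_cong[OF fdG]) (simp add: algebra_simps)
    then show ?thesis using L unimodular_G[OF y] by (simp add: tr_diff[OF fdG])
  qed
  have trRR: "tr G (\<lambda>u. R x ((R y ^^ k) u)) = 0" if "x \<in> G" "y \<in> G" for x y k
    using that(1)
  proof (induction k arbitrary: x)
    case 0
    then show ?case using trR by simp
  next
    case (Suc k)
    note x = Suc.prems and y = \<open>y \<in> G\<close>
    have Rk: "lin (R y ^^ k)" "(R y ^^ k) ` G \<subseteq> G" for k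
      using lin_funpow[OF lR(1)] RG by (auto, cases k) auto
    \<comment> \<open>The right side is the commutator of left multiplication by x with
      \<open>R y\<close>. Its composite with \<open>R y ^^ k\<close> is traceless by cyclicity,
      which reduces exponent k + 1 for x to exponent k for \<open>R y x\<close>; hence the induction
      over all x.\<close>
    have id: "R (R y x) u - R y (R x u) = R (R y u) x - R y (R u x)" if u: "u \<in> G" for u
    proof -
      have "R (R y u) x - R (R y x) u = R y (br x u)" using flat[OF x u, of y] by simp
      also have "\<dots> = R y (R u x) - R y (R x u)" using torsion[OF x u] lin_diff[OF lR(1)] by metis
      finally show ?thesis by (simp add: algebra_simps)
    qed
    have "tr G (\<lambda>u. R (R y x) ((R y ^^ k) u) - R y (R x ((R y ^^ k) u)))
        = tr G (\<lambda>u. (\<lambda>w. R w x) ((R y ^^ Suc k) u) - R y (R ((R y ^^ k) u) x))"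
      using id Rk(2)[of k] by (intro tr_cong[OF fdG]) (auto simp: image_subset_iff)
    also have "\<dots> = tr G (\<lambda>u. (\<lambda>w. R w x) ((R y ^^ Suc k) u)) - tr G (\<lambda>u. R y (R ((R y ^^ k) u) x))"
      by (rule tr_diff[OF fdG])
    also have "tr G (\<lambda>u. R y (R ((R y ^^ k) u) x)) = tr G (\<lambda>u. R ((R y ^^ k) (R y u)) x)"
      using Rk[of k] RG by (intro tr_commute[OF fdG lR(1) lin_compose[OF lR(2) Rk(1)]]) auto
    also have "tr G (\<lambda>u. (\<lambda>w. R w x) ((R y ^^ Suc k) u)) = tr G (\<lambda>u. R ((R y ^^ k) (R y u)) x)"
      by (simp add: funpow_swap1)
    finally have "tr G (\<lambda>u. R y (R x ((R y ^^ k) u))) = 0"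
      using Suc.IH[OF RG] by (simp add: tr_diff[OF fdG])
    moreover have "tr G (\<lambda>u. R y (R x ((R y ^^ k) u))) = tr G (\<lambda>u. R x ((R y ^^ k) (R y u)))"
      using Rk[of k] RG by (intro tr_commute[OF fdG lR(1) lin_compose[OF lR(1) Rk(1)]]) auto
    ultimately show ?case by (simp add: funpow_swap1)
  qed
  have rG: "rep S G br" by (rule rep_adjoint[OF subalg_G minimal_perfect_subalg[OF S(2)] SG])
  have "cocycle S G br \<omega>"
    unfolding cocycle_def
  proof (intro conjI allI ballI lw)
    show "\<omega> (br x y) m = \<omega> x (br y m) - \<omega> y (br x m)" for x y m by (rule form_br)
  qed
  then obtain \<psi> where \<psi>: "lfun \<psi>" "\<And>x m. x \<in> S \<Longrightarrow> m \<in> G \<Longrightarrow> \<omega> x m = \<psi> (br x m)"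
    using cocycle_exact[OF S(2) rG] by blast
  \<comment> \<open>This y represents \<psi>, so \<open>\<omega> x z = \<omega> y (br x z)\<close>
    for x in S, and the definition of R gives \<open>R y x = - x\<close>.\<close>
  define y where "y = (\<Sum>i\<in>I. \<psi> (v i) *s g i)"
  have yG: "y \<in> G" unfolding y_def using g(1) by (intro subspace_sum[OF sG] subspace_scale[OF sG])
  have Ry: "R y x = - x" if x: "x \<in> S" for x
  proof (rule form_eqI)
    show "\<omega> (R y x) z = \<omega> (- x) z" if z: "z \<in> G" for z
      using represent[OF \<psi>(1), of "br x z"] brG[of x z] z x SG \<psi>(2)[OF x z]
      by (auto simp: R\<omega> y_def lfun_minus[OF lw(2)])
  qed (use RG x SG subspace_neg[OF sG] in auto)
  have "tr G (R y ^^ Suc k) = 0" for k using trRR[OF yG yG, of k] by (simp add: comp_def)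
  then obtain k where k: "\<And>x. x \<in> G \<Longrightarrow> (R y ^^ k) x = 0"
    using nilpotent_if_traces_zero[OF fdG lR(1) RGi] by (metis of_nat_eq_0_iff nat.distinct(1))
  have pow: "(R y ^^ k) x = x \<or> (R y ^^ k) x = - x" if x: "x \<in> S" for x k
    by (induction k) (auto simp: Ry[OF x] lin_minus[OF lR(1)])
  have "x = 0" if "x \<in> S" for x using pow[OF that, of k] k SG that by auto
  then have "S = {0}"
    using subspace_0[OF subalg_subspace[OF minimal_perfect_subalg[OF S(2)]]] by blast
  then show False using minimal_perfect_nonzero[OF S(2)] by simp
qed

end

section \<open>Complexification\<close>

text \<open>The pair \<open>(a, b)\<close> stands for a + i b, and \<open>W \<times> W\<close> for
  the complexification of W.\<close>

definition cscale :: "complex \<Rightarrow> 'a::real_vector \<times> 'a \<Rightarrow> 'a \<times> 'a" where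
  "cscale c z = (Re c *\<^sub>R fst z - Im c *\<^sub>R snd z, Re c *\<^sub>R snd z + Im c *\<^sub>R fst z)"

interpretation cx: cvspace "cscale :: complex \<Rightarrow> 'a::real_vector \<times> 'a \<Rightarrow> 'a \<times> 'a"
  by unfold_locales (auto simp: cscale_def algebra_simps)

interpretation rv: vspace "scaleR :: real \<Rightarrow> 'a::real_vector \<Rightarrow> 'a"
  rewrites "module.span (scaleR :: real \<Rightarrow> 'a \<Rightarrow> 'a) = span"
    and "module.subspace (scaleR :: real \<Rightarrow> 'a \<Rightarrow> 'a) = subspace"
    and "Vector_Spaces.linear (scaleR :: real \<Rightarrow> 'a \<Rightarrow> 'a) (scaleR :: real \<Rightarrow> 'a \<Rightarrow> 'a) = linear"
    and "Vector_Spaces.linear (scaleR :: real \<Rightarrow> 'a \<Rightarrow> 'a) (*) = linear"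
proof -
  show "vspace (scaleR :: real \<Rightarrow> 'a \<Rightarrow> 'a)" by unfold_locales
  show "Vector_Spaces.linear (scaleR :: real \<Rightarrow> 'a \<Rightarrow> 'a) (*) = linear"
  proof -
    have "((*) :: real \<Rightarrow> real \<Rightarrow> real) = scaleR" by (intro ext) simp
    then show ?thesis by (simp only: linear_def[abs_def])
  qed
qed (auto simp: span_raw_def subspace_raw_def linear_def[abs_def])

text \<open>Relates the trace by a chosen basis to indexed dual coordinates that are linear on V
  alone. The free index type admits bases assembled from several families.\<close>

lemma trace_on_coords:
  assumes f: "linear_on V V f" and V: "subspace V" and I: "finite I" "\<And>i. i \<in> I \<Longrightarrow> v i \<in> V"
    and c: "\<And>i. i \<in> I \<Longrightarrow> linear_on V UNIV (c i)"
      "\<And>i j. i \<in> I \<Longrightarrow> j \<in> I \<Longrightarrow> c i (v j) = (if i = j then 1 else 0)"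
      "\<And>x. x \<in> V \<Longrightarrow> (\<Sum>i\<in>I. c i x *\<^sub>R v i) = x"
  shows "trace_on V f = (\<Sum>i\<in>I. c i (f (v i)))"
proof -
  have inj: "inj_on v I" by (rule inj_onI) (metis c(2) zero_neq_one)
  have cs: "c i (\<Sum>b\<in>v ` I. u b *\<^sub>R b) = u (v i)" if i: "i \<in> I" for i u
  proof -
    have "c i (\<Sum>b\<in>v ` I. u b *\<^sub>R b) = (\<Sum>b\<in>v ` I. u b *\<^sub>R c i b)"
      using linear_on_sum[OF c(1)[OF i] V, of "v ` I" u] I by auto
    also have "\<dots> = (\<Sum>j\<in>I. if j = i then u (v j) else 0)"
      unfolding sum.reindex[OF inj] o_def using c(2) i by (intro sum.cong) auto
    finally show ?thesis using i I(1) by simp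
  qed
  have ind: "independent (v ` I)"
  proof
    assume "dependent (v ` I)"
    then obtain u where u: "\<exists>b\<in>v ` I. u b \<noteq> 0" "(\<Sum>b\<in>v ` I. u b *\<^sub>R b) = 0"
      using real_vector.dependent_finite[of "v ` I"] I(1) by auto
    then obtain i where i: "i \<in> I" "u (v i) \<noteq> 0" by blast
    then show False
      using cs[OF i(1), of u] u(2) linear_on_zero[OF c(1)[OF i(1)] subspace_0[OF V]] by simp
  qed
  have span: "span (v ` I) = V"
  proof
    show "span (v ` I) \<subseteq> V" using I(2) V by (intro span_minimal) auto
    show "V \<subseteq> span (v ` I)"
    proof
      fix x assume "x \<in> V"
      have "(\<Sum>i\<in>I. c i x *\<^sub>R v i) \<in> span (v ` I)"
        by (intro span_sum span_scale span_base imageI)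
      then show "x \<in> span (v ` I)" using c(3)[OF \<open>x \<in> V\<close>] by simp
    qed
  qed
  have rep: "representation (v ` I) x (v i) = c i x" if "x \<in> V" "i \<in> I" for x i
  proof -
    have "(\<Sum>b\<in>v ` I. representation (v ` I) x b *\<^sub>R b) = x"
      using real_vector.sum_representation_eq[OF ind _ _ subset_refl] span that I(1) by simp
    then show ?thesis using cs[OF that(2), of "representation (v ` I) x"] by simp
  qed
  have "trace_on V f = (\<Sum>b\<in>v ` I. representation (v ` I) (f b) b)"
    using trace_on_basis[OF f ind span] I(1) by simp
  also have "\<dots> = (\<Sum>i\<in>I. c i (f (v i)))"
    unfolding sum.reindex[OF inj] o_def using f I(2) rep by (intro sum.cong) (auto simp: linear_on_def)
  finally show ?thesis .
qed

lemma linear_on_linear: "linear f \<Longrightarrow> (\<And>x. x \<in> V \<Longrightarrow> f x \<in> W) \<Longrightarrow> linear_on V W f"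
  by (auto simp: linear_on_def linear_add linear_scale)

locale total_symplectic = symplectic_lie_algebra V br \<omega>
  for V :: "'a::real_vector set" and br :: "'a \<Rightarrow> 'a \<Rightarrow> 'a" and \<omega> :: "'a \<Rightarrow> 'a \<Rightarrow> real" +
  assumes linear_br_right: "linear (br x)" and linear_br_left: "linear (\<lambda>x. br x y)"
    and br_closed: "br x y \<in> V" and br_self_total: "br x x = 0"
    and br_br_total: "br (br x y) z = br x (br y z) - br y (br x z)"
    and linear_form: "linear (\<omega> x)" and skew_total: "\<omega> y x = - \<omega> x y"
    and closed_total: "\<omega> (br x y) z + \<omega> (br y z) x + \<omega> (br z x) y = 0"

lemma (in lie_algebra) fd_carrier: "rv.fd V"
  using subspace_carrier finite_dimensional by (auto simp: rv.fd_def)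

text \<open>Composing with a linear projection onto the carrier makes all identities hold on the ambient space.\<close>

lemma total_symplectic_exists:
  assumes "symplectic_lie_algebra V br \<omega>"
  shows "\<exists>br' \<omega>'. total_symplectic V br' \<omega>' \<and> (\<forall>x\<in>V. \<forall>y\<in>V. br' x y = br x y \<and> \<omega>' x y = \<omega> x y)"
proof -
  interpret symplectic_lie_algebra V br \<omega> by fact
  obtain I :: "'a set" and v c where c: "rv.coords V I v c" using rv.coords_exists[OF fd_carrier] .
  define P where "P x = (\<Sum>i\<in>I. c i x *\<^sub>R v i)" for x
  have P: "P x \<in> V" "x \<in> V \<Longrightarrow> P x = x" for x
    unfolding P_def using rv.coords_mem[OF c] rv.coords_expand[OF c] subspace_carrier
    by (auto intro!: subspace_sum subspace_scale)
  have lP: "linear P" unfolding P_def by (intro rv.lin_combination rv.coords_lfun[OF c])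
  define b where "b x y = br (P x) (P y)" for x y
  define w where "w x y = \<omega> (P x) (P y)" for x y
  have bV: "b x y \<in> V" for x y
    using bilinear_bracket P(1) unfolding b_def bilinear_on_def linear_on_def by blast
  have bl: "linear (b x)" "linear (\<lambda>x. b x y)" for x y
    using bilinear_bracket P(1) unfolding b_def bilinear_on_def linear_on_def
    by (auto intro!: linearI simp: linear_add[OF lP] linear_scale[OF lP])
  have wl: "linear (w x)" for x
    using bilinear_form P(1) unfolding w_def bilinear_on_def linear_on_def
    by (auto intro!: linearI simp: linear_add[OF lP] linear_scale[OF lP])
  have self: "b x x = 0" for x using bracket_self P(1) by (simp add: b_def)
  have skew: "b y x = - b x y" for x y
  proof -
    have "b (x + y) (x + y) = b x x + b x y + (b y x + b y y)"
      by (simp add: linear_add[OF bl(1)] linear_add[OF bl(2)])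
    then show ?thesis by (simp add: self eq_neg_iff_add_eq_0 add.commute)
  qed
  have cyc: "b x (b y z) + b y (b z x) + b z (b x y) = 0" for x y z
    using jacobi[OF P(1)[of x] P(1)[of y] P(1)[of z]] bV by (simp add: b_def P(2))
  have jac: "b (b x y) z = b x (b y z) - b y (b x z)" for x y z
  proof -
    have "b y (b z x) = - b y (b x z)" using skew[of z x] linear_neg[OF bl(1)] by simp
    moreover have "b z (b x y) = - b (b x y) z" by (rule skew)
    ultimately show ?thesis using cyc[of x y z] by simp
  qed
  have wskew: "w y x = - w x y" for x y unfolding w_def by (rule form_skew[OF P(1) P(1)])
  have closed: "w (b x y) z + w (b y z) x + w (b z x) y = 0" for x y z
    using form_closed[OF P(1)[of x] P(1)[of y] P(1)[of z]] bV by (simp add: w_def b_def P(2))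
  have eq: "b x y = br x y" "w x y = \<omega> x y" if "x \<in> V" "y \<in> V" for x y
    using that P(2) by (auto simp: b_def w_def)
  have wr: "linear (\<lambda>x. w x y)" for y
    using wl[of y] unfolding linear_iff wskew[of _ y] by (metis minus_add_distrib scaleR_minus_right)
  have "symplectic_lie_algebra V b w"
  proof unfold_locales
    show "bilinear_on V V b" "bilinear_on V UNIV w"
      unfolding bilinear_on_def using bl wl wr bV by (auto intro: linear_on_linear)
    show "b x (b y z) + b y (b z x) + b z (b x y) = 0" for x y z by (rule cyc)
    show "x = 0" if "x \<in> V" "\<And>y. y \<in> V \<Longrightarrow> w x y = 0" for x
      using form_nondegenerate[OF that(1)] that eq(2) by simp
    show "w y x = - w x y" for x y by (rule wskew)
    show "w (b x y) z + w (b y z) x + w (b z x) y = 0" for x y z by (rule closed)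
  qed (use subspace_carrier finite_dimensional self in auto)
  then have "total_symplectic V b w"
    using bl bV self jac wl wskew closed by (intro total_symplectic.intro total_symplectic_axioms.intro)
  with eq show ?thesis by blast
qed

context total_symplectic
begin

lemma br_skew: "br y x = - br x y"
proof -
  have "br (x + y) (x + y) = br x x + br x y + (br y x + br y y)"
    by (simp add: linear_add[OF linear_br_right] linear_add[OF linear_br_left])
  then show ?thesis by (simp add: br_self_total eq_neg_iff_add_eq_0 add.commute)
qed

lemma linear_form_left: "linear (\<lambda>x. \<omega> x y)"
  using linear_form[of y] unfolding linear_iff skew_total[of _ y] by (metis minus_add_distrib scaleR_minus_right)

lemmas br_linear = linear_add[OF linear_br_right] linear_add[OF linear_br_left]
  linear_scale[OF linear_br_right] linear_scale[OF linear_br_left]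
  linear_diff[OF linear_br_right] linear_diff[OF linear_br_left]
  linear_neg[OF linear_br_right] linear_neg[OF linear_br_left]
  linear_0[OF linear_br_right] linear_0[OF linear_br_left]

lemmas form_linear = linear_add[OF linear_form] linear_add[OF linear_form_left]
  linear_scale[OF linear_form] linear_scale[OF linear_form_left]
  linear_diff[OF linear_form] linear_diff[OF linear_form_left]
  linear_neg[OF linear_form] linear_neg[OF linear_form_left]
  linear_0[OF linear_form] linear_0[OF linear_form_left]

lemma form_br: "\<omega> (br x y) z = \<omega> x (br y z) - \<omega> y (br x z)"
  using closed_total[of x y z] skew_total[of x "br y z"] skew_total[of y "br x z"] br_skew[of z x]
  by (simp add: form_linear)

definition br_complex :: "'a \<times> 'a \<Rightarrow> 'a \<times> 'a \<Rightarrow> 'a \<times> 'a" where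
  "br_complex z w = (br (fst z) (fst w) - br (snd z) (snd w), br (fst z) (snd w) + br (snd z) (fst w))"

definition form_complex :: "'a \<times> 'a \<Rightarrow> 'a \<times> 'a \<Rightarrow> complex" where
  "form_complex z w = Complex (\<omega> (fst z) (fst w) - \<omega> (snd z) (snd w)) (\<omega> (fst z) (snd w) + \<omega> (snd z) (fst w))"

lemma complex_lie_br_complex: "complex_lie cscale br_complex"
proof (intro complex_lie.intro complex_lie_axioms.intro)
  show "cvspace (cscale :: complex \<Rightarrow> 'a \<times> 'a \<Rightarrow> 'a \<times> 'a)" by unfold_locales
  show "cx.lin (br_complex x)" "cx.lin (\<lambda>x. br_complex x y)" for x y
    by (auto simp: cx.lin_iff br_complex_def cscale_def br_linear algebra_simps)
  show "br_complex x x = 0" for x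
    using br_skew[of "snd x" "fst x"] by (simp add: br_complex_def br_self_total zero_prod_def)
  show "br_complex (br_complex x y) z = br_complex x (br_complex y z) - br_complex y (br_complex x z)" for x y z
    by (simp add: br_complex_def br_linear br_br_total algebra_simps)
qed

interpretation cl: complex_lie cscale br_complex by (rule complex_lie_br_complex)

text \<open>A real basis of V is a complex basis of \<open>V \<times> V\<close>, so the complex
  trace of the adjoint map of a + i b has the real traces for a and b as real and imaginary
  parts.\<close>

lemma coords_complex:
  assumes c: "rv.coords V I v c"
  shows "cx.coords (V \<times> V) I (\<lambda>i. (v i, 0)) (\<lambda>i z. Complex (c i (fst z)) (c i (snd z)))"
  unfolding cx.coords_def
proof (intro conjI ballI)
  show "finite I" using rv.coords_finite[OF c] .
  show "(v i, 0) \<in> V \<times> V" if "i \<in> I" for i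
    using rv.coords_mem[OF c that] subspace_0[OF subspace_carrier] by simp
  show "cx.lfun (\<lambda>z. Complex (c i (fst z)) (c i (snd z)))" if "i \<in> I" for i
    using rv.coords_lfun[OF c that]
    by (auto simp: cx.lfun_iff cscale_def complex_eq_iff linear_add linear_scale linear_diff)
  show "Complex (c i (fst (v j, 0))) (c i (snd (v j, 0 :: 'a))) = (if i = j then 1 else 0)" if "i \<in> I" "j \<in> I" for i j
    using rv.coords_dual[OF c that] linear_0[OF rv.coords_lfun[OF c that(1)]] by (simp add: complex_eq_iff)
  fix z assume "z \<in> V \<times> V"
  then have "(\<Sum>i\<in>I. c i (fst z) *\<^sub>R v i) = fst z" "(\<Sum>i\<in>I. c i (snd z) *\<^sub>R v i) = snd z"
    using rv.coords_expand[OF c] by auto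
  then show "(\<Sum>i\<in>I. cscale (Complex (c i (fst z)) (c i (snd z))) (v i, 0)) = z"
    by (simp add: cscale_def prod_eq_iff fst_sum snd_sum)
qed

lemma subspace_complex: "subspace W \<Longrightarrow> cx.subspace (W \<times> W)"
  unfolding cx.subspace_def
  by (auto simp: cscale_def zero_prod_def subspace_0 intro!: subspace_add subspace_diff subspace_scale)

lemma fd_complex: "cx.fd (V \<times> V)"
proof -
  obtain I :: "'a set" and v c where c: "rv.coords V I v c" using rv.coords_exists[OF fd_carrier] .
  note cc = coords_complex[OF c] and sV = subspace_complex[OF subspace_carrier]
  show ?thesis
    using cx.fd_span[of "(\<lambda>i. (v i, 0)) ` I"] cx.coords_span[OF cc sV] rv.coords_finite[OF c] by simp
qed

lemma complex_symplectic_complexification: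
  assumes "unimodular V br"
  shows "complex_symplectic cscale br_complex form_complex (V \<times> V)"
proof (intro complex_symplectic.intro complex_symplectic_axioms.intro complex_lie_br_complex)
  show "cx.lfun (form_complex x)" for x
    by (auto simp: cx.lfun_iff form_complex_def cscale_def form_linear complex_eq_iff algebra_simps)
  show "form_complex y x = - form_complex x y" for x y
    using skew_total[of "fst y" "fst x"] skew_total[of "snd y" "snd x"] skew_total[of "fst y" "snd x"]
      skew_total[of "snd y" "fst x"]
    by (simp add: form_complex_def complex_eq_iff)
  show "form_complex (br_complex x y) z + form_complex (br_complex y z) x + form_complex (br_complex z x) y = 0" for x y z
    using closed_total[of "fst x" "fst y" "fst z"] closed_total[of "fst x" "snd y" "snd z"]
      closed_total[of "snd x" "fst y" "snd z"] closed_total[of "snd x" "snd y" "fst z"]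
      closed_total[of "snd x" "snd y" "snd z"] closed_total[of "snd x" "fst y" "fst z"]
      closed_total[of "fst x" "snd y" "fst z"] closed_total[of "fst x" "fst y" "snd z"]
    by (simp add: form_complex_def br_complex_def form_linear complex_eq_iff)
  show "cl.subalg (V \<times> V)"
    unfolding cl.subalg_def using fd_complex br_closed subspace_carrier
    by (auto simp: br_complex_def intro!: subspace_diff subspace_add)
  show "x = 0" if "x \<in> V \<times> V" "\<And>y. y \<in> V \<times> V \<Longrightarrow> form_complex x y = 0" for x
  proof -
    have "\<omega> (fst x) y = 0 \<and> \<omega> (snd x) y = 0" if "y \<in> V" for y
      using \<open>\<And>y. y \<in> V \<times> V \<Longrightarrow> form_complex x y = 0\<close>[of "(y, 0)"] that subspace_0[OF subspace_carrier]
      by (simp add: form_complex_def form_linear complex_eq_iff)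
    then have "fst x = 0" "snd x = 0"
      using form_nondegenerate[of "fst x"] form_nondegenerate[of "snd x"] that(1) by auto
    then show ?thesis by (simp add: prod_eq_iff)
  qed
  show "cx.tr (V \<times> V) (br_complex x) = 0" if x: "x \<in> V \<times> V" for x
  proof -
    obtain I :: "'a set" and v c where c: "rv.coords V I v c" using rv.coords_exists[OF fd_carrier] .
    have t: "trace_on V (br y) = (\<Sum>i\<in>I. c i (br y (v i)))" for y
      using rv.coords_finite[OF c] rv.coords_mem[OF c] rv.coords_lfun[OF c] rv.coords_dual[OF c]
        rv.coords_expand[OF c] subspace_carrier linear_br_right br_closed
      by (intro trace_on_coords) (auto intro: linear_on_linear)
    have "cx.tr (V \<times> V) (br_complex x)
        = (\<Sum>i\<in>I. Complex (c i (fst (br_complex x (v i, 0)))) (c i (snd (br_complex x (v i, 0)))))"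
      using br_closed subspace_carrier
      by (intro cx.tr_coords[OF fd_complex cl.lin_br_right _ coords_complex[OF c]])
        (auto simp: br_complex_def intro!: subspace_diff subspace_add)
    also have "\<dots> = (\<Sum>i\<in>I. Complex (c i (br (fst x) (v i))) (c i (br (snd x) (v i))))"
      by (simp add: br_complex_def br_linear)
    also have "\<dots> = Complex (trace_on V (br (fst x))) (trace_on V (br (snd x)))"
      by (simp add: t complex_eq_iff Re_sum Im_sum)
    also have "\<dots> = 0" using assms x by (auto simp: unimodular_def complex_eq_iff)
    finally show ?thesis .
  qed
qed

text \<open>Lie's theorem on \<open>J \<times> J\<close> gives an eigenvector u + i v with weight
  \<alpha> + i \<beta>; the two formulas are the real and imaginary parts of the eigenvalue equation
  for real x.\<close>

lemma ideal_eigenvector: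
  assumes "unimodular V br" "lie_ideal V br J" "J \<noteq> {0}"
  obtains u v \<alpha> \<beta> where "u \<in> J" "v \<in> J" "u \<noteq> 0 \<or> v \<noteq> 0"
    "\<And>x. x \<in> V \<Longrightarrow> br x u = \<alpha> x *\<^sub>R u - \<beta> x *\<^sub>R v" "\<And>x. x \<in> V \<Longrightarrow> br x v = \<beta> x *\<^sub>R u + \<alpha> x *\<^sub>R v"
proof -
  interpret cs: complex_symplectic cscale br_complex form_complex "V \<times> V"
    by (rule complex_symplectic_complexification[OF assms(1)])
  have J: "subspace J" "J \<subseteq> V" "\<And>x y. x \<in> V \<Longrightarrow> y \<in> J \<Longrightarrow> br x y \<in> J"
    using assms(2) by (auto simp: lie_ideal_def)
  have "cl.solvable (V \<times> V)"
    unfolding cl.solvable_def by (intro conjI allI impI cs.subalg_G cs.no_perfect_subalgebra)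
  moreover have "cl.rep (V \<times> V) (J \<times> J) br_complex"
  proof (rule cl.rep_subspace[OF cl.rep_adjoint[OF cs.subalg_G cs.subalg_G subset_refl] subspace_complex[OF J(1)]])
    show "br_complex x m \<in> J \<times> J" if "x \<in> V \<times> V" "m \<in> J \<times> J" for x m
      using that J(3) by (auto simp: br_complex_def intro!: subspace_diff[OF J(1)] subspace_add[OF J(1)])
  qed (use J(2) in blast)
  moreover have "J \<times> J \<noteq> {0}"
    using assms(3) subspace_0[OF J(1)] by (auto simp: zero_prod_def)
  ultimately obtain z \<theta> where z: "z \<in> J \<times> J" "z \<noteq> 0"
    "\<And>x. x \<in> V \<times> V \<Longrightarrow> br_complex x z = cscale (\<theta> x) z"
    using cl.solvable_common_eigenvector by blast
  have "br x (fst z) = Re (\<theta> (x, 0)) *\<^sub>R fst z - Im (\<theta> (x, 0)) *\<^sub>R snd z \<and>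
      br x (snd z) = Im (\<theta> (x, 0)) *\<^sub>R fst z + Re (\<theta> (x, 0)) *\<^sub>R snd z" if "x \<in> V" for x
    using z(3)[of "(x, 0)"] that subspace_0[OF subspace_carrier]
    by (simp add: br_complex_def cscale_def br_linear add.commute)
  then show ?thesis
    using that[of "fst z" "snd z" "\<lambda>x. Re (\<theta> (x, 0))" "\<lambda>x. Im (\<theta> (x, 0))"] z(1,2)
    by (auto simp: prod_eq_iff)
qed

end

section \<open>Symplectic reduction\<close>

text \<open>Double extensions inherit all axioms from V along the isomorphism, so the compatibility
  conditions on their data never have to be verified.\<close>

lemma symplectic_transport:
  assumes "symplectic_lie_algebra V br \<omega>" and iso: "symplectic_lie_iso V br \<omega> V' br' \<omega>' \<phi>"
    and V': "subspace V'"
  shows "symplectic_lie_algebra V' br' \<omega>'"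
proof -
  interpret symplectic_lie_algebra V br \<omega> by fact
  have \<phi>: "x \<in> V \<Longrightarrow> \<phi> x \<in> V'" "x \<in> V \<Longrightarrow> y \<in> V \<Longrightarrow> \<phi> (x + y) = \<phi> x + \<phi> y"
    "x \<in> V \<Longrightarrow> \<phi> (c *\<^sub>R x) = c *\<^sub>R \<phi> x" "x \<in> V \<Longrightarrow> y \<in> V \<Longrightarrow> br' (\<phi> x) (\<phi> y) = \<phi> (br x y)"
    "x \<in> V \<Longrightarrow> y \<in> V \<Longrightarrow> \<omega>' (\<phi> x) (\<phi> y) = \<omega> x y" for x y c
    using iso by (auto simp: symplectic_lie_iso_def linear_on_def)
  have surj: "\<And>x'. x' \<in> V' \<Longrightarrow> \<exists>x\<in>V. x' = \<phi> x"
    using iso by (auto simp: symplectic_lie_iso_def bij_betw_def)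
  have \<phi>0: "\<phi> 0 = 0" using \<phi>(3)[of 0 0] subspace_0[OF subspace_carrier] by simp
  have V: "x \<in> V \<Longrightarrow> y \<in> V \<Longrightarrow> x + y \<in> V" "x \<in> V \<Longrightarrow> c *\<^sub>R x \<in> V" "x \<in> V \<Longrightarrow> y \<in> V \<Longrightarrow> br x y \<in> V" for x y c
    using subspace_carrier bilinear_bracket
    by (auto simp: bilinear_on_def linear_on_def intro: subspace_add subspace_scale)
  have b: "x \<in> V \<Longrightarrow> y \<in> V \<Longrightarrow> z \<in> V \<Longrightarrow> br x (y + z) = br x y + br x z"
    "x \<in> V \<Longrightarrow> y \<in> V \<Longrightarrow> z \<in> V \<Longrightarrow> br (x + y) z = br x z + br y z"
    "x \<in> V \<Longrightarrow> y \<in> V \<Longrightarrow> br x (c *\<^sub>R y) = c *\<^sub>R br x y"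
    "x \<in> V \<Longrightarrow> y \<in> V \<Longrightarrow> br (c *\<^sub>R x) y = c *\<^sub>R br x y" for x y z c
    using bilinear_bracket by (auto simp: bilinear_on_def linear_on_def)
  have w: "x \<in> V \<Longrightarrow> y \<in> V \<Longrightarrow> z \<in> V \<Longrightarrow> \<omega> x (y + z) = \<omega> x y + \<omega> x z"
    "x \<in> V \<Longrightarrow> y \<in> V \<Longrightarrow> z \<in> V \<Longrightarrow> \<omega> (x + y) z = \<omega> x z + \<omega> y z"
    "x \<in> V \<Longrightarrow> y \<in> V \<Longrightarrow> \<omega> x (c *\<^sub>R y) = c * \<omega> x y"
    "x \<in> V \<Longrightarrow> y \<in> V \<Longrightarrow> \<omega> (c *\<^sub>R x) y = c * \<omega> x y" for x y z c
    using bilinear_form by (auto simp: bilinear_on_def linear_on_def)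
  show ?thesis
  proof unfold_locales
    show "subspace V'" by fact
    obtain B where B: "finite B" "span B = V" using finite_dimensional by blast
    have "V' \<subseteq> span (\<phi> ` B)"
    proof
      fix x' assume "x' \<in> V'"
      then obtain x where x: "x \<in> V" "x' = \<phi> x" using surj by blast
      have "x \<in> span B" using x B by simp
      then have "\<phi> x \<in> span (\<phi> ` B) \<and> x \<in> V"
      proof (induction rule: span_induct_alt)
        case base
        show ?case using \<phi>0 span_zero subspace_0[OF subspace_carrier] by simp
      next
        case (step c u y)
        then have "u \<in> V" using B(2) span_base by blast
        then show ?case
          using step \<phi>(2)[of "c *\<^sub>R u" y] \<phi>(3)[of u c] V(1)[of "c *\<^sub>R u" y] V(2)[of u c]
            span_add[OF span_scale[OF span_base[of "\<phi> u" "\<phi> ` B"]], of "\<phi> y" c] by simp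
      qed
      then show "x' \<in> span (\<phi> ` B)" using x by simp
    qed
    moreover have "\<phi> ` B \<subseteq> V'" using B(2) span_superset \<phi>(1) by blast
    then have "span (\<phi> ` B) \<subseteq> V'" using V' by (rule span_minimal)
    ultimately show "\<exists>B. finite B \<and> span B = V'" using B(1) by blast
    show "bilinear_on V' V' br'"
      unfolding bilinear_on_def linear_on_def
      by (auto dest!: surj simp: \<phi>(4) \<phi>(1) V b simp flip: \<phi>(2) \<phi>(3))
    show "bilinear_on V' UNIV \<omega>'"
      unfolding bilinear_on_def linear_on_def
      by (auto dest!: surj simp: \<phi>(5) V w simp flip: \<phi>(2) \<phi>(3))
    show "br' x x = 0" if "x \<in> V'" for x
      using surj[OF that] \<phi>(4) bracket_self \<phi>0 by auto
    show "br' x (br' y z) + br' y (br' z x) + br' z (br' x y) = 0"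
      if xyz: "x \<in> V'" "y \<in> V'" "z \<in> V'" for x y z
    proof -
      obtain x0 y0 z0 where "x0 \<in> V" "x = \<phi> x0" "y0 \<in> V" "y = \<phi> y0" "z0 \<in> V" "z = \<phi> z0"
        using surj[OF xyz(1)] surj[OF xyz(2)] surj[OF xyz(3)] by blast
      then show ?thesis using jacobi[of x0 y0 z0] by (simp add: \<phi>(4) V \<phi>0 flip: \<phi>(2))
    qed
    show "\<omega>' y x = - \<omega>' x y" if xy: "x \<in> V'" "y \<in> V'" for x y
    proof -
      obtain x0 y0 where "x0 \<in> V" "x = \<phi> x0" "y0 \<in> V" "y = \<phi> y0" using surj[OF xy(1)] surj[OF xy(2)] by blast
      then show ?thesis using form_skew[of x0 y0] by (simp add: \<phi>(5))
    qed
    show "x = 0" if x: "x \<in> V'" and nd: "\<And>y. y \<in> V' \<Longrightarrow> \<omega>' x y = 0" for x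
    proof -
      obtain x0 where "x0 \<in> V" "x = \<phi> x0" using surj[OF x] by blast
      moreover from this have "\<omega> x0 y = 0" if "y \<in> V" for y using nd[OF \<phi>(1)[OF that]] \<phi>(5) that by simp
      ultimately show ?thesis using form_nondegenerate \<phi>0 by auto
    qed
    show "\<omega>' (br' x y) z + \<omega>' (br' y z) x + \<omega>' (br' z x) y = 0"
      if xyz: "x \<in> V'" "y \<in> V'" "z \<in> V'" for x y z
    proof -
      obtain x0 y0 z0 where "x0 \<in> V" "x = \<phi> x0" "y0 \<in> V" "y = \<phi> y0" "z0 \<in> V" "z = \<phi> z0"
        using surj[OF xyz(1)] surj[OF xyz(2)] surj[OF xyz(3)] by blast
      then show ?thesis using form_closed[of x0 y0 z0] by (simp add: \<phi>(4,5) V)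
    qed
  qed
qed

context total_symplectic
begin

text \<open>A dual family of a basis assembles the representing vector. All vector parameters of the
  double extensions other than z arise from representers.\<close>

lemma representer_exists:
  assumes "linear f"
  obtains p where "p \<in> V" "\<And>x. x \<in> V \<Longrightarrow> \<omega> p x = f x"
proof -
  obtain I :: "'a set" and v c where c: "rv.coords V I v c" using rv.coords_exists[OF fd_carrier] .
  have "\<exists>g. (\<forall>i\<in>I. g i \<in> V) \<and> (\<forall>i\<in>I. \<forall>j\<in>I. \<omega> (g i) (v j) = (if i = j then 1 else 0))"
  proof (rule rv.dual_coords[OF c subspace_carrier linear_form linear_form_left _ subspace_carrier])
    fix x assume x: "x \<in> V" "\<And>k. k \<in> V \<Longrightarrow> \<omega> k x = 0"
    have "\<omega> x y = 0" if "y \<in> V" for y using x(2)[OF that] skew_total[of x y] by simp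
    then show "x = 0" using form_nondegenerate[OF x(1)] by blast
  qed
  then obtain g where g: "\<And>i. i \<in> I \<Longrightarrow> g i \<in> V"
    "\<And>i j. i \<in> I \<Longrightarrow> j \<in> I \<Longrightarrow> \<omega> (g i) (v j) = (if i = j then 1 else 0)" by blast
  define p where "p = (\<Sum>i\<in>I. f (v i) *\<^sub>R g i)"
  have "\<omega> p (v j) = f (v j)" if "j \<in> I" for j
  proof -
    have "\<omega> p (v j) = (\<Sum>i\<in>I. if i = j then f (v i) else 0)"
      unfolding p_def linear_sum[OF linear_form_left] form_linear using g(2) that by (intro sum.cong) auto
    then show ?thesis using that rv.coords_finite[OF c] by simp
  qed
  then have "\<omega> p x = f x" if "x \<in> V" for x
    using linear_eq_on_span[OF linear_form assms, of "v ` I" p x] that rv.coords_span[OF c subspace_carrier] by auto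
  moreover have "p \<in> V" unfolding p_def using g(1) subspace_carrier by (intro subspace_sum subspace_scale) auto
  ultimately show ?thesis using that by blast
qed

end

text \<open>Symplectic reduction by the ideal spanned by the \<open>e i\<close>, realized on the orthogonal complement
  of the hyperbolic space spanned by the \<open>e i\<close> and \<open>d i\<close>.\<close>

locale symplectic_reduction = total_symplectic V br \<omega>
  for V :: "'a::real_vector set" and br :: "'a \<Rightarrow> 'a \<Rightarrow> 'a" and \<omega> :: "'a \<Rightarrow> 'a \<Rightarrow> real" +
  fixes I :: "'i set" and e d :: "'i \<Rightarrow> 'a"
  assumes finite_I: "finite I" and e_mem: "i \<in> I \<Longrightarrow> e i \<in> V" and d_mem: "i \<in> I \<Longrightarrow> d i \<in> V"
    and form_de: "i \<in> I \<Longrightarrow> j \<in> I \<Longrightarrow> \<omega> (d i) (e j) = (if i = j then 1 else 0)"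
    and form_ee: "i \<in> I \<Longrightarrow> j \<in> I \<Longrightarrow> \<omega> (e i) (e j) = 0"
    and form_dd: "i \<in> I \<Longrightarrow> j \<in> I \<Longrightarrow> \<omega> (d i) (d j) = 0"
    and ideal: "x \<in> V \<Longrightarrow> i \<in> I \<Longrightarrow> br x (e i) \<in> span (e ` I)"
begin

text \<open>The projection onto \<open>A\<close> along all \<open>d i\<close> and
  \<open>e i\<close>: pairing with \<open>e i\<close> reads off the coefficient of
  \<open>d i\<close> and vice versa, the order of the arguments absorbing the sign.\<close>

definition proj :: "'a \<Rightarrow> 'a" where
  "proj x = x - (\<Sum>i\<in>I. \<omega> x (e i) *\<^sub>R d i) - (\<Sum>i\<in>I. \<omega> (d i) x *\<^sub>R e i)"

definition A :: "'a set" where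
  "A = {x \<in> V. \<forall>i\<in>I. \<omega> x (e i) = 0 \<and> \<omega> x (d i) = 0}"

lemma form_ed: "i \<in> I \<Longrightarrow> j \<in> I \<Longrightarrow> \<omega> (e i) (d j) = (if i = j then -1 else 0)"
  using form_de[of j i] skew_total[of "e i" "d j"] by auto

lemma linear_proj: "linear proj"
  unfolding proj_def
  by (intro linear_compose_sub linear_ident rv.lin_combination linear_form linear_form_left)

lemma A_subset: "A \<subseteq> V"
  by (auto simp: A_def)

lemma subspace_A: "subspace A"
  using subspace_carrier by (auto simp: A_def subspace_def form_linear)

lemma A_form: "x \<in> A \<Longrightarrow> i \<in> I \<Longrightarrow> \<omega> x (e i) = 0" "x \<in> A \<Longrightarrow> i \<in> I \<Longrightarrow> \<omega> x (d i) = 0"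
  "x \<in> A \<Longrightarrow> i \<in> I \<Longrightarrow> \<omega> (e i) x = 0" "x \<in> A \<Longrightarrow> i \<in> I \<Longrightarrow> \<omega> (d i) x = 0"
  using skew_total[of "e i" x] skew_total[of "d i" x] by (auto simp: A_def)

lemma proj_A: "x \<in> A \<Longrightarrow> proj x = x"
  by (simp add: proj_def A_form)

lemma sum_delta_mult:
  "j \<in> I \<Longrightarrow> (\<Sum>i\<in>I. f i * (if i = j then b else 0)) = f j * (b :: real)"
  "j \<in> I \<Longrightarrow> (\<Sum>i\<in>I. f i * (if j = i then b else 0)) = f j * (b :: real)"
  using finite_I by (simp_all add: if_distrib[of "\<lambda>x. _ * x"] cong: if_cong)

lemma proj_mem: "x \<in> V \<Longrightarrow> proj x \<in> A"
proof -
  assume x: "x \<in> V"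
  have "proj x \<in> V" unfolding proj_def using x e_mem d_mem subspace_carrier
    by (intro subspace_diff subspace_sum subspace_scale) auto
  moreover have "\<omega> (proj x) (e j) = 0" if j: "j \<in> I" for j
  proof -
    have "(\<Sum>i\<in>I. \<omega> x (e i) * \<omega> (d i) (e j)) = (\<Sum>i\<in>I. \<omega> x (e i) * (if i = j then 1 else 0))"
      using j by (intro sum.cong) (auto simp: form_de)
    moreover have "(\<Sum>i\<in>I. \<omega> (d i) x * \<omega> (e i) (e j)) = 0"
      using j by (intro sum.neutral) (auto simp: form_ee)
    ultimately show ?thesis
      using j by (simp add: proj_def form_linear linear_sum[OF linear_form_left] sum_delta_mult)
  qed
  moreover have "\<omega> (proj x) (d j) = 0" if j: "j \<in> I" for j
  proof -
    have "(\<Sum>i\<in>I. \<omega> (d i) x * \<omega> (e i) (d j)) = (\<Sum>i\<in>I. \<omega> (d i) x * (if i = j then - 1 else 0))"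
      using j by (intro sum.cong) (auto simp: form_ed)
    moreover have "(\<Sum>i\<in>I. \<omega> x (e i) * \<omega> (d i) (d j)) = 0"
      using j by (intro sum.neutral) (auto simp: form_dd)
    ultimately show ?thesis
      using j skew_total[of "d j" x]
      by (simp add: proj_def form_linear linear_sum[OF linear_form_left] sum_delta_mult)
  qed
  ultimately show ?thesis by (simp add: A_def)
qed

lemma decompose: "x = proj x + (\<Sum>i\<in>I. \<omega> x (e i) *\<^sub>R d i) + (\<Sum>i\<in>I. \<omega> (d i) x *\<^sub>R e i)"
  by (simp add: proj_def)

lemma form_proj: "z \<in> A \<Longrightarrow> \<omega> (proj x) z = \<omega> x z" "z \<in> A \<Longrightarrow> \<omega> z (proj x) = \<omega> z x"
  by (simp_all add: proj_def form_linear linear_sum[OF linear_form] linear_sum[OF linear_form_left] A_form)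

lemma proj_e: "i \<in> I \<Longrightarrow> proj (e i) = 0"
proof -
  assume i: "i \<in> I"
  have "(\<Sum>j\<in>I. \<omega> (e i) (e j) *\<^sub>R d j) = 0" using i by (intro sum.neutral) (auto simp: form_ee)
  moreover have "(\<Sum>j\<in>I. \<omega> (d j) (e i) *\<^sub>R e j) = (\<Sum>j\<in>I. if j = i then e j else 0)"
    using i by (intro sum.cong) (auto simp: form_de)
  ultimately show ?thesis using i finite_I by (simp add: proj_def)
qed

lemma proj_d: "i \<in> I \<Longrightarrow> proj (d i) = 0"
proof -
  assume i: "i \<in> I"
  have "(\<Sum>j\<in>I. \<omega> (d j) (d i) *\<^sub>R e j) = 0" using i by (intro sum.neutral) (auto simp: form_dd)
  moreover have "(\<Sum>j\<in>I. \<omega> (d i) (e j) *\<^sub>R d j) = (\<Sum>j\<in>I. if j = i then d j else 0)"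
    using i by (intro sum.cong) (auto simp: form_de)
  ultimately show ?thesis using i finite_I by (simp add: proj_def)
qed

lemma proj_span_e: "y \<in> span (e ` I) \<Longrightarrow> proj y = 0"
  using linear_eq_0_on_span[OF linear_proj, of "e ` I" y] proj_e by blast

lemma span_e_form: "y \<in> span (e ` I) \<Longrightarrow> z \<in> A \<Longrightarrow> \<omega> y z = 0"
  using linear_eq_0_on_span[OF linear_form_left, of "e ` I" z y] A_form(3) by blast

lemma br_span_e: "x \<in> V \<Longrightarrow> y \<in> span (e ` I) \<Longrightarrow> br x y \<in> span (e ` I)"
  using rv.lin_span[OF linear_br_right, of "e ` I" x "span (e ` I)" y] ideal by auto

text \<open>Closedness moves the bracket onto \<open>e i\<close>, where it stays in the ideal, which
  is orthogonal to A. Thus brackets of A have no component along the \<open>d i\<close>.\<close>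

lemma br_A_form_e:
  assumes "x \<in> A" "y \<in> A" "i \<in> I"
  shows "\<omega> (br x y) (e i) = 0"
proof -
  have "\<omega> (br x (e i)) y = 0" "\<omega> (br y (e i)) x = 0"
    using span_e_form ideal assms A_subset by blast+
  then show ?thesis
    using form_br[of x y "e i"] skew_total[of y "br x (e i)"] skew_total[of x "br y (e i)"] by simp
qed

lemma br_A_decompose:
  assumes "x \<in> A" "y \<in> A"
  shows "br x y - proj (br x y) \<in> span (e ` I)"
proof -
  have "br x y - proj (br x y) = (\<Sum>i\<in>I. \<omega> (d i) (br x y) *\<^sub>R e i)"
    by (simp add: proj_def br_A_form_e[OF assms])
  also have "\<dots> \<in> span (e ` I)" by (intro span_sum span_scale span_base imageI)
  finally show ?thesis .
qed

text \<open>\<open>A\<close> is a complement of the ideal in its orthogonal space; this is the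
  bracket of the quotient of that space by the ideal.\<close>

definition br_A :: "'a \<Rightarrow> 'a \<Rightarrow> 'a" where
  "br_A x y = proj (br x y)"

lemma symplectic_A: "symplectic_lie_algebra A br_A \<omega>"
proof unfold_locales
  show "subspace A" by (rule subspace_A)
  obtain J :: "'a set" and v c where c: "rv.coords A J v c"
    using rv.coords_exists[OF rv.fd_mono[OF fd_carrier subspace_A A_subset]] .
  show "\<exists>B. finite B \<and> span B = A"
    using rv.coords_span[OF c subspace_A] rv.coords_finite[OF c] by blast
  have "linear (\<lambda>y. br_A x y)" "linear (\<lambda>x. br_A x y)" for x y
    unfolding br_A_def
    using linear_compose[OF linear_br_right linear_proj] linear_compose[OF linear_br_left linear_proj]
    by (simp_all add: o_def)
  moreover have brA: "br_A x y \<in> A" for x y unfolding br_A_def by (rule proj_mem[OF br_closed])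
  ultimately show "bilinear_on A A br_A" unfolding bilinear_on_def by (auto intro!: linear_on_linear)
  show "bilinear_on A UNIV \<omega>"
    unfolding bilinear_on_def using linear_form linear_form_left by (auto intro!: linear_on_linear)
  show "br_A x x = 0" for x by (simp add: br_A_def br_self_total linear_0[OF linear_proj])
  show "\<omega> y x = - \<omega> x y" for x y by (rule skew_total)
  show "\<omega> (br_A x y) z + \<omega> (br_A y z) x + \<omega> (br_A z x) y = 0" if "x \<in> A" "y \<in> A" "z \<in> A" for x y z
    using closed_total[of x y z] that by (simp add: br_A_def form_proj)
  show "x = 0" if x: "x \<in> A" and nd: "\<And>y. y \<in> A \<Longrightarrow> \<omega> x y = 0" for x
  proof (rule form_nondegenerate)
    show "x \<in> V" using x A_subset by blast
    show "\<omega> x y = 0" if "y \<in> V" for y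
      using nd[OF proj_mem[OF that]] form_proj(2)[OF x, of y] by simp
  qed
  show "br_A x (br_A y z) + br_A y (br_A z x) + br_A z (br_A x y) = 0"
    if xyz: "x \<in> A" "y \<in> A" "z \<in> A" for x y z
  proof -
    have *: "br_A x (br_A y z) = proj (br x (br y z))" if "x \<in> A" "y \<in> A" "z \<in> A" for x y z
    proof -
      have "br x (br y z - proj (br y z)) \<in> span (e ` I)"
        using br_span_e[OF _ br_A_decompose[OF that(2,3)]] that(1) A_subset by blast
      then have "proj (br x (br y z - proj (br y z))) = 0" by (rule proj_span_e)
      then show ?thesis by (simp add: br_A_def br_linear linear_diff[OF linear_proj])
    qed
    have "br x (br y z) + br y (br z x) + br z (br x y) = 0"
      using jacobi[of x y z] xyz A_subset by blast
    then show ?thesis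
      using xyz by (simp add: * linear_0[OF linear_proj] flip: linear_add[OF linear_proj])
  qed
qed

text \<open>In a basis of V made of A, the \<open>d i\<close> and the \<open>e i\<close>, the
  diagonal entries of \<open>br x\<close> at \<open>d i\<close> and \<open>e i\<close> cancel: by
  closedness they are opposite, since \<open>br (d i) (e i)\<close> lies in the ideal and is
  orthogonal to x.\<close>

lemma unimodular_A:
  assumes "unimodular V br"
  shows "unimodular A br_A"
  unfolding unimodular_def
proof
  fix x assume x: "x \<in> A"
  have xV: "x \<in> V" using x A_subset by blast
  obtain J :: "'a set" and v c where c: "rv.coords A J v c"
    using rv.coords_exists[OF rv.fd_mono[OF fd_carrier subspace_A A_subset]] .
  note cJ = rv.coords_finite[OF c] rv.coords_mem[OF c] rv.coords_lfun[OF c] rv.coords_dual[OF c]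
    rv.coords_expand[OF c]
  have linear_br_A: "linear (br_A x)"
    unfolding br_A_def using linear_compose[OF linear_br_right linear_proj] by (simp add: o_def)
  have trA: "trace_on A (br_A x) = (\<Sum>j\<in>J. c j (br_A x (v j)))"
  proof (rule trace_on_coords)
    show "linear_on A A (br_A x)"
      using linear_br_A by (rule linear_on_linear) (simp add: br_A_def proj_mem[OF br_closed])
  qed (use cJ subspace_A in \<open>auto intro: linear_on_linear\<close>)
  define w where "w = case_sum v (case_sum d e)"
  define k where "k = case_sum (\<lambda>j y. c j (proj y)) (case_sum (\<lambda>i y. \<omega> y (e i)) (\<lambda>i y. \<omega> (d i) y))"
  let ?K = "J <+> (I <+> I)"
  have sumK: "(\<Sum>a\<in>?K. f a) = (\<Sum>j\<in>J. f (Inl j)) + (\<Sum>i\<in>I. f (Inr (Inl i))) + (\<Sum>i\<in>I. f (Inr (Inr i)))"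
    for f :: "'a + 'i + 'i \<Rightarrow> 'c::comm_monoid_add"
    using cJ(1) finite_I by (simp add: sum.Plus add.assoc)
  have "trace_on V (br x) = (\<Sum>a\<in>?K. k a (br x (w a)))"
  proof (rule trace_on_coords)
    show "linear_on V V (br x)" using linear_br_right br_closed by (rule linear_on_linear)
    show "finite ?K" using cJ(1) finite_I by simp
    show "w a \<in> V" if "a \<in> ?K" for a
      using that cJ(2) A_subset d_mem e_mem by (auto simp: w_def)
    show "linear_on V UNIV (k a)" if a: "a \<in> ?K" for a
    proof -
      have "linear (\<lambda>y. c j (proj y))" if "j \<in> J" for j
        using linear_compose[OF linear_proj cJ(3)[OF that]] by (simp add: o_def)
      then show ?thesis
        using a linear_form linear_form_left by (auto simp: k_def intro!: linear_on_linear)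
    qed
    show "k a (w b) = (if a = b then 1 else 0)" if "a \<in> ?K" "b \<in> ?K" for a b
      using that cJ(2,4) linear_0[OF cJ(3)] form_de form_ee form_dd
      by (auto simp: k_def w_def proj_A proj_d proj_e A_form split: if_splits)
    show "(\<Sum>a\<in>?K. k a y *\<^sub>R w a) = y" if "y \<in> V" for y
      using cJ(5)[OF proj_mem[OF that]] decompose[of y] by (simp add: sumK k_def w_def)
  qed (rule subspace_carrier)
  also have "\<dots> = trace_on A (br_A x) + ((\<Sum>i\<in>I. \<omega> (br x (d i)) (e i)) + (\<Sum>i\<in>I. \<omega> (d i) (br x (e i))))"
    by (simp add: sumK k_def w_def trA br_A_def)
  also have "(\<Sum>i\<in>I. \<omega> (br x (d i)) (e i)) = (\<Sum>i\<in>I. - \<omega> (d i) (br x (e i)))"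
  proof (intro sum.cong refl)
    fix i assume i: "i \<in> I"
    have "\<omega> x (br (d i) (e i)) = 0"
      using span_e_form[OF ideal[OF d_mem[OF i] i] x] skew_total[of x "br (d i) (e i)"] by simp
    then show "\<omega> (br x (d i)) (e i) = - \<omega> (d i) (br x (e i))" using form_br[of x "d i" "e i"] by simp
  qed
  finally show "trace_on A (br_A x) = 0" using assms xV by (simp add: unimodular_def sum_negf)
qed

lemma representer_A:
  assumes "linear f"
  shows "\<exists>p\<in>A. \<forall>x\<in>A. \<omega> p x = f x"
proof -
  obtain p where p: "p \<in> V" "\<And>x. x \<in> V \<Longrightarrow> \<omega> p x = f x" using representer_exists[OF assms] by blast
  then show ?thesis using proj_mem[OF p(1)] A_subset form_proj(1) by (intro bexI[of _ "proj p"]) auto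
qed

text \<open>Closedness with \<open>d i\<close> as third argument; this is the origin of the
  e-component of a bracket of two elements of A in the double extensions.\<close>

lemma br_A_form_d:
  assumes "x \<in> A" "y \<in> A"
  shows "\<omega> (d i) (br x y) = \<omega> (proj (br (d i) x)) y + \<omega> x (proj (br (d i) y))"
  using form_br[of x y "d i"] skew_total[of "d i" "br x y"] br_skew[of "d i" x] br_skew[of "d i" y]
    skew_total[of y "br (d i) x"]
  by (simp add: form_proj assms form_linear)

lemma linear_on_D: "linear_on A A (\<lambda>x. proj (br y x))"
  using linear_compose[OF linear_br_right linear_proj] proj_mem[OF br_closed]
  by (intro linear_on_linear) (simp_all add: o_def)

end

section \<open>Reconstruction as a double extension\<close>

context total_symplectic
begin

text \<open>Choose d dual to e, reduce by the line of e, and read the data off the brackets: p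
  represents the weight \<alpha>, while D and q give the A-part and the e-part of
  \<open>br d\<close> on A.\<close>

lemma line_extension:
  assumes uni: "unimodular V br" and e: "e \<in> V" "e \<noteq> 0" "\<And>x. x \<in> V \<Longrightarrow> br x e = \<alpha> x *\<^sub>R e"
  shows "\<exists>A br\<^sub>A \<omega>\<^sub>A. symplectic_lie_algebra A br\<^sub>A \<omega>\<^sub>A \<and> unimodular A br\<^sub>A \<and>
    is_line_double_extension V br \<omega> (A :: 'a set) br\<^sub>A \<omega>\<^sub>A"
proof -
  obtain d' where d': "d' \<in> V" "\<omega> e d' \<noteq> 0" using form_nondegenerate[OF e(1)] e(2) by blast
  define d where "d = inverse (\<omega> d' e) *\<^sub>R d'"
  have "\<omega> d' e \<noteq> 0" using d'(2) skew_total[of d' e] by simp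
  then have de: "\<omega> d e = 1" by (simp add: d_def form_linear)
  have dV: "d \<in> V" unfolding d_def using d'(1) subspace_carrier by (intro subspace_scale)
  have self: "\<omega> x x = 0" for x using skew_total[of x x] by simp
  interpret R: symplectic_reduction V br \<omega> "{()}" "\<lambda>_. e" "\<lambda>_. d"
  proof unfold_locales
    show "br x e \<in> span ((\<lambda>_. e) ` {()})" if "x \<in> V" for x using e(3)[OF that] by (auto intro: span_scale span_base)
  qed (use e(1) dV de self in auto)
  note A_form = R.A_form[OF _ UNIV_I[where 'a = unit, unfolded UNIV_unit]]
  have ed: "\<omega> e d = - 1" using skew_total[of e d] de by simp
  have proj: "R.proj x = x - \<omega> x e *\<^sub>R d - \<omega> d x *\<^sub>R e" for x by (simp add: R.proj_def)
  have proj0: "R.proj e = 0" "R.proj d = 0" using R.proj_e R.proj_d by auto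
  note AV = R.A_subset
  note lp = linear_add[OF R.linear_proj] linear_scale[OF R.linear_proj] linear_diff[OF R.linear_proj]
    linear_neg[OF R.linear_proj]
  have \<alpha>: "\<alpha> x = \<omega> d (br x e)" if "x \<in> V" for x using e(3)[OF that] by (simp add: form_linear de)
  have "linear (\<lambda>x. \<omega> d (br x e))"
    using linear_compose[OF linear_br_left linear_form] by (simp add: o_def)
  from R.representer_A[OF this]
  obtain p where p: "p \<in> R.A" "\<And>x. x \<in> R.A \<Longrightarrow> \<omega> p x = \<alpha> x"
    using \<alpha>[OF subsetD[OF AV]] by (metis (lifting))
  have "linear (\<lambda>x. \<omega> d (br d x))"
    using linear_compose[OF linear_br_right linear_form] by (simp add: o_def)
  then obtain q where q: "q \<in> R.A" "\<And>x. x \<in> R.A \<Longrightarrow> \<omega> q x = \<omega> d (br d x)"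
    using R.representer_A by blast
  define D where "D x = R.proj (br d x)" for x
  \<comment> \<open>The construction prescribes \<open>br e d\<close>, whereas \<alpha> belongs to
    \<open>br d e\<close>; hence the sign.\<close>
  define \<epsilon> where "\<epsilon> = - \<alpha> d"
  let ?br = "line_bracket R.br_A \<omega> p q D \<epsilon>" and ?\<omega> = "line_form \<omega>"
  define \<phi> where "\<phi> x = (\<omega> x e, R.proj x, \<omega> d x)" for x
  define \<psi> where "\<psi> = (\<lambda>(s, a, t). s *\<^sub>R d + a + t *\<^sub>R e)"
  have \<phi>\<psi>: "\<phi> (s *\<^sub>R d + a + t *\<^sub>R e) = (s, a, t)" if "a \<in> R.A" for s a t
    using that by (simp add: \<phi>_def form_linear lp proj0 R.proj_A A_form self de ed)
  have decomp: "\<exists>s a t. a \<in> R.A \<and> x = s *\<^sub>R d + a + t *\<^sub>R e" if "x \<in> V" for x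
    by (rule exI[of _ "\<omega> x e"], rule exI[of _ "R.proj x"], rule exI[of _ "\<omega> d x"])
      (simp add: R.proj_mem[OF that], simp add: proj)
  have br_expand: "br (s *\<^sub>R d + a + t *\<^sub>R e) (s' *\<^sub>R d + a' + t' *\<^sub>R e)
      = s *\<^sub>R br d a' - s' *\<^sub>R br d a + br a a'
        + (s * t' * \<alpha> d - t * s' * \<alpha> d + t' * \<alpha> a - t * \<alpha> a') *\<^sub>R e"
    if "a \<in> R.A" "a' \<in> R.A" for s a t s' a' t'
  proof -
    have "br d e = \<alpha> d *\<^sub>R e" "br a e = \<alpha> a *\<^sub>R e" "br e d = - (\<alpha> d *\<^sub>R e)" "br e a' = - (\<alpha> a' *\<^sub>R e)"
      "br a d = - br d a"
      using e(3)[OF dV] e(3)[of a] e(3)[of a'] that AV br_skew[of e d] br_skew[of e a'] br_skew[of a d] by auto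
    then show ?thesis by (simp add: br_linear br_self_total algebra_simps)
  qed
  \<comment> \<open>The d-component of \<open>br d a\<close> is forced by closedness to be the
    weight of a on e, so one vector p serves both relations.\<close>
  have form_bde: "\<omega> (br d a) e = \<alpha> a" if "a \<in> R.A" for a
    using form_br[of d a e] e(3)[OF subsetD[OF AV that]] e(3)[OF dV] A_form(1)[OF that]
    by (simp add: form_linear de)
  have form_aae: "\<omega> (br a a') e = 0" if "a \<in> R.A" "a' \<in> R.A" for a a'
    using R.br_A_form_e[OF that, of "()"] by simp
  have form_daa: "\<omega> d (br a a') = \<omega> (D a) a' + \<omega> a (D a')" if "a \<in> R.A" "a' \<in> R.A" for a a'
    using R.br_A_form_d[OF that] by (simp add: D_def)
  have \<phi>_br: "\<phi> (br x y) = ?br (\<phi> x) (\<phi> y)" if xy: "x \<in> V" "y \<in> V" for x y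
  proof -
    obtain s a t s' a' t' where a: "a \<in> R.A" "a' \<in> R.A"
      and x: "x = s *\<^sub>R d + a + t *\<^sub>R e" and y: "y = s' *\<^sub>R d + a' + t' *\<^sub>R e"
      using decomp[OF xy(1)] decomp[OF xy(2)] by blast
    show ?thesis
      unfolding x y br_expand[OF a] \<phi>\<psi>[OF a(1)] \<phi>\<psi>[OF a(2)]
      using a by (simp add: \<phi>_def form_linear lp proj0 form_bde form_aae form_daa p(2) q(2) \<epsilon>_def self de
          R.br_A_def flip: D_def) (simp add: algebra_simps)
  qed
  have \<phi>_form: "?\<omega> (\<phi> x) (\<phi> y) = \<omega> x y" if xy: "x \<in> V" "y \<in> V" for x y
  proof -
    obtain s a t s' a' t' where a: "a \<in> R.A" "a' \<in> R.A"
      and x: "x = s *\<^sub>R d + a + t *\<^sub>R e" and y: "y = s' *\<^sub>R d + a' + t' *\<^sub>R e"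
      using decomp[OF xy(1)] decomp[OF xy(2)] by blast
    show ?thesis unfolding x y \<phi>\<psi>[OF a(1)] \<phi>\<psi>[OF a(2)] using a by (simp add: form_linear self de ed A_form)
  qed
  have \<phi>_lin: "linear \<phi>"
    by (rule linearI) (simp_all add: \<phi>_def form_linear lp)
  have \<phi>_mem: "\<phi> x \<in> line_carrier R.A" if "x \<in> V" for x
    using R.proj_mem[OF that] by (simp add: \<phi>_def line_carrier_def)
  have "bij_betw \<phi> V (line_carrier R.A)"
  proof (rule bij_betw_byWitness[where f' = \<psi>])
    show "\<forall>x\<in>V. \<psi> (\<phi> x) = x" by (simp add: \<psi>_def \<phi>_def proj)
    show "\<forall>z\<in>line_carrier R.A. \<phi> (\<psi> z) = z" by (auto simp: \<psi>_def line_carrier_def \<phi>\<psi>)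
    show "\<phi> ` V \<subseteq> line_carrier R.A" using \<phi>_mem by blast
    show "\<psi> ` line_carrier R.A \<subseteq> V"
      using AV dV e(1) subspace_carrier
      by (auto simp: \<psi>_def line_carrier_def intro!: subspace_add subspace_scale)
  qed
  then have iso: "symplectic_lie_iso V br \<omega> (line_carrier R.A) ?br ?\<omega> \<phi>"
    unfolding symplectic_lie_iso_def using \<phi>_br \<phi>_form \<phi>_mem \<phi>_lin linear_on_linear by blast
  have "subspace (line_carrier R.A)"
    using R.subspace_A by (auto simp: line_carrier_def subspace_def zero_prod_def)
  then have "symplectic_lie_algebra (line_carrier R.A) ?br ?\<omega>"
    by (rule symplectic_transport[OF symplectic_lie_algebra_axioms iso])
  moreover have "linear_on R.A R.A D" unfolding D_def by (rule R.linear_on_D)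
  ultimately have "is_line_double_extension V br \<omega> R.A R.br_A \<omega>"
    unfolding is_line_double_extension_def using R.symplectic_A p(1) q(1) iso by blast
  then show ?thesis using R.symplectic_A R.unimodular_A[OF uni] by blast
qed

text \<open>Each x acts on the plane by a scalar plus a multiple of a quarter turn, with the sign
  convention of the construction. All d-components of brackets are forced by closedness; the
  remaining data are components of brackets with the dual vectors.\<close>

lemma plane_extension:
  assumes uni: "unimodular V br" and e\<^sub>0: "e\<^sub>0 \<in> V" and e\<^sub>1: "e\<^sub>1 \<in> V"
    and indep: "\<And>s t. s *\<^sub>R e\<^sub>0 + t *\<^sub>R e\<^sub>1 = 0 \<Longrightarrow> s = 0 \<and> t = 0" and e\<^sub>0e\<^sub>1: "\<omega> e\<^sub>0 e\<^sub>1 = 0"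
    and bre\<^sub>0: "\<And>x. x \<in> V \<Longrightarrow> br x e\<^sub>0 = \<alpha> x *\<^sub>R e\<^sub>0 + \<beta> x *\<^sub>R e\<^sub>1"
    and bre\<^sub>1: "\<And>x. x \<in> V \<Longrightarrow> br x e\<^sub>1 = \<alpha> x *\<^sub>R e\<^sub>1 - \<beta> x *\<^sub>R e\<^sub>0"
  shows "\<exists>A br\<^sub>A \<omega>\<^sub>A. symplectic_lie_algebra A br\<^sub>A \<omega>\<^sub>A \<and> unimodular A br\<^sub>A \<and>
    is_plane_double_extension V br \<omega> (A :: 'a set) br\<^sub>A \<omega>\<^sub>A"
proof -
  have self: "\<omega> x x = 0" for x using skew_total[of x x] by simp
  define e where "e b = (if b then e\<^sub>1 else e\<^sub>0)" for b
  have "\<exists>g. (\<forall>b\<in>UNIV. g b \<in> V) \<and> (\<forall>b\<in>UNIV. \<forall>b'\<in>UNIV. \<omega> (g b') (e b) = (if b = b' then 1 else 0))"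
  proof (rule rv.dual_family[OF finite subspace_carrier, where f = "\<lambda>b k. \<omega> k (e b)"])
    fix a :: "bool \<Rightarrow> real" assume a: "\<And>k. k \<in> V \<Longrightarrow> (\<Sum>b\<in>UNIV. a b * \<omega> k (e b)) = 0"
    have "a False *\<^sub>R e\<^sub>0 + a True *\<^sub>R e\<^sub>1 = 0"
    proof (rule form_nondegenerate)
      show "a False *\<^sub>R e\<^sub>0 + a True *\<^sub>R e\<^sub>1 \<in> V" using e\<^sub>0 e\<^sub>1 subspace_carrier by (intro subspace_add subspace_scale)
      show "\<omega> (a False *\<^sub>R e\<^sub>0 + a True *\<^sub>R e\<^sub>1) k = 0" if "k \<in> V" for k
        using a[OF that] skew_total[of e\<^sub>0 k] skew_total[of e\<^sub>1 k] by (simp add: form_linear UNIV_bool e_def)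
    qed
    then show "\<forall>b\<in>UNIV. a b = 0" using indep by (auto simp: UNIV_bool)
  qed (rule linear_form_left)
  then obtain g where g: "\<And>b. g b \<in> V" "\<And>b b'. \<omega> (g b') (e b) = (if b = b' then 1 else 0)" by blast
  define d\<^sub>0 where "d\<^sub>0 = g False"
  \<comment> \<open>The multiple of \<open>e\<^sub>0\<close> makes \<open>d\<^sub>0\<close> and
    \<open>d\<^sub>1\<close> orthogonal without disturbing the pairings with the e-vectors, which
    are orthogonal to each other.\<close>
  define d\<^sub>1 where "d\<^sub>1 = g True - \<omega> (g False) (g True) *\<^sub>R e\<^sub>0"
  have d\<^sub>0: "d\<^sub>0 \<in> V" and d\<^sub>1: "d\<^sub>1 \<in> V"
    using g(1) e\<^sub>0 subspace_carrier by (auto simp: d\<^sub>0_def d\<^sub>1_def intro!: subspace_diff subspace_scale)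
  have de: "\<omega> d\<^sub>0 e\<^sub>0 = 1" "\<omega> d\<^sub>0 e\<^sub>1 = 0" "\<omega> d\<^sub>1 e\<^sub>0 = 0" "\<omega> d\<^sub>1 e\<^sub>1 = 1" "\<omega> d\<^sub>0 d\<^sub>1 = 0"
    using g(2)[of False False] g(2)[of False True] g(2)[of True False] g(2)[of True True] e\<^sub>0e\<^sub>1
    by (simp_all add: d\<^sub>0_def d\<^sub>1_def e_def form_linear self)
  have ed: "\<omega> e\<^sub>0 d\<^sub>0 = - 1" "\<omega> e\<^sub>1 d\<^sub>0 = 0" "\<omega> e\<^sub>0 d\<^sub>1 = 0" "\<omega> e\<^sub>1 d\<^sub>1 = - 1" "\<omega> d\<^sub>1 d\<^sub>0 = 0" "\<omega> e\<^sub>1 e\<^sub>0 = 0"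
    using skew_total[of e\<^sub>0 d\<^sub>0] skew_total[of e\<^sub>1 d\<^sub>0] skew_total[of e\<^sub>0 d\<^sub>1] skew_total[of e\<^sub>1 d\<^sub>1]
      skew_total[of d\<^sub>1 d\<^sub>0] skew_total[of e\<^sub>1 e\<^sub>0] de e\<^sub>0e\<^sub>1 by simp_all
  note dual = de ed e\<^sub>0e\<^sub>1 self
  define d where "d b = (if b then d\<^sub>1 else d\<^sub>0)" for b
  interpret R: symplectic_reduction V br \<omega> UNIV e d
  proof unfold_locales
    fix x and b :: bool assume "x \<in> V"
    then have "br x (e b) = (if b then \<alpha> x *\<^sub>R e True - \<beta> x *\<^sub>R e False else \<alpha> x *\<^sub>R e False + \<beta> x *\<^sub>R e True)"
      using bre\<^sub>0 bre\<^sub>1 by (simp add: e_def)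
    moreover have "e b \<in> span (range e)" for b by (intro span_base) simp
    ultimately show "br x (e b) \<in> span (range e)" by (simp add: span_add span_diff span_scale)
  qed (use e\<^sub>0 e\<^sub>1 d\<^sub>0 d\<^sub>1 dual in \<open>auto simp: e_def d_def\<close>)
  have A_form: "\<omega> x e\<^sub>0 = 0" "\<omega> x e\<^sub>1 = 0" "\<omega> x d\<^sub>0 = 0" "\<omega> x d\<^sub>1 = 0"
      "\<omega> e\<^sub>0 x = 0" "\<omega> e\<^sub>1 x = 0" "\<omega> d\<^sub>0 x = 0" "\<omega> d\<^sub>1 x = 0" if "x \<in> R.A" for x
    using R.A_form[OF that, of False] R.A_form[OF that, of True] by (simp_all add: e_def d_def)
  have proj: "R.proj x = x - (\<omega> x e\<^sub>0 *\<^sub>R d\<^sub>0 + \<omega> x e\<^sub>1 *\<^sub>R d\<^sub>1) - (\<omega> d\<^sub>0 x *\<^sub>R e\<^sub>0 + \<omega> d\<^sub>1 x *\<^sub>R e\<^sub>1)" for x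
    unfolding R.proj_def by (simp add: UNIV_bool e_def d_def)
  have proj0: "R.proj e\<^sub>0 = 0" "R.proj e\<^sub>1 = 0" "R.proj d\<^sub>0 = 0" "R.proj d\<^sub>1 = 0"
    using R.proj_e[of False] R.proj_e[of True] R.proj_d[of False] R.proj_d[of True]
    by (simp_all add: e_def d_def)
  note AV = R.A_subset
  note lp = linear_add[OF R.linear_proj] linear_scale[OF R.linear_proj] linear_diff[OF R.linear_proj]
    linear_neg[OF R.linear_proj]
  have coeff: "\<alpha> x = \<omega> d\<^sub>0 (br x e\<^sub>0)" "\<beta> x = \<omega> d\<^sub>1 (br x e\<^sub>0)" if "x \<in> V" for x
    using bre\<^sub>0[OF that] by (simp_all add: form_linear dual)
  have lin_right: "linear (\<lambda>x. \<omega> u (br w x))" and lin_left: "linear (\<lambda>x. \<omega> u (br x w))" for u w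
    using linear_compose[OF linear_br_right linear_form] linear_compose[OF linear_br_left linear_form]
    by (simp_all add: o_def)
  obtain a\<^sub>0 where a\<^sub>0: "a\<^sub>0 \<in> R.A" "\<And>x. x \<in> R.A \<Longrightarrow> \<omega> a\<^sub>0 x = \<alpha> x"
    using R.representer_A[OF lin_left[of d\<^sub>0 e\<^sub>0]] coeff(1)[OF subsetD[OF AV]] by (metis (lifting))
  obtain a\<^sub>1' where a\<^sub>1': "a\<^sub>1' \<in> R.A" "\<And>x. x \<in> R.A \<Longrightarrow> \<omega> a\<^sub>1' x = \<beta> x"
    using R.representer_A[OF lin_left[of d\<^sub>1 e\<^sub>0]] coeff(2)[OF subsetD[OF AV]] by (metis (lifting))
  \<comment> \<open>In the construction \<open>\<omega> a\<^sub>1 x\<close> is the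
    \<open>e\<^sub>1\<close>-coefficient of \<open>br e\<^sub>0 x\<close>, while \<beta> is that of
    \<open>br x e\<^sub>0\<close>.\<close>
  define a\<^sub>1 where "a\<^sub>1 = - a\<^sub>1'"
  have a\<^sub>1: "a\<^sub>1 \<in> R.A" "\<And>x. x \<in> R.A \<Longrightarrow> \<omega> a\<^sub>1 x = - \<beta> x"
    using a\<^sub>1' R.subspace_A by (auto simp: a\<^sub>1_def form_linear intro: subspace_neg)
  obtain b\<^sub>0 where b\<^sub>0: "b\<^sub>0 \<in> R.A" "\<And>x. x \<in> R.A \<Longrightarrow> \<omega> b\<^sub>0 x = \<omega> d\<^sub>0 (br d\<^sub>0 x)"
    using R.representer_A[OF lin_right[of d\<^sub>0 d\<^sub>0]] by blast
  obtain b\<^sub>1 where b\<^sub>1: "b\<^sub>1 \<in> R.A" "\<And>x. x \<in> R.A \<Longrightarrow> \<omega> b\<^sub>1 x = \<omega> d\<^sub>1 (br d\<^sub>0 x)"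
    using R.representer_A[OF lin_right[of d\<^sub>1 d\<^sub>0]] by blast
  obtain b\<^sub>2 where b\<^sub>2: "b\<^sub>2 \<in> R.A" "\<And>x. x \<in> R.A \<Longrightarrow> \<omega> b\<^sub>2 x = \<omega> d\<^sub>1 (br d\<^sub>1 x)"
    using R.representer_A[OF lin_right[of d\<^sub>1 d\<^sub>1]] by blast
  define z where "z = R.proj (br d\<^sub>0 d\<^sub>1)"
  have z: "z \<in> R.A" unfolding z_def by (rule R.proj_mem[OF br_closed])
  define D\<^sub>0 where "D\<^sub>0 x = R.proj (br d\<^sub>0 x)" for x
  define D\<^sub>1 where "D\<^sub>1 x = R.proj (br d\<^sub>1 x)" for x
  define \<epsilon> where "\<epsilon> k = [\<alpha> d\<^sub>0, \<beta> d\<^sub>0, \<alpha> d\<^sub>1, \<beta> d\<^sub>1, \<omega> d\<^sub>0 (br d\<^sub>0 d\<^sub>1), \<omega> d\<^sub>1 (br d\<^sub>0 d\<^sub>1)] ! k" for k :: nat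
  have \<epsilon>: "\<epsilon> 0 = \<alpha> d\<^sub>0" "\<epsilon> 1 = \<beta> d\<^sub>0" "\<epsilon> 2 = \<alpha> d\<^sub>1" "\<epsilon> 3 = \<beta> d\<^sub>1" "\<epsilon> 4 = \<omega> d\<^sub>0 (br d\<^sub>0 d\<^sub>1)"
    "\<epsilon> 5 = \<omega> d\<^sub>1 (br d\<^sub>0 d\<^sub>1)" by (simp_all add: \<epsilon>_def)
  let ?br = "plane_bracket R.br_A \<omega> a\<^sub>0 a\<^sub>1 b\<^sub>0 b\<^sub>1 b\<^sub>2 z D\<^sub>0 D\<^sub>1 \<epsilon>" and ?\<omega> = "plane_form \<omega>"
  define \<phi> where "\<phi> x = (\<omega> x e\<^sub>0, \<omega> x e\<^sub>1, R.proj x, \<omega> d\<^sub>0 x, \<omega> d\<^sub>1 x)" for x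
  define \<psi> where "\<psi> = (\<lambda>(s\<^sub>0, s\<^sub>1, a, t\<^sub>0, t\<^sub>1). s\<^sub>0 *\<^sub>R d\<^sub>0 + s\<^sub>1 *\<^sub>R d\<^sub>1 + a + t\<^sub>0 *\<^sub>R e\<^sub>0 + t\<^sub>1 *\<^sub>R e\<^sub>1)"
  have \<phi>\<psi>: "\<phi> (s\<^sub>0 *\<^sub>R d\<^sub>0 + s\<^sub>1 *\<^sub>R d\<^sub>1 + a + t\<^sub>0 *\<^sub>R e\<^sub>0 + t\<^sub>1 *\<^sub>R e\<^sub>1) = (s\<^sub>0, s\<^sub>1, a, t\<^sub>0, t\<^sub>1)"
    if "a \<in> R.A" for s\<^sub>0 s\<^sub>1 a t\<^sub>0 t\<^sub>1
    using that by (simp add: \<phi>_def form_linear lp proj0 R.proj_A A_form dual)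
  have decomp: "\<exists>s\<^sub>0 s\<^sub>1 a t\<^sub>0 t\<^sub>1. a \<in> R.A \<and> x = s\<^sub>0 *\<^sub>R d\<^sub>0 + s\<^sub>1 *\<^sub>R d\<^sub>1 + a + t\<^sub>0 *\<^sub>R e\<^sub>0 + t\<^sub>1 *\<^sub>R e\<^sub>1"
    if "x \<in> V" for x
    by (rule exI[of _ "\<omega> x e\<^sub>0"], rule exI[of _ "\<omega> x e\<^sub>1"], rule exI[of _ "R.proj x"],
        rule exI[of _ "\<omega> d\<^sub>0 x"], rule exI[of _ "\<omega> d\<^sub>1 x"])
      (simp add: R.proj_mem[OF that], simp add: proj algebra_simps)
  \<comment> \<open>A vector brackets to zero with itself, so independence kills both weights of
    \<open>e\<^sub>0\<close>, and the plane is abelian.\<close>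
  have "br e\<^sub>0 e\<^sub>0 = \<alpha> e\<^sub>0 *\<^sub>R e\<^sub>0 + \<beta> e\<^sub>0 *\<^sub>R e\<^sub>1" by (rule bre\<^sub>0[OF e\<^sub>0])
  then have "\<alpha> e\<^sub>0 = 0" "\<beta> e\<^sub>0 = 0" using indep[of "\<alpha> e\<^sub>0" "\<beta> e\<^sub>0"] by (simp_all add: br_self_total)
  then have ee: "br e\<^sub>0 e\<^sub>1 = 0" "br e\<^sub>1 e\<^sub>0 = 0" using bre\<^sub>1[OF e\<^sub>0] br_skew[of e\<^sub>1 e\<^sub>0] by simp_all
  have br_expand: "br (s\<^sub>0 *\<^sub>R d\<^sub>0 + s\<^sub>1 *\<^sub>R d\<^sub>1 + a + t\<^sub>0 *\<^sub>R e\<^sub>0 + t\<^sub>1 *\<^sub>R e\<^sub>1)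
        (s\<^sub>0' *\<^sub>R d\<^sub>0 + s\<^sub>1' *\<^sub>R d\<^sub>1 + a' + t\<^sub>0' *\<^sub>R e\<^sub>0 + t\<^sub>1' *\<^sub>R e\<^sub>1)
      = (s\<^sub>0 * s\<^sub>1' - s\<^sub>0' * s\<^sub>1) *\<^sub>R br d\<^sub>0 d\<^sub>1 + (s\<^sub>0 *\<^sub>R br d\<^sub>0 a' - s\<^sub>0' *\<^sub>R br d\<^sub>0 a)
        + (s\<^sub>1 *\<^sub>R br d\<^sub>1 a' - s\<^sub>1' *\<^sub>R br d\<^sub>1 a) + br a a'
        + (t\<^sub>0' * (s\<^sub>0 * \<alpha> d\<^sub>0 + s\<^sub>1 * \<alpha> d\<^sub>1 + \<alpha> a) - t\<^sub>1' * (s\<^sub>0 * \<beta> d\<^sub>0 + s\<^sub>1 * \<beta> d\<^sub>1 + \<beta> a)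
          - t\<^sub>0 * (s\<^sub>0' * \<alpha> d\<^sub>0 + s\<^sub>1' * \<alpha> d\<^sub>1 + \<alpha> a') + t\<^sub>1 * (s\<^sub>0' * \<beta> d\<^sub>0 + s\<^sub>1' * \<beta> d\<^sub>1 + \<beta> a')) *\<^sub>R e\<^sub>0
        + (t\<^sub>0' * (s\<^sub>0 * \<beta> d\<^sub>0 + s\<^sub>1 * \<beta> d\<^sub>1 + \<beta> a) + t\<^sub>1' * (s\<^sub>0 * \<alpha> d\<^sub>0 + s\<^sub>1 * \<alpha> d\<^sub>1 + \<alpha> a)
          - t\<^sub>0 * (s\<^sub>0' * \<beta> d\<^sub>0 + s\<^sub>1' * \<beta> d\<^sub>1 + \<beta> a') - t\<^sub>1 * (s\<^sub>0' * \<alpha> d\<^sub>0 + s\<^sub>1' * \<alpha> d\<^sub>1 + \<alpha> a')) *\<^sub>R e\<^sub>1"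
    if "a \<in> R.A" "a' \<in> R.A" for s\<^sub>0 s\<^sub>1 a t\<^sub>0 t\<^sub>1 s\<^sub>0' s\<^sub>1' a' t\<^sub>0' t\<^sub>1'
  proof -
    have V: "a \<in> V" "a' \<in> V" using that AV by auto
    have 1: "br d\<^sub>1 d\<^sub>0 = - br d\<^sub>0 d\<^sub>1" "br a d\<^sub>0 = - br d\<^sub>0 a" "br a d\<^sub>1 = - br d\<^sub>1 a"
      by (rule br_skew)+
    have 2: "br e\<^sub>0 x = - (\<alpha> x *\<^sub>R e\<^sub>0 + \<beta> x *\<^sub>R e\<^sub>1)" "br e\<^sub>1 x = - (\<alpha> x *\<^sub>R e\<^sub>1 - \<beta> x *\<^sub>R e\<^sub>0)" if "x \<in> V" for x
      using br_skew[of e\<^sub>0 x] br_skew[of e\<^sub>1 x] bre\<^sub>0[OF that] bre\<^sub>1[OF that] by simp_all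
    show ?thesis
      by (simp add: br_linear br_self_total 1 2[OF d\<^sub>0] 2[OF d\<^sub>1] 2[OF V(2)] bre\<^sub>0[OF d\<^sub>0] bre\<^sub>0[OF d\<^sub>1] bre\<^sub>0[OF V(1)]
          bre\<^sub>1[OF d\<^sub>0] bre\<^sub>1[OF d\<^sub>1] bre\<^sub>1[OF V(1)] ee algebra_simps)
  qed
  \<comment> \<open>The origin of the coefficients \<open>\<epsilon> 2 - \<epsilon> 1\<close> and
    \<open>- (\<epsilon> 0 + \<epsilon> 3)\<close> in \<open>br d\<^sub>0 d\<^sub>1\<close>:
    closedness computes them from the weights of the dual vectors.\<close>
  have form_de: "\<omega> (br d\<^sub>0 d\<^sub>1) e\<^sub>0 = \<alpha> d\<^sub>1 - \<beta> d\<^sub>0" "\<omega> (br d\<^sub>0 d\<^sub>1) e\<^sub>1 = - (\<alpha> d\<^sub>0 + \<beta> d\<^sub>1)"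
    using form_br[of d\<^sub>0 d\<^sub>1 e\<^sub>0] form_br[of d\<^sub>0 d\<^sub>1 e\<^sub>1]
    by (simp_all add: bre\<^sub>0[OF d\<^sub>0] bre\<^sub>0[OF d\<^sub>1] bre\<^sub>1[OF d\<^sub>0] bre\<^sub>1[OF d\<^sub>1] form_linear dual)
  have form_dae: "\<omega> (br d\<^sub>0 a) e\<^sub>0 = \<alpha> a" "\<omega> (br d\<^sub>0 a) e\<^sub>1 = - \<beta> a" "\<omega> (br d\<^sub>1 a) e\<^sub>0 = \<beta> a" "\<omega> (br d\<^sub>1 a) e\<^sub>1 = \<alpha> a"
    if "a \<in> R.A" for a
    using form_br[of d\<^sub>0 a e\<^sub>0] form_br[of d\<^sub>0 a e\<^sub>1] form_br[of d\<^sub>1 a e\<^sub>0] form_br[of d\<^sub>1 a e\<^sub>1] that AV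
    by (simp_all add: subset_iff bre\<^sub>0 bre\<^sub>1 d\<^sub>0 d\<^sub>1 form_linear dual A_form)
  have form_aae: "\<omega> (br a a') e\<^sub>0 = 0" "\<omega> (br a a') e\<^sub>1 = 0" if "a \<in> R.A" "a' \<in> R.A" for a a'
    using R.br_A_form_e[OF that, of False] R.br_A_form_e[OF that, of True] by (simp_all add: e_def)
  have form_daa: "\<omega> d\<^sub>0 (br a a') = \<omega> (D\<^sub>0 a) a' + \<omega> a (D\<^sub>0 a')" "\<omega> d\<^sub>1 (br a a') = \<omega> (D\<^sub>1 a) a' + \<omega> a (D\<^sub>1 a')"
    if "a \<in> R.A" "a' \<in> R.A" for a a'
    using R.br_A_form_d[OF that, of False] R.br_A_form_d[OF that, of True]
    by (simp_all add: d_def D\<^sub>0_def D\<^sub>1_def)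
  \<comment> \<open>Closedness on \<open>d\<^sub>0\<close>, \<open>d\<^sub>1\<close>, a explains why
    the construction uses \<open>b\<^sub>1 + z\<close> and not another free vector.\<close>
  have form_zda: "\<omega> d\<^sub>0 (br d\<^sub>1 a) = \<omega> b\<^sub>1 a + \<omega> z a" if "a \<in> R.A" for a
    using form_br[of d\<^sub>0 d\<^sub>1 a] b\<^sub>1(2)[OF that] R.form_proj(1)[OF that, of "br d\<^sub>0 d\<^sub>1"] by (simp add: z_def)
  have \<phi>_br: "\<phi> (br x y) = ?br (\<phi> x) (\<phi> y)" if xy: "x \<in> V" "y \<in> V" for x y
  proof -
    obtain s\<^sub>0 s\<^sub>1 a t\<^sub>0 t\<^sub>1 s\<^sub>0' s\<^sub>1' a' t\<^sub>0' t\<^sub>1' where a: "a \<in> R.A" "a' \<in> R.A"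
      and x: "x = s\<^sub>0 *\<^sub>R d\<^sub>0 + s\<^sub>1 *\<^sub>R d\<^sub>1 + a + t\<^sub>0 *\<^sub>R e\<^sub>0 + t\<^sub>1 *\<^sub>R e\<^sub>1"
      and y: "y = s\<^sub>0' *\<^sub>R d\<^sub>0 + s\<^sub>1' *\<^sub>R d\<^sub>1 + a' + t\<^sub>0' *\<^sub>R e\<^sub>0 + t\<^sub>1' *\<^sub>R e\<^sub>1"
      using decomp[OF xy(1)] decomp[OF xy(2)] by blast
    have D: "R.proj (br d\<^sub>0 u) = D\<^sub>0 u" "R.proj (br d\<^sub>1 u) = D\<^sub>1 u" "R.proj (br u w) = R.br_A u w"
      if "u \<in> R.A" for u w by (simp_all add: D\<^sub>0_def D\<^sub>1_def R.br_A_def)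
    show ?thesis
      unfolding x y br_expand[OF a] \<phi>\<psi>[OF a(1)] \<phi>\<psi>[OF a(2)]
      unfolding plane_bracket.simps \<phi>_def prod.inject \<epsilon>
    proof (intro conjI)
    qed (use a in \<open>simp_all add: form_linear lp proj0 form_de form_dae form_aae form_daa form_zda a\<^sub>0(2) a\<^sub>1(2)
          b\<^sub>0(2) b\<^sub>1(2) b\<^sub>2(2) dual D flip: z_def\<close>, simp_all add: algebra_simps)
  qed
  have \<phi>_form: "?\<omega> (\<phi> x) (\<phi> y) = \<omega> x y" if xy: "x \<in> V" "y \<in> V" for x y
  proof -
    obtain s\<^sub>0 s\<^sub>1 a t\<^sub>0 t\<^sub>1 s\<^sub>0' s\<^sub>1' a' t\<^sub>0' t\<^sub>1' where a: "a \<in> R.A" "a' \<in> R.A"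
      and x: "x = s\<^sub>0 *\<^sub>R d\<^sub>0 + s\<^sub>1 *\<^sub>R d\<^sub>1 + a + t\<^sub>0 *\<^sub>R e\<^sub>0 + t\<^sub>1 *\<^sub>R e\<^sub>1"
      and y: "y = s\<^sub>0' *\<^sub>R d\<^sub>0 + s\<^sub>1' *\<^sub>R d\<^sub>1 + a' + t\<^sub>0' *\<^sub>R e\<^sub>0 + t\<^sub>1' *\<^sub>R e\<^sub>1"
      using decomp[OF xy(1)] decomp[OF xy(2)] by blast
    show ?thesis
      unfolding x y \<phi>\<psi>[OF a(1)] \<phi>\<psi>[OF a(2)] using a by (simp add: form_linear dual A_form algebra_simps)
  qed
  have \<phi>_lin: "linear \<phi>"
    by (rule linearI) (simp_all add: \<phi>_def form_linear lp)
  have \<phi>_mem: "\<phi> x \<in> plane_carrier R.A" if "x \<in> V" for x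
    using R.proj_mem[OF that] by (simp add: \<phi>_def plane_carrier_def)
  have "bij_betw \<phi> V (plane_carrier R.A)"
  proof (rule bij_betw_byWitness[where f' = \<psi>])
    show "\<forall>x\<in>V. \<psi> (\<phi> x) = x" by (simp add: \<psi>_def \<phi>_def proj)
    show "\<forall>u\<in>plane_carrier R.A. \<phi> (\<psi> u) = u" by (auto simp: \<psi>_def plane_carrier_def \<phi>\<psi>)
    show "\<phi> ` V \<subseteq> plane_carrier R.A" using \<phi>_mem by blast
    show "\<psi> ` plane_carrier R.A \<subseteq> V"
      using AV d\<^sub>0 d\<^sub>1 e\<^sub>0 e\<^sub>1 subspace_carrier
      by (auto simp: \<psi>_def plane_carrier_def intro!: subspace_add subspace_scale)
  qed
  then have iso: "symplectic_lie_iso V br \<omega> (plane_carrier R.A) ?br ?\<omega> \<phi>"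
    unfolding symplectic_lie_iso_def using \<phi>_br \<phi>_form \<phi>_mem \<phi>_lin linear_on_linear by blast
  have "subspace (plane_carrier R.A)"
    using R.subspace_A by (auto simp: plane_carrier_def subspace_def zero_prod_def)
  then have "symplectic_lie_algebra (plane_carrier R.A) ?br ?\<omega>"
    by (rule symplectic_transport[OF symplectic_lie_algebra_axioms iso])
  moreover have "linear_on R.A R.A D\<^sub>0" "linear_on R.A R.A D\<^sub>1"
    unfolding D\<^sub>0_def D\<^sub>1_def by (rule R.linear_on_D)+
  ultimately have "is_plane_double_extension V br \<omega> R.A R.br_A \<omega>"
    unfolding is_plane_double_extension_def
    using R.symplectic_A a\<^sub>0(1) a\<^sub>1(1) b\<^sub>0(1) b\<^sub>1(1) b\<^sub>2(1) z iso by blast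
  then show ?thesis using R.symplectic_A R.unimodular_A[OF uni] by blast
qed

lemma double_extension:
  assumes uni: "unimodular V br" and J: "lie_ideal V br J" "isotropic V \<omega> J" "J \<noteq> {0}"
  shows "\<exists>A br\<^sub>A \<omega>\<^sub>A. symplectic_lie_algebra A br\<^sub>A \<omega>\<^sub>A \<and> unimodular A br\<^sub>A \<and>
    (is_line_double_extension V br \<omega> (A :: 'a set) br\<^sub>A \<omega>\<^sub>A \<or> is_plane_double_extension V br \<omega> A br\<^sub>A \<omega>\<^sub>A)"
proof -
  obtain u v \<alpha> \<beta> where uv: "u \<in> J" "v \<in> J" "u \<noteq> 0 \<or> v \<noteq> 0"
    and bru: "\<And>x. x \<in> V \<Longrightarrow> br x u = \<alpha> x *\<^sub>R u - \<beta> x *\<^sub>R v"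
    and brv: "\<And>x. x \<in> V \<Longrightarrow> br x v = \<beta> x *\<^sub>R u + \<alpha> x *\<^sub>R v"
    using ideal_eigenvector[OF uni J(1,3)] by blast
  have V: "u \<in> V" "v \<in> V" using uv J(1) by (auto simp: lie_ideal_def)
  have uv0: "\<omega> u v = 0" using uv J(2) by (auto simp: isotropic_def perp_def)
  \<comment> \<open>If u and v are dependent, a nonzero one of them spans an invariant line;
    otherwise they span an invariant plane.\<close>
  consider "u = 0" | t where "u \<noteq> 0" "v = t *\<^sub>R u" | "u \<noteq> 0" "\<And>t. v \<noteq> t *\<^sub>R u" by blast
  then show ?thesis
  proof cases
    case 1
    then have "br x v = \<alpha> x *\<^sub>R v" if "x \<in> V" for x using brv[OF that] by simp
    from line_extension[OF uni V(2) _ this] show ?thesis using uv(3) 1 by blast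
  next
    case (2 t)
    then have "br x u = (\<alpha> x - \<beta> x * t) *\<^sub>R u" if "x \<in> V" for x using bru[OF that] by (simp add: algebra_simps)
    from line_extension[OF uni V(1) 2(1) this] show ?thesis by blast
  next
    case 3
    have "\<exists>A br\<^sub>A \<omega>\<^sub>A. symplectic_lie_algebra A br\<^sub>A \<omega>\<^sub>A \<and> unimodular A br\<^sub>A \<and>
        is_plane_double_extension V br \<omega> (A :: 'a set) br\<^sub>A \<omega>\<^sub>A"
    \<comment> \<open>Here -v takes the role of \<open>e\<^sub>1\<close>, since multiplication by i
      on u + i v turns the pair u, v against the sign convention of the construction.\<close>
    proof (rule plane_extension[OF uni V(1) subspace_neg[OF subspace_carrier V(2)]])
      show "\<omega> u (- v) = 0" using uv0 by (simp add: form_linear)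
      fix s t assume st: "s *\<^sub>R u + t *\<^sub>R (- v) = 0"
      have "t = 0"
      proof (rule ccontr)
        assume t: "t \<noteq> 0"
        have "inverse t *\<^sub>R t *\<^sub>R v = inverse t *\<^sub>R s *\<^sub>R u" using st by simp
        then show False using 3(2)[of "inverse t * s"] t by simp
      qed
      then show "s = 0 \<and> t = 0" using st 3(1) by simp
    next
      fix x assume x: "x \<in> V"
      show "br x u = \<alpha> x *\<^sub>R u + \<beta> x *\<^sub>R (- v)" using bru[OF x] by simp
      show "br x (- v) = \<alpha> x *\<^sub>R (- v) - \<beta> x *\<^sub>R u" using brv[OF x] by (simp add: br_linear)
    qed
    then show ?thesis by blast
  qed
qed

end

lemma symplectic_lie_iso_cong:
  assumes "\<And>x y. x \<in> V \<Longrightarrow> y \<in> V \<Longrightarrow> br x y = br' x y" "\<And>x y. x \<in> V \<Longrightarrow> y \<in> V \<Longrightarrow> \<omega> x y = \<omega>' x y"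
  shows "symplectic_lie_iso V br \<omega> W b w = symplectic_lie_iso V br' \<omega>' W b w"
  by (rule ext) (simp add: symplectic_lie_iso_def assms cong: ball_cong)

text \<open>Trace, ideals, isotropy and isomorphisms involve the bracket and the form only on V, so
  both may be replaced by the total versions that agree with them there.\<close>

theorem corollary5p2:
  fixes V :: "'a::real_vector set" and br :: "'a \<Rightarrow> 'a \<Rightarrow> 'a" and \<omega> :: "'a \<Rightarrow> 'a \<Rightarrow> real"
  assumes "symplectic_lie_algebra V br \<omega>"
    and "unimodular V br"
    and "\<exists>I. lie_ideal V br I \<and> isotropic V \<omega> I \<and> I \<noteq> {0}"
  shows "\<exists>(A :: 'a set) br\<^sub>A \<omega>\<^sub>A.
    symplectic_lie_algebra A br\<^sub>A \<omega>\<^sub>A \<and> unimodular A br\<^sub>A \<and>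
    (is_line_double_extension V br \<omega> A br\<^sub>A \<omega>\<^sub>A \<or> is_plane_double_extension V br \<omega> A br\<^sub>A \<omega>\<^sub>A)"
proof -
  interpret symplectic_lie_algebra V br \<omega> by fact
  obtain J where J: "lie_ideal V br J" "isotropic V \<omega> J" "J \<noteq> {0}" using assms(3) by blast
  obtain br' \<omega>' where T: "total_symplectic V br' \<omega>'"
    and eq: "\<And>x y. x \<in> V \<Longrightarrow> y \<in> V \<Longrightarrow> br' x y = br x y" "\<And>x y. x \<in> V \<Longrightarrow> y \<in> V \<Longrightarrow> \<omega>' x y = \<omega> x y"
    using total_symplectic_exists[OF assms(1)] by blast
  interpret T: total_symplectic V br' \<omega>' by (rule T)
  have tr_eq: "trace_on V (br' x) = trace_on V (br x)" if x: "x \<in> V" for x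
  proof -
    obtain I :: "'a set" and v c where c: "rv.coords V I v c" using rv.coords_exists[OF fd_carrier] .
    have l: "linear_on V V (br x)" "linear_on V V (br' x)"
      using bilinear_bracket T.bilinear_bracket x by (auto simp: bilinear_on_def)
    have "trace_on V f = (\<Sum>i\<in>I. c i (f (v i)))" if "linear_on V V f" for f
      using that subspace_carrier rv.coords_finite[OF c] rv.coords_mem[OF c] rv.coords_lfun[OF c]
        rv.coords_dual[OF c] rv.coords_expand[OF c]
      by (intro trace_on_coords) (auto intro: linear_on_linear)
    then show ?thesis using l eq(1)[OF x] rv.coords_mem[OF c] by simp
  qed
  have "unimodular V br'" using assms(2) tr_eq by (simp add: unimodular_def)
  moreover have "lie_ideal V br' J" using J(1) eq(1) by (auto simp: lie_ideal_def subset_iff)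
  moreover have "isotropic V \<omega>' J"
    using J(1,2) eq(2) by (auto simp: isotropic_def perp_def lie_ideal_def subset_iff)
  ultimately obtain A br\<^sub>A \<omega>\<^sub>A where A: "symplectic_lie_algebra (A :: 'a set) br\<^sub>A \<omega>\<^sub>A" "unimodular A br\<^sub>A"
    "is_line_double_extension V br' \<omega>' A br\<^sub>A \<omega>\<^sub>A \<or> is_plane_double_extension V br' \<omega>' A br\<^sub>A \<omega>\<^sub>A"
    using T.double_extension J(3) by blast
  note iso_eq = symplectic_lie_iso_cong[of V br' br \<omega>' \<omega>, OF eq]
  have "is_line_double_extension V br \<omega> A br\<^sub>A \<omega>\<^sub>A \<or> is_plane_double_extension V br \<omega> A br\<^sub>A \<omega>\<^sub>A"
    using A(3) unfolding is_line_double_extension_def is_plane_double_extension_def by (simp add: iso_eq)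
  then show ?thesis using A(1,2) by blast
qed

end
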